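(* Let $n\ge 1$, let $p\ge 2$, let $f\in L^1(\mathbb{R}^n)$, and let $V\in L^\infty_{\mathrm{loc}}(\mathbb{R}^n)$ satisfy $V\ge 1$ a.e. and be confining in measure. Then there exists a unique asymptotic energy solution $u\in\Lambda^p(\mathbb{R}^n)$ of \[ -\operatorname{div}\bigl(|\nabla u|^{p-2}\nabla u\bigr)+V|u|^{p-2}u=f\qquad\text{in }\mathbb{R}^n . \] Moreover, for every $\alpha>0$, \[ \|T_\alpha(u)\|_{\mathrm{X}}^p\le \alpha\,\|f\|_{L^1(\mathbb{R}^n)}. \]
   Context: $p'=p/(p-1)$. $V$ is called confining in measure if there exist $\kappa,\gamma>0$ such that the sets $E_R=\{x\in\mathbb{R}^n: |x|\ge R,\ V(x)<\kappa|x|^\gamma\}$ satisfy $|E_R|\to 0$ as $R\to\infty$ ($|\cdot|$ is Lebesgue measure). $\Lambda^p(\mathbb{R}^n)$ is the set of measurable $u:\mathbb{R}^n\to\mathbb{R}$ with $\int_{\mathbb{R}^n}\min(|u|,1)^p\,dx<\infty$, with metric $d(u,v)=\|\min(|u-v|,1)\|_{L^p}$. For $t>0$, $T_t(s)=\max\{-t,\min\{s,t\}\}$. $\mathrm{X}=\{v\in W^{1,p}(\mathbb{R}^n):\int V|v|^p\,dx<\infty\}$ with norm $\|v\|_{\mathrm{X}}=\bigl(\int|\nabla v|^p\,dx+\int V|v|^p\,dx\bigr)^{1/p}$. For $g\in L^1(\mathbb{R}^n)\cap L^{p'}(\mathbb{R}^n)$, a weak energy solution with datum $g$ is $w\in\mathrm{X}$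 with $\int|\nabla w|^{p-2}\nabla w\cdot\nabla\varphi\,dx+\int V|w|^{p-2}w\varphi\,dx=\int g\varphi\,dx$ for all $\varphi\in\mathrm{X}$; such $w$ exists and is unique. A function $u\in\Lambda^p(\mathbb{R}^n)$ is an asymptotic energy solution (with datum $f\in L^1$) if (i) $T_\alpha(u)\in\mathrm{X}$ for every $\alpha>0$, and (ii) there is a sequence $\{f_j\}\subseteq L^1(\mathbb{R}^n)\cap L^{p'}(\mathbb{R}^n)$ with $f_j\to f$ in $L^1$ such that, if $u_j\in\mathrm{X}$ is the weak energy solution with datum $f_j$, then $T_\alpha(u_j-u)\to 0$ in $\mathrm{X}$ for every $\alpha>0$. *)

theory Defs
  imports "HOL-Analysis.Analysis"
begin

text \<open>Functions on R^n are modelled as functions on a Euclidean space 'a (dimension DIM('a) >= 1),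
  with Lebesgue measure. Sobolev functions are concrete functions; uniqueness is up to a.e. equality.\<close>

definition Lp :: "real \<Rightarrow> ('a::euclidean_space \<Rightarrow> real) \<Rightarrow> bool" where
  "Lp p u \<longleftrightarrow> u \<in> borel_measurable lebesgue \<and> integrable lebesgue (\<lambda>x. \<bar>u x\<bar> powr p)"

definition has_partial :: "('a::euclidean_space \<Rightarrow> real) \<Rightarrow> 'a \<Rightarrow> ('a \<Rightarrow> real) \<Rightarrow> bool" where
  "has_partial f i g \<longleftrightarrow> (\<forall>x. ((\<lambda>t. f (x + t *\<^sub>R i)) has_real_derivative g x) (at 0))"

fun Ck :: "nat \<Rightarrow> ('a::euclidean_space \<Rightarrow> real) \<Rightarrow> bool" where
  "Ck 0 f = continuous_on UNIV f"
| "Ck (Suc k) f = (continuous_on UNIV f \<and> (\<forall>i\<in>Basis. \<exists>g. has_partial f i g \<and> Ck k g))"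

definition smooth_fun :: "('a::euclidean_space \<Rightarrow> real) \<Rightarrow> bool" where
  "smooth_fun f \<longleftrightarrow> (\<forall>k. Ck k f)"

definition test_fun :: "('a::euclidean_space \<Rightarrow> real) \<Rightarrow> bool" where
  "test_fun \<phi> \<longleftrightarrow> smooth_fun \<phi> \<and> (\<exists>r. \<forall>x. r < norm x \<longrightarrow> \<phi> x = 0)"

definition loc_integrable :: "('a::euclidean_space \<Rightarrow> real) \<Rightarrow> bool" where
  "loc_integrable u \<longleftrightarrow> u \<in> borel_measurable lebesgue \<and> (\<forall>K. compact K \<longrightarrow> set_integrable lebesgue K u)"

definition has_weak_gradient :: "('a::euclidean_space \<Rightarrow> real) \<Rightarrow> ('a \<Rightarrow> 'a) \<Rightarrow> bool" where
  "has_weak_gradient u G \<longleftrightarrow> loc_integrable u \<and> G \<in> borel_measurable lebesgue \<and>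
     (\<forall>i\<in>Basis. loc_integrable (\<lambda>x. G x \<bullet> i)) \<and>
     (\<forall>\<phi> i g. test_fun \<phi> \<longrightarrow> i \<in> Basis \<longrightarrow> has_partial \<phi> i g \<longrightarrow>
        (\<integral>x. u x * g x \<partial>lebesgue) = - (\<integral>x. (G x \<bullet> i) * \<phi> x \<partial>lebesgue))"

definition wgrad :: "('a::euclidean_space \<Rightarrow> real) \<Rightarrow> ('a \<Rightarrow> 'a)" where
  "wgrad u = (SOME G. has_weak_gradient u G)"

definition W1p :: "real \<Rightarrow> ('a::euclidean_space \<Rightarrow> real) \<Rightarrow> bool" where
  "W1p p u \<longleftrightarrow> Lp p u \<and> (\<exists>G. has_weak_gradient u G \<and> Lp p (\<lambda>x. norm (G x)))"

definition Xspace :: "('a::euclidean_space \<Rightarrow> real) \<Rightarrow> real \<Rightarrow> ('a \<Rightarrow> real) \<Rightarrow> bool" where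
  "Xspace V p v \<longleftrightarrow> W1p p v \<and> integrable lebesgue (\<lambda>x. V x * \<bar>v x\<bar> powr p)"

definition Xnorm :: "('a::euclidean_space \<Rightarrow> real) \<Rightarrow> real \<Rightarrow> ('a \<Rightarrow> real) \<Rightarrow> real" where
  "Xnorm V p v = ((\<integral>x. norm (wgrad v x) powr p \<partial>lebesgue)
                  + (\<integral>x. V x * \<bar>v x\<bar> powr p \<partial>lebesgue)) powr (1 / p)"

definition trunc :: "real \<Rightarrow> real \<Rightarrow> real" where
  "trunc t s = max (- t) (min s t)"

definition Lambda_p :: "real \<Rightarrow> ('a::euclidean_space \<Rightarrow> real) \<Rightarrow> bool" where
  "Lambda_p p u \<longleftrightarrow> u \<in> borel_measurable lebesgue \<and> integrable lebesgue (\<lambda>x. (min \<bar>u x\<bar> 1) powr p)"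

text \<open>Weak energy solution with datum g (g in L^1 cap L^p').\<close>
definition weak_energy_sol ::
  "('a::euclidean_space \<Rightarrow> real) \<Rightarrow> real \<Rightarrow> ('a \<Rightarrow> real) \<Rightarrow> ('a \<Rightarrow> real) \<Rightarrow> bool" where
  "weak_energy_sol V p g w \<longleftrightarrow> Xspace V p w \<and>
     (\<forall>\<phi>. Xspace V p \<phi> \<longrightarrow>
        (\<integral>x. norm (wgrad w x) powr (p - 2) * (wgrad w x \<bullet> wgrad \<phi> x) \<partial>lebesgue)
        + (\<integral>x. V x * \<bar>w x\<bar> powr (p - 2) * w x * \<phi> x \<partial>lebesgue)
        = (\<integral>x. g x * \<phi> x \<partial>lebesgue))"

definition asym_energy_sol ::
  "('a::euclidean_space \<Rightarrow> real) \<Rightarrow> real \<Rightarrow> ('a \<Rightarrow> real) \<Rightarrow> ('a \<Rightarrow> real) \<Rightarrow> bool" where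
  "asym_energy_sol V p f u \<longleftrightarrow> Lambda_p p u \<and>
     (\<forall>\<alpha>>0. Xspace V p (\<lambda>x. trunc \<alpha> (u x))) \<and>
     (\<exists>fs us. (\<forall>j. integrable lebesgue (fs j) \<and> Lp (p / (p - 1)) (fs j)) \<and>
        (\<lambda>j. \<integral>x. \<bar>fs j x - f x\<bar> \<partial>lebesgue) \<longlonglongrightarrow> 0 \<and>
        (\<forall>j. weak_energy_sol V p (fs j) (us j)) \<and>
        (\<forall>\<alpha>>0. (\<forall>j. Xspace V p (\<lambda>x. trunc \<alpha> (us j x - u x))) \<and>
           (\<lambda>j. Xnorm V p (\<lambda>x. trunc \<alpha> (us j x - u x))) \<longlonglongrightarrow> 0))"

definition Linf_loc :: "('a::euclidean_space \<Rightarrow> real) \<Rightarrow> bool" where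
  "Linf_loc V \<longleftrightarrow> V \<in> borel_measurable lebesgue \<and>
     (\<forall>K. compact K \<longrightarrow> (\<exists>C. AE x in lebesgue. x \<in> K \<longrightarrow> \<bar>V x\<bar> \<le> C))"

definition confining_in_measure :: "('a::euclidean_space \<Rightarrow> real) \<Rightarrow> bool" where
  "confining_in_measure V \<longleftrightarrow> (\<exists>\<kappa>>0. \<exists>\<gamma>>0.
     ((\<lambda>R. emeasure lebesgue {x. R \<le> norm x \<and> V x < \<kappa> * norm x powr \<gamma>}) \<longlongrightarrow> 0) at_top)"

end

theory Submission
  imports Defs
begin

text \<open>The operator is strongly monotone for \<open>p \<ge> 2\<close>, which replaces compactness. Testing the equations of two weak energy solutions with the
  truncation of their difference bounds its energy by \<open>\<alpha> \<parallel>f\<^sub>1 - f\<^sub>2\<parallel>\<close> in \<open>L\<^sup>1\<close>, up to a constant. Hence the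
  solutions for truncated data \<open>f\<^sub>j \<longlonglongrightarrow> f\<close> converge almost everywhere to some \<open>u\<close> when the data converge fast enough,
  and uniqueness follows from the same estimate. Solutions for nice data minimise a functional
  that is uniformly convex by Clarkson's inequality, so minimising sequences are Cauchy. The estimates
  pass to the limit since the energy is lower semicontinuous under almost everywhere convergence,
  again by Clarkson's inequality. The chain rule for truncations of Sobolev functions comes from strong
  \<open>L\<^sup>1\<close> convergence of difference quotients on balls.\<close>

section \<open>Smooth functions and test functions\<close>

text \<open>An integrable datum can be paired only with bounded test functions. Testing with a
  truncation bounded by \<open>\<alpha>\<close> is therefore the point where the L^1 norm enters,
  and the factor \<open>\<alpha>\<close> of the final estimate is that bound. Only truncations of
  the limit u are known to lie in X, so u is never tested against its own equation: each fact about
  u is a bound for weak solutions that is uniform in the index and is carried to the limit. In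
  particular the truncation of u_j - u is reached from those of u_j - u_k with j fixed and k
  growing.

  Cauchy arguments share the rate \<open>2 powr (- (p + 1) * real n)\<close> for p-th powers. The
  part \<open>p * real n\<close> pays for multiplying a difference by 2^n, and the remaining 2^(-n)
  makes the integrals summable. This yields almost everywhere convergence together with one L^p
  majorant, so limits become dominated convergence.

  The energy is the sum of the p-th powers of two L^p norms, of the gradient and of V^(1/p) v. Both
  are norms of functions with values in an inner product space, so convexity and monotonicity are
  proved for vectors and then integrated.\<close>

lemma Ck_Suc_imp: "Ck (Suc k) f \<Longrightarrow> Ck k f"
proof (induction k arbitrary: f)
  case (Suc k)
  then show ?case by (metis Ck.simps(2))
qed auto

lemma has_partial_unique: "has_partial f i g \<Longrightarrow> has_partial f i h \<Longrightarrow> g = h"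
  unfolding has_partial_def by (auto intro: DERIV_unique)

lemma Ck_const: "Ck k (\<lambda>x. c)"
proof (induction k arbitrary: c)
  case (Suc k)
  have "has_partial (\<lambda>x. c) i (\<lambda>x. 0)" for i :: 'a
    by (auto simp: has_partial_def)
  then show ?case using Suc by (auto intro!: continuous_intros)
qed auto

lemma has_partial_add:
  "has_partial f i f' \<Longrightarrow> has_partial g i g' \<Longrightarrow> has_partial (\<lambda>x. f x + g x) i (\<lambda>x. f' x + g' x)"
  unfolding has_partial_def by (auto intro!: derivative_eq_intros)

lemma has_partial_mult:
  assumes "has_partial f i f'" "has_partial g i g'"
  shows "has_partial (\<lambda>x. f x * g x) i (\<lambda>x. f' x * g x + g' x * f x)"
  unfolding has_partial_def
proof
  fix x
  have "((\<lambda>t. f (x + t *\<^sub>R i)) has_real_derivative f' x) (at 0)"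
       "((\<lambda>t. g (x + t *\<^sub>R i)) has_real_derivative g' x) (at 0)"
    using assms unfolding has_partial_def by auto
  from DERIV_mult[OF this]
  show "((\<lambda>t. f (x + t *\<^sub>R i) * g (x + t *\<^sub>R i)) has_real_derivative f' x * g x + g' x * f x) (at 0)"
    by simp
qed

lemma Ck_add: "Ck k f \<Longrightarrow> Ck k g \<Longrightarrow> Ck k (\<lambda>x. f x + g x)"
proof (induction k arbitrary: f g)
  case (Suc k)
  show ?case
  proof (simp, intro conjI ballI)
    show "continuous_on UNIV (\<lambda>x. f x + g x)" using Suc.prems by (auto intro!: continuous_intros)
  next
    fix i :: 'a assume i: "i \<in> Basis"
    obtain f' g' where "has_partial f i f'" "Ck k f'" "has_partial g i g'" "Ck k g'"
      using Suc.prems i by (metis Ck.simps(2))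
    then show "\<exists>h. has_partial (\<lambda>x. f x + g x) i h \<and> Ck k h"
      using Suc.IH has_partial_add by blast
  qed
qed (auto intro: continuous_intros)

lemma Ck_mult: "Ck k f \<Longrightarrow> Ck k g \<Longrightarrow> Ck k (\<lambda>x. f x * g x)"
proof (induction k arbitrary: f g)
  case (Suc k)
  show ?case
  proof (simp, intro conjI ballI)
    show "continuous_on UNIV (\<lambda>x. f x * g x)" using Suc.prems by (auto intro!: continuous_intros)
  next
    fix i :: 'a assume i: "i \<in> Basis"
    obtain f' g' where fg: "has_partial f i f'" "Ck k f'" "has_partial g i g'" "Ck k g'"
      using Suc.prems i by (metis Ck.simps(2))
    have "Ck k f" "Ck k g" using Suc.prems Ck_Suc_imp by auto
    then have "Ck k (\<lambda>x. f' x * g x + g' x * f x)" using fg by (intro Ck_add Suc.IH)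
    then show "\<exists>h. has_partial (\<lambda>x. f x * g x) i h \<and> Ck k h"
      using has_partial_mult fg by blast
  qed
qed (auto intro: continuous_intros)

lemma Ck_prod: "(\<And>j. j \<in> J \<Longrightarrow> Ck k (f j)) \<Longrightarrow> Ck k (\<lambda>x. \<Prod>j\<in>J. f j x)"
  by (induction J rule: infinite_finite_induct) (auto simp: Ck_const intro: Ck_mult)

lemma Ck_power: "Ck k f \<Longrightarrow> Ck k (\<lambda>x. f x ^ m)"
  by (induction m) (auto simp: Ck_const intro: Ck_mult)

lemma Ck_one_minus: "Ck k f \<Longrightarrow> Ck k (\<lambda>x. 1 - f x)"
  using Ck_add[OF Ck_const[of k 1] Ck_mult[OF Ck_const[of k "-1"], of f]] by simp

text \<open>A family \<open>D\<close> closed under differentiation lets one induction on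
  \<open>k\<close> treat all iterated derivatives: a partial derivative only contributes the
  constant \<open>c * (j \<bullet> i)\<close> and moves to another member of \<open>D\<close>. It is
  applied to \<open>range flat\<close>.\<close>

lemma Ck_compose_affine:
  assumes D: "\<And>f. f \<in> D \<Longrightarrow> \<exists>f'\<in>D. \<forall>t. (f has_real_derivative f' t) (at t)"
  shows "f \<in> D \<Longrightarrow> Ck k (\<lambda>x. f (c * (x \<bullet> i) + d))"
proof (induction k arbitrary: f)
  have cont: "continuous_on UNIV (\<lambda>x. f (c * (x \<bullet> i) + d))" if "f \<in> D" for f and i :: 'a
  proof -
    have "continuous_on UNIV f" using D[OF that] DERIV_isCont continuous_at_imp_continuous_on by blast
    then show ?thesis by (auto intro!: continuous_on_compose2[where s=UNIV and f="\<lambda>x. c * (x \<bullet> i) + d"] continuous_intros)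
  qed
  case 0
  then show ?case using cont by auto
next
  case (Suc k)
  obtain f' where f': "f' \<in> D" "\<And>t. (f has_real_derivative f' t) (at t)" using D[OF Suc.prems] by blast
  show ?case
  proof (simp, intro conjI ballI)
    have "continuous_on UNIV f" using f' DERIV_isCont continuous_at_imp_continuous_on by blast
    then show "continuous_on UNIV (\<lambda>x. f (c * (x \<bullet> i) + d))"
      by (auto intro!: continuous_on_compose2[where s=UNIV and f="\<lambda>x. c * (x \<bullet> i) + d"] continuous_intros)
  next
    fix j :: 'a assume "j \<in> Basis"
    have "has_partial (\<lambda>x. f (c * (x \<bullet> i) + d)) j (\<lambda>x. (c * (j \<bullet> i)) * f' (c * (x \<bullet> i) + d))"
      unfolding has_partial_def
    proof
      fix x
      have "((\<lambda>t. f (c * ((x + t *\<^sub>R j) \<bullet> i) + d)) has_real_derivative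
          f' (c * ((x + 0 *\<^sub>R j) \<bullet> i) + d) * (c * (j \<bullet> i))) (at 0)"
        by (rule DERIV_chain2[OF f'(2)]) (auto intro!: derivative_eq_intros simp: inner_simps)
      then show "((\<lambda>t. f (c * ((x + t *\<^sub>R j) \<bullet> i) + d)) has_real_derivative c * (j \<bullet> i) * f' (c * (x \<bullet> i) + d)) (at 0)"
        by (simp add: mult_ac)
    qed
    then show "\<exists>g. has_partial (\<lambda>x. f (c * (x \<bullet> i) + d)) j g \<and> Ck k g"
      using Ck_mult[OF Ck_const Suc.IH[OF f'(1)]] by blast
  qed
qed

section \<open>A smooth bump with prescribed box of positivity\<close>

definition flat :: "real poly \<Rightarrow> real \<Rightarrow> real" where
  "flat P t = (if t \<le> 0 then 0 else poly P (1 / t) * exp (- (1 / t)))"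

lemma poly_exp_tendsto_0: "((\<lambda>s. poly P s * exp (- s)) \<longlongrightarrow> 0) at_top" for P :: "real poly"
proof -
  have "((\<lambda>s. \<Sum>i\<le>degree P. coeff P i * (s ^ i / exp s)) \<longlongrightarrow> (\<Sum>i\<le>degree P. coeff P i * 0)) at_top"
    by (intro tendsto_sum tendsto_mult tendsto_const tendsto_power_div_exp_0)
  moreover have "(\<Sum>i\<le>degree P. coeff P i * (s ^ i / exp s)) = poly P s * exp (- s)" for s
    by (simp add: poly_altdef exp_minus sum_distrib_right divide_inverse mult.assoc)
  ultimately show ?thesis by simp
qed

text \<open>With s = 1/t one has ds/dt = -s^2 and d/ds (P(s) e^(-s)) = (P'(s) - P(s)) e^(-s), which
  produces the new polynomial s^2 (P - P'). The polynomial parameter of \<open>flat\<close> exists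
  so that the class is stable under this step.\<close>

lemma flat_DERIV: "(flat P has_real_derivative flat ([:0, 0, 1:] * (P - pderiv P)) t) (at t)"
proof -
  consider "t < 0" | "t > 0" | "t = 0" by linarith
  then show ?thesis
  proof cases
    case 1
    have "((\<lambda>t. 0) has_real_derivative 0) (at t)" by simp
    moreover have "eventually (\<lambda>s. s \<in> {..<0}) (nhds t)" by (rule eventually_nhds_in_open) (use 1 in auto)
    then have "eventually (\<lambda>s. flat P s = 0) (nhds t)" by eventually_elim (auto simp: flat_def)
    ultimately show ?thesis using 1 by (subst DERIV_cong_ev[OF refl _ refl]) (auto simp: flat_def)
  next
    case 2
    have d1: "((\<lambda>t. 1 / t) has_real_derivative - (1 / t)\<^sup>2) (at t)"
      using 2 by (auto intro!: derivative_eq_intros simp: power2_eq_square divide_simps)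
    have "((\<lambda>t. poly P (1 / t) * exp (- (1 / t))) has_real_derivative
        (poly (pderiv P) (1/t) * (- (1 / t)\<^sup>2)) * exp (- (1/t)) + (exp (- (1/t)) * (1/t)\<^sup>2) * poly P (1/t)) (at t)"
    proof (rule DERIV_mult)
      show "((\<lambda>t. poly P (1 / t)) has_real_derivative poly (pderiv P) (1/t) * (- (1 / t)\<^sup>2)) (at t)"
        by (rule DERIV_chain2[OF poly_DERIV d1])
      have "((\<lambda>t. exp (- (1 / t))) has_real_derivative exp (- (1/t)) * (- (- (1 / t)\<^sup>2))) (at t)"
        by (rule DERIV_chain2[OF DERIV_exp]) (rule DERIV_minus[OF d1])
      then show "((\<lambda>t. exp (- (1 / t))) has_real_derivative exp (- (1/t)) * (1/t)\<^sup>2) (at t)" by simp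
    qed
    moreover have "eventually (\<lambda>s. s \<in> {0<..}) (nhds t)" by (rule eventually_nhds_in_open) (use 2 in auto)
    then have "eventually (\<lambda>s. flat P s = poly P (1 / s) * exp (- (1 / s))) (nhds t)"
      by eventually_elim (auto simp: flat_def)
    ultimately show ?thesis using 2
      by (subst DERIV_cong_ev[OF refl _ refl]) (auto simp: flat_def algebra_simps power2_eq_square)
  next
    case 3
    have "((\<lambda>h. flat P h / h) \<longlongrightarrow> 0) (at_left 0)"
      by (rule tendsto_eventually) (auto simp: eventually_at_filter flat_def)
    moreover have "((\<lambda>h. flat P h / h) \<longlongrightarrow> 0) (at_right 0)"
    proof -
      \<comment> \<open>Dividing by h multiplies by s = 1/h, so the difference quotient at 0 is
        again a polynomial in s times e^(-s), now with s going to infinity.\<close>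
      have "((\<lambda>h. poly ([:0,1:] * P) (inverse h) * exp (- inverse h)) \<longlongrightarrow> 0) (at_right 0)"
        by (rule filterlim_compose[OF poly_exp_tendsto_0 filterlim_inverse_at_top_right])
      moreover have "eventually (\<lambda>h. poly ([:0,1:] * P) (inverse h) * exp (- inverse h) = flat P h / h) (at_right 0)"
        by (rule eventually_at_right_less[THEN eventually_mono]) (auto simp: flat_def divide_simps)
      ultimately show ?thesis using tendsto_cong by force
    qed
    ultimately have "((\<lambda>h. flat P h / h) \<longlongrightarrow> 0) (at 0)" by (simp add: filterlim_split_at)
    then show ?thesis using 3 by (simp add: DERIV_def flat_def)
  qed
qed

definition box_bump :: "'a::euclidean_space \<Rightarrow> 'a \<Rightarrow> 'a \<Rightarrow> real" where
  "box_bump a b x = (\<Prod>i\<in>Basis. flat 1 (x \<bullet> i - a \<bullet> i) * flat 1 (b \<bullet> i - x \<bullet> i))"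

lemma Ck_box_bump: "Ck k (box_bump a b)"
proof -
  have *: "\<exists>f'\<in>range flat. \<forall>t. (f has_real_derivative f' t) (at t)" if "f \<in> range flat" for f
    using that flat_DERIV by blast
  have "Ck k (\<lambda>x. flat 1 (x \<bullet> i - a \<bullet> i))" "Ck k (\<lambda>x. flat 1 (b \<bullet> i - x \<bullet> i))" for i :: 'a
    using Ck_compose_affine[OF *, of "flat 1" k 1 i "- (a \<bullet> i)"]
      Ck_compose_affine[OF *, of "flat 1" k "-1" i "b \<bullet> i"] by auto
  then show ?thesis unfolding box_bump_def by (intro Ck_prod Ck_mult) auto
qed

lemma flat_1_bounds: "0 \<le> flat 1 t" "flat 1 t \<le> 1" "0 < flat 1 t \<longleftrightarrow> 0 < t"
  by (auto simp: flat_def)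

lemma box_bump_bounds: "0 \<le> box_bump a b x" "box_bump a b x \<le> 1" 
  unfolding box_bump_def
  by (auto intro!: prod_nonneg prod_le_1 mult_le_one simp: flat_1_bounds)

lemma box_bump_pos_iff: "0 < box_bump a b x \<longleftrightarrow> x \<in> box a b"
proof
  assume "x \<in> box a b"
  then show "0 < box_bump a b x" unfolding box_bump_def
    by (intro prod_pos) (auto simp: mem_box flat_1_bounds)
next
  assume *: "0 < box_bump a b x"
  have "flat 1 (x \<bullet> i - a \<bullet> i) * flat 1 (b \<bullet> i - x \<bullet> i) \<noteq> 0" if "i \<in> Basis" for i
  proof
    assume "flat 1 (x \<bullet> i - a \<bullet> i) * flat 1 (b \<bullet> i - x \<bullet> i) = 0"
    then have "box_bump a b x = 0" unfolding box_bump_def using that by (intro prod_zero) auto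
    then show False using * by simp
  qed
  then have "flat 1 (x \<bullet> i - a \<bullet> i) > 0" "flat 1 (b \<bullet> i - x \<bullet> i) > 0" if "i \<in> Basis" for i
    using that flat_1_bounds(1)[of "x \<bullet> i - a \<bullet> i"] flat_1_bounds(1)[of "b \<bullet> i - x \<bullet> i"]
    by (auto simp: less_le)
  then show "x \<in> box a b" by (auto simp: mem_box flat_1_bounds)
qed

lemma test_fun_diff:
  assumes "test_fun f" "test_fun g" shows "test_fun (\<lambda>x. f x - g x)"
proof -
  obtain r s where "\<And>x. r < norm x \<Longrightarrow> f x = 0" "\<And>x. s < norm x \<Longrightarrow> g x = 0"
    using assms unfolding test_fun_def by blast
  then have "\<forall>x. max r s < norm x \<longrightarrow> f x - g x = 0" by auto
  moreover have "Ck k (\<lambda>x. f x - g x)" for k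
    using assms Ck_add[of k f "\<lambda>x. - 1 * g x"] Ck_mult[OF Ck_const[of k "-1"], of g]
    unfolding test_fun_def smooth_fun_def by auto
  ultimately show ?thesis unfolding test_fun_def smooth_fun_def by blast
qed

lemma test_fun_shift:
  assumes "test_fun f" shows "test_fun (\<lambda>x. f (x + a))"
proof -
  have "Ck k (\<lambda>x. g (x + a))" if "Ck k g" for k g
    using that
  proof (induction k arbitrary: g)
    case 0
    then show ?case by (auto intro!: continuous_on_compose2[of UNIV g] continuous_intros)
  next
    case (Suc k)
    show ?case
    proof (simp, intro conjI ballI)
      show "continuous_on UNIV (\<lambda>x. g (x + a))"
        using Suc.prems by (auto intro!: continuous_on_compose2[of UNIV g] continuous_intros)
      fix i :: 'a assume "i \<in> Basis"
      then obtain h where h: "has_partial g i h" "Ck k h" using Suc.prems by auto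
      have "has_partial (\<lambda>x. g (x + a)) i (\<lambda>x. h (x + a))"
        unfolding has_partial_def
      proof
        fix x
        have "((\<lambda>t. g ((x + a) + t *\<^sub>R i)) has_real_derivative h (x + a)) (at 0)"
          using h by (auto simp: has_partial_def)
        then show "((\<lambda>t. g (x + t *\<^sub>R i + a)) has_real_derivative h (x + a)) (at 0)"
          by (simp add: add_ac)
      qed
      then show "\<exists>h. has_partial (\<lambda>x. g (x + a)) i h \<and> Ck k h" using Suc.IH h by blast
    qed
  qed
  moreover obtain r where r: "\<And>x. r < norm x \<Longrightarrow> f x = 0" using assms unfolding test_fun_def by blast
  have "f (x + a) = 0" if "r + norm a < norm x" for x
    using norm_triangle_ineq4[of "x + a" a] that by (intro r) auto
  ultimately show ?thesis using assms unfolding test_fun_def smooth_fun_def by blast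
qed

lemma test_fun_continuous: "test_fun f \<Longrightarrow> continuous_on UNIV f"
  unfolding test_fun_def smooth_fun_def by (metis Ck.simps(1))

lemma test_fun_has_partial:
  assumes "test_fun f" "i \<in> Basis"
  obtains g where "has_partial f i g" "continuous_on UNIV g"
proof -
  have "Ck (Suc 0) f" using assms unfolding test_fun_def smooth_fun_def by blast
  then show ?thesis using assms that by auto
qed

lemma test_fun_partial_zero:
  assumes "has_partial f i g" "open W" "\<And>x. x \<in> W \<Longrightarrow> f x = 0" "x \<in> W"
  shows "g x = 0"
proof -
  have "((\<lambda>t. x + t *\<^sub>R i) \<longlongrightarrow> x + 0 *\<^sub>R i) (nhds 0)" by (intro tendsto_intros filterlim_ident)
  then have "eventually (\<lambda>t. x + t *\<^sub>R i \<in> W) (nhds 0)"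
    using assms by (auto dest: topological_tendstoD)
  then have "eventually (\<lambda>t. f (x + t *\<^sub>R i) = 0) (nhds 0)" using assms by (auto elim: eventually_mono)
  moreover have "((\<lambda>t. f (x + t *\<^sub>R i)) has_real_derivative g x) (at 0)" using assms by (auto simp: has_partial_def)
  ultimately have "((\<lambda>t. 0) has_real_derivative g x) (at 0)"
    by (subst (asm) DERIV_cong_ev[OF refl _ refl]) auto
  then show ?thesis by (metis DERIV_const DERIV_unique)
qed

lemma bounded_support_bounded:
  fixes f :: "'a::euclidean_space \<Rightarrow> real"
  assumes "continuous_on UNIV f" "\<And>x. r < norm x \<Longrightarrow> f x = 0"
  obtains C where "C > 0" "\<And>x. \<bar>f x\<bar> \<le> C"
proof -
  have "compact (f ` cball 0 r)"
    by (intro compact_continuous_image continuous_on_subset[OF assms(1)]) auto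
  then obtain C where C: "C > 0" "\<And>y. y \<in> f ` cball 0 r \<Longrightarrow> norm y \<le> C"
    by (meson bounded_pos compact_imp_bounded)
  have "\<bar>f x\<bar> \<le> C" for x
    using C assms(2)[of x] by (cases "norm x \<le> r") auto
  then show ?thesis using C that by blast
qed

text \<open>One radius and one constant serve the function and its derivative together; this is the
  form in which dominated convergence consumes test functions.\<close>

lemma test_fun_partial_bounds:
  assumes "test_fun f" "i \<in> Basis" "has_partial f i g"
  shows "\<exists>r C. 0 < r \<and> 0 < C \<and> (\<forall>x. r < norm x \<longrightarrow> f x = 0 \<and> g x = 0) \<and>
    (\<forall>x. \<bar>f x\<bar> \<le> C \<and> \<bar>g x\<bar> \<le> C) \<and> continuous_on UNIV f \<and> continuous_on UNIV g"
proof -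
  obtain r0 where r0: "\<And>x. r0 < norm x \<Longrightarrow> f x = 0" using assms unfolding test_fun_def by blast
  define r where "r = max r0 1"
  have r: "r > 0" "\<And>x. r < norm x \<Longrightarrow> f x = 0" using r0 by (auto simp: r_def)
  have g0: "g x = 0" if "r < norm x" for x
    by (rule test_fun_partial_zero[OF assms(3), of "{x. r < norm x}"]) (use r that in \<open>auto intro!: open_Collect_less continuous_intros\<close>)
  have cg: "continuous_on UNIV g"
    using test_fun_has_partial[OF assms(1,2)] has_partial_unique[OF assms(3)] by blast
  have cf: "continuous_on UNIV f" using assms test_fun_continuous by blast
  obtain C1 where C1: "C1 > 0" "\<And>x. \<bar>f x\<bar> \<le> C1" using bounded_support_bounded[OF cf r(2)] by blast
  obtain C2 where C2: "C2 > 0" "\<And>x. \<bar>g x\<bar> \<le> C2" using bounded_support_bounded[OF cg g0] by blast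
  have "\<bar>f x\<bar> \<le> max C1 C2" "\<bar>g x\<bar> \<le> max C1 C2" for x using C1(2)[of x] C2(2)[of x] by auto
  then show ?thesis using r C1 g0 cg cf by (intro exI[of _ r] exI[of _ "max C1 C2"]) auto
qed

text \<open>With bumps positive exactly on countably many boxes exhausting an open set, raising
  \<open>1 - bump\<close> to high powers drives the product to the indicator of the complement.\<close>

lemma test_fun_approx_open:
  fixes U :: "'a::euclidean_space set"
  assumes "open U"
  obtains \<phi> where "\<And>m. test_fun (\<phi> m)" "\<And>m x. 0 \<le> \<phi> m x" "\<And>m x. \<phi> m x \<le> 1"
    "\<And>m x. x \<notin> U \<Longrightarrow> \<phi> m x = 0" "\<And>x. (\<lambda>m. \<phi> m x) \<longlonglongrightarrow> indicator U x"
proof -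
  obtain D where D: "countable D" "D \<subseteq> Pow U" "\<And>X. X \<in> D \<Longrightarrow> \<exists>a b. X = box a b" "\<Union>D = U"
    by (rule open_countable_Union_open_box[OF assms]) blast
  \<comment> \<open>The empty box makes the family nonempty, so that it is the range of a sequence
    even if \<open>U\<close> is empty.\<close>
  define D' where "D' = insert {} D"
  have D': "countable D'" "D' \<noteq> {}" "\<And>X. X \<in> D' \<Longrightarrow> X \<subseteq> U" "\<Union>D' = U"
    using D by (auto simp: D'_def)
  have "\<exists>a b. X = box a b" if "X \<in> D'" for X
  proof (cases "X = {}")
    case True
    then have "X = box (0::'a) 0" by simp
    then show ?thesis by blast
  qed (use that D(3) D'_def in auto)
  note box = this
  define B where "B = from_nat_into D'"
  have B: "\<And>j. B j \<in> D'" "range B = D'"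
    using range_from_nat_into[OF D'(2,1)] by (auto simp: B_def)
  have "\<exists>a b. B j = box a b" for j using box[OF B(1)] .
  then obtain a b where ab: "\<And>j. B j = box (a j) (b j)" by metis
  \<comment> \<open>The index \<open>m\<close> plays two roles: only \<open>m\<close> boxes are
    used, which keeps the support bounded, and the exponent \<open>m\<close> pushes the values
    towards 1 where some used bump is positive.\<close>
  define \<phi> where "\<phi> m x = 1 - (\<Prod>j\<in>{..<m}. (1 - box_bump (a j) (b j) x)) ^ m" for m :: nat and x
  show thesis
  proof
    have "Ck k (\<phi> m)" for k m
      unfolding \<phi>_def by (intro Ck_one_minus Ck_power Ck_prod Ck_box_bump)
    then have sm: "smooth_fun (\<phi> m)" for m by (auto simp: smooth_fun_def)
    have z: "box_bump (a j) (b j) x = 0" if "x \<notin> B j" for j x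
      using that box_bump_pos_iff[of "a j" "b j" x] box_bump_bounds(1)[of "a j" "b j" x] ab by auto
    have "\<exists>r. \<forall>x. r < norm x \<longrightarrow> \<phi> m x = 0" for m
    proof -
      have "bounded (\<Union>j\<in>{..<m}. B j)" using ab by (auto intro!: bounded_UN)
      then obtain r where r: "\<And>x. x \<in> (\<Union>j\<in>{..<m}. B j) \<Longrightarrow> norm x \<le> r" by (auto simp: bounded_iff)
      have "\<phi> m x = 0" if "r < norm x" for x
      proof -
        have "x \<notin> B j" if "j < m" for j using r[of x] \<open>r < norm x\<close> that by force
        then show ?thesis using z by (simp add: \<phi>_def)
      qed
      then show ?thesis by blast
    qed
    then show "test_fun (\<phi> m)" for m using sm by (auto simp: test_fun_def)
    have P: "0 \<le> (\<Prod>j\<in>{..<m}. (1 - box_bump (a j) (b j) x))" "(\<Prod>j\<in>{..<m}. (1 - box_bump (a j) (b j) x)) \<le> 1" for m x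
      by (auto intro!: prod_nonneg prod_le_1 simp: box_bump_bounds)
    show "0 \<le> \<phi> m x" "\<phi> m x \<le> 1" for m x
      using P[of x m] by (auto simp: \<phi>_def intro: power_le_one)
    show z2: "\<phi> m x = 0" if "x \<notin> U" for m x
    proof -
      have "x \<notin> B j" for j using that B(1)[of j] D'(3) by blast
      then show ?thesis using z by (simp add: \<phi>_def)
    qed
    show "(\<lambda>m. \<phi> m x) \<longlonglongrightarrow> indicator U x" for x
    proof (cases "x \<in> U")
      case False
      then show ?thesis using z2 by simp
    next
      case True
      then obtain j0 where j0: "x \<in> B j0" using D'(4) B(2) by blast
      define q where "q = 1 - box_bump (a j0) (b j0) x"
      have q: "0 \<le> q" "q < 1" using j0 ab box_bump_pos_iff[of "a j0" "b j0" x] box_bump_bounds[of "a j0" "b j0" x] by (auto simp: q_def)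
      have "(\<Prod>j\<in>{..<m}. (1 - box_bump (a j) (b j) x)) \<le> q" if "m > j0" for m
      proof -
        have "(\<Prod>j\<in>{..<m}. (1 - box_bump (a j) (b j) x)) = q * (\<Prod>j\<in>{..<m} - {j0}. (1 - box_bump (a j) (b j) x))"
          using that by (subst prod.remove[of _ j0]) (auto simp: q_def)
        also have "\<dots> \<le> q * 1"
          using q by (intro mult_left_mono prod_le_1) (auto simp: box_bump_bounds)
        finally show ?thesis by simp
      qed
      then have "eventually (\<lambda>m. (\<Prod>j\<in>{..<m}. (1 - box_bump (a j) (b j) x)) ^ m \<le> q ^ m) sequentially"
        using P by (intro eventually_sequentiallyI[of "Suc j0"] power_mono) auto
      then have "eventually (\<lambda>m. norm ((\<Prod>j\<in>{..<m}. (1 - box_bump (a j) (b j) x)) ^ m) \<le> q ^ m) sequentially"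
        by eventually_elim (simp add: norm_power abs_of_nonneg P)
      then have "(\<lambda>m. (\<Prod>j\<in>{..<m}. (1 - box_bump (a j) (b j) x)) ^ m) \<longlonglongrightarrow> 0"
      proof (rule Lim_null_comparison)
        show "(\<lambda>m. q ^ m) \<longlonglongrightarrow> 0" using q by (intro LIMSEQ_power_zero) auto
      qed
      then have "(\<lambda>m. 1 - (\<Prod>j\<in>{..<m}. (1 - box_bump (a j) (b j) x)) ^ m) \<longlonglongrightarrow> 1 - 0"
        by (intro tendsto_diff tendsto_const)
      then show ?thesis using True by (simp add: \<phi>_def)
    qed
  qed
qed

section \<open>Translation and locally integrable functions\<close>

lemma continuous_imp_lebesgue_measurable:
  fixes f :: "'a::euclidean_space \<Rightarrow> 'b::euclidean_space"
  shows "continuous_on UNIV f \<Longrightarrow> f \<in> borel_measurable lebesgue"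
  by (intro measurable_completion) (simp add: borel_measurable_continuous_onI)

lemma lebesgue_translate:
  fixes f :: "'a::euclidean_space \<Rightarrow> real"
  shows "f \<in> borel_measurable lebesgue \<Longrightarrow> (\<lambda>x. f (x + a)) \<in> borel_measurable lebesgue"
    and "integrable lebesgue f \<Longrightarrow> integrable lebesgue (\<lambda>x. f (x + a))"
    and "f \<in> borel_measurable lebesgue \<Longrightarrow> (\<integral>x. f (x + a) \<partial>lebesgue) = (\<integral>x. f x \<partial>lebesgue)"
proof -
  \<comment> \<open>The translation is written coordinatewise with unit factors to match the affine
    change of variables; the resulting density is the constant 1.\<close>
  define T where "T = (\<lambda>x. a + (\<Sum>j\<in>Basis. (1 * (x \<bullet> j)) *\<^sub>R j))"
  have T: "T x = x + a" for x by (simp add: T_def euclidean_representation add.commute)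
  have eq: "lebesgue = density (distr lebesgue lebesgue T) (\<lambda>_. (\<Prod>j\<in>(Basis::'a set). \<bar>1::real\<bar>))"
    unfolding T_def by (rule lebesgue_affine_euclidean) auto
  then have eq: "lebesgue = distr lebesgue lebesgue T" by (simp add: density_1)
  have T_meas: "T \<in> lebesgue \<rightarrow>\<^sub>M lebesgue"
    unfolding T_def by (rule lebesgue_affine_measurable) auto
  show "(\<lambda>x. f (x + a)) \<in> borel_measurable lebesgue" if "f \<in> borel_measurable lebesgue"
    using measurable_compose[OF T_meas that] by (simp add: T)
  show "integrable lebesgue (\<lambda>x. f (x + a))" if "integrable lebesgue f"
  proof -
    have "integrable (distr lebesgue lebesgue T) f" using that eq by simp
    then show ?thesis using integrable_distr[OF T_meas] by (simp add: T)
  qed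
  show "(\<integral>x. f (x + a) \<partial>lebesgue) = (\<integral>x. f x \<partial>lebesgue)" if "f \<in> borel_measurable lebesgue"
    using integral_distr[OF T_meas that] eq by (simp add: T)
qed

lemma indicator_ball_mult_measurable:
  fixes u :: "'a::euclidean_space \<Rightarrow> real"
  shows "u \<in> borel_measurable lebesgue \<Longrightarrow> (\<lambda>x. indicator (ball a R) x * u x) \<in> borel_measurable lebesgue"
  by (intro borel_measurable_times borel_measurable_indicator) auto

lemma loc_integrable_iff_ball:
  "loc_integrable u \<longleftrightarrow> u \<in> borel_measurable lebesgue \<and>
    (\<forall>R. integrable lebesgue (\<lambda>x. indicator (ball 0 R) x * u x))"
proof
  assume u: "loc_integrable u"
  have "integrable lebesgue (\<lambda>x. indicator (ball 0 R) x * u x)" for R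
  proof -
    have "integrable lebesgue (\<lambda>x. indicator (cball 0 R) x *\<^sub>R u x)"
      using u unfolding loc_integrable_def set_integrable_def by auto
    moreover have "(\<lambda>x. indicator (ball 0 R) x * u x) \<in> borel_measurable lebesgue"
      using u unfolding loc_integrable_def by (intro indicator_ball_mult_measurable) auto
    ultimately show ?thesis
      by (rule Bochner_Integration.integrable_bound) (auto simp: indicator_def)
  qed
  then show "u \<in> borel_measurable lebesgue \<and> (\<forall>R. integrable lebesgue (\<lambda>x. indicator (ball 0 R) x * u x))"
    using u by (auto simp: loc_integrable_def)
next
  assume u: "u \<in> borel_measurable lebesgue \<and> (\<forall>R. integrable lebesgue (\<lambda>x. indicator (ball 0 R) x * u x))"
  show "loc_integrable u" unfolding loc_integrable_def set_integrable_def
  proof (intro conjI allI impI)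
    fix K :: "'a set" assume K: "compact K"
    then obtain R where R: "K \<subseteq> ball 0 R" using bounded_subset_ballD compact_imp_bounded by blast
    have [measurable]: "K \<in> sets lebesgue" using K by (auto simp: borel_compact)
    have "integrable lebesgue (\<lambda>x. indicator (ball 0 R) x * u x)" using u by blast
    moreover have "(\<lambda>x. indicator K x *\<^sub>R u x) \<in> borel_measurable lebesgue"
      using u by auto
    ultimately show "integrable lebesgue (\<lambda>x. indicator K x *\<^sub>R u x)"
      by (rule Bochner_Integration.integrable_bound) (use R in \<open>force simp: indicator_def\<close>)
  qed (use u in auto)
qed

lemma loc_integrable_measurable: "loc_integrable u \<Longrightarrow> u \<in> borel_measurable lebesgue"
  by (simp add: loc_integrable_def)

lemma loc_integrable_ball_abs:
  "loc_integrable w \<Longrightarrow> integrable lebesgue (\<lambda>x. indicator (ball 0 R) x * \<bar>w x\<bar>)"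
proof -
  assume "loc_integrable w"
  then have "integrable lebesgue (\<lambda>x. \<bar>indicator (ball 0 R) x * w x\<bar>)"
    unfolding loc_integrable_iff_ball by (intro Bochner_Integration.integrable_abs) blast
  then show ?thesis by (simp add: abs_mult)
qed

lemma loc_integrable_bound:
  assumes "loc_integrable u" "v \<in> borel_measurable lebesgue" "AE x in lebesgue. \<bar>v x\<bar> \<le> \<bar>u x\<bar>"
  shows "loc_integrable v"
  unfolding loc_integrable_iff_ball
proof (intro conjI allI)
  fix R
  have "integrable lebesgue (\<lambda>x. indicator (ball 0 R) x * u x)" using assms by (auto simp: loc_integrable_iff_ball)
  moreover have "(\<lambda>x. indicator (ball 0 R) x * v x) \<in> borel_measurable lebesgue" using assms by (intro indicator_ball_mult_measurable)
  ultimately show "integrable lebesgue (\<lambda>x. indicator (ball 0 R) x * v x)"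
    by (rule Bochner_Integration.integrable_bound) (use assms(3) in \<open>auto simp: indicator_def\<close>)
qed (use assms in auto)

lemma loc_integrable_lincomb:
  assumes "loc_integrable u" "loc_integrable v"
  shows "loc_integrable (\<lambda>x. a * u x + b * v x)"
  unfolding loc_integrable_iff_ball
proof (intro conjI allI)
  fix R
  have "integrable lebesgue (\<lambda>x. a * (indicator (ball 0 R) x * u x) + b * (indicator (ball 0 R) x * v x))"
    using assms by (auto simp: loc_integrable_iff_ball)
  then show "integrable lebesgue (\<lambda>x. indicator (ball 0 R) x * (a * u x + b * v x))"
    by (simp add: algebra_simps)
qed (use assms in \<open>auto simp: loc_integrable_iff_ball\<close>)

lemma loc_integrable_diff: "loc_integrable u \<Longrightarrow> loc_integrable v \<Longrightarrow> loc_integrable (\<lambda>x. u x - v x)"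
  using loc_integrable_lincomb[of u v 1 "-1"] by simp

lemma loc_integrable_shift:
  assumes "loc_integrable u" shows "loc_integrable (\<lambda>x. u (x + a))"
  unfolding loc_integrable_iff_ball
proof (intro conjI allI)
  have um: "u \<in> borel_measurable lebesgue" using assms by (auto simp: loc_integrable_iff_ball)
  then show m: "(\<lambda>x. u (x + a)) \<in> borel_measurable lebesgue" using lebesgue_translate by blast
  fix R
  have "integrable lebesgue (\<lambda>x. indicator (ball 0 (R + norm a)) x * u x)"
    using assms by (auto simp: loc_integrable_iff_ball)
  then have i: "integrable lebesgue (\<lambda>x. indicator (ball 0 (R + norm a)) (x + a) * u (x + a))"
    by (rule lebesgue_translate(2))
  have m2: "(\<lambda>x. indicator (ball 0 R) x * u (x + a)) \<in> borel_measurable lebesgue"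
    using m by (intro indicator_ball_mult_measurable)
  have "norm (x + a) < R + norm a" if "norm x < R" for x
    using norm_triangle_ineq[of x a] that by linarith
  then show "integrable lebesgue (\<lambda>x. indicator (ball 0 R) x * u (x + a))"
    by (intro Bochner_Integration.integrable_bound[OF i m2] AE_I2) (auto simp: indicator_def)
qed

lemma loc_integrable_mult_bounded:
  assumes "loc_integrable u" "h \<in> borel_measurable lebesgue" "\<And>x. \<bar>h x\<bar> \<le> C" "\<And>x. r < norm x \<Longrightarrow> h x = 0"
  shows "integrable lebesgue (\<lambda>x. u x * h x)"
proof -
  \<comment> \<open>The extra 1 makes the open ball contain the sphere of radius \<open>r\<close>,
    where \<open>h\<close> may still be nonzero.\<close>
  have i: "integrable lebesgue (\<lambda>x. C * (indicator (ball 0 (r + 1)) x * u x))"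
    using assms by (auto simp: loc_integrable_iff_ball)
  have m: "(\<lambda>x. u x * h x) \<in> borel_measurable lebesgue" using assms by (auto simp: loc_integrable_iff_ball)
  have C0: "0 \<le> C" using assms(3)[of 0] by linarith
  have "norm (u x * h x) \<le> norm (C * (indicator (ball 0 (r + 1)) x * u x))" for x
  proof (cases "r < norm x")
    case True then show ?thesis using assms(4) by simp
  next
    case False
    then have "indicator (ball 0 (r + 1)) x = (1::real)" by (auto simp: indicator_def)
    moreover have "\<bar>u x\<bar> * \<bar>h x\<bar> \<le> \<bar>u x\<bar> * C" by (rule mult_left_mono[OF assms(3)]) auto
    ultimately show ?thesis using C0 by (simp add: abs_mult mult.commute)
  qed
  then show ?thesis by (intro Bochner_Integration.integrable_bound[OF i m] AE_I2) auto
qed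

lemma loc_integrable_test_mult:
  assumes "loc_integrable u" "test_fun \<phi>"
  shows "integrable lebesgue (\<lambda>x. u x * \<phi> x)"
proof -
  obtain r where r: "\<And>x. r < norm x \<Longrightarrow> \<phi> x = 0" using assms by (auto simp: test_fun_def)
  have c: "continuous_on UNIV \<phi>" using assms test_fun_continuous by blast
  obtain C where "\<And>x. \<bar>\<phi> x\<bar> \<le> C" using bounded_support_bounded[OF c r] by blast
  then show ?thesis using loc_integrable_mult_bounded[OF assms(1)] r c continuous_imp_lebesgue_measurable by blast
qed

lemma loc_integrable_const: "loc_integrable (\<lambda>x. c)"
proof -
  have "integrable lebesgue (\<lambda>x::'a. indicator (ball 0 R) x * c)" for R
    using lmeasurable_ball[of "0::'a" R] by (auto simp: fmeasurable_def)
  then show ?thesis by (simp add: loc_integrable_iff_ball)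
qed

lemma test_fun_integrable: "test_fun \<phi> \<Longrightarrow> integrable lebesgue \<phi>"
  using loc_integrable_test_mult[OF loc_integrable_const[of 1], of \<phi>] by simp

lemma test_fun_partial_integrable:
  assumes "loc_integrable u" "test_fun \<phi>" "i \<in> Basis" "has_partial \<phi> i h"
  shows "integrable lebesgue (\<lambda>x. u x * h x)"
proof -
  obtain r C where *: "\<forall>x. r < norm x \<longrightarrow> h x = 0" "\<forall>x. \<bar>h x\<bar> \<le> C" "continuous_on UNIV h"
    using test_fun_partial_bounds[OF assms(2,3,4)] by auto
  then show ?thesis
    by (intro loc_integrable_mult_bounded[OF assms(1) continuous_imp_lebesgue_measurable, of h C r]) auto
qed

text \<open>Outer regularity encloses \<open>A\<close> in an open set of measure larger by less than
  e/2. Cutting that set with \<open>W\<close> keeps the support inside \<open>W\<close>, and the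
  bumps for the resulting open set converge to its indicator in L^1, which costs the other
  e/2.\<close>

lemma test_fun_approx_set:
  fixes A W :: "'a::euclidean_space set"
  assumes A: "A \<in> lmeasurable" and W: "open W" "A \<subseteq> W" and e: "e > 0"
  obtains \<phi> where "test_fun \<phi>" "\<And>x. 0 \<le> \<phi> x" "\<And>x. \<phi> x \<le> 1" "\<And>x. x \<notin> W \<Longrightarrow> \<phi> x = 0"
    "(\<integral>x. \<bar>\<phi> x - indicator A x\<bar> \<partial>lebesgue) < e"
proof -
  obtain T where T: "open T" "A \<subseteq> T" "(T - A) \<in> lmeasurable" "emeasure lebesgue (T - A) < ennreal (e/2)"
    using sets_lebesgue_outer_open[of A "e/2"] A e by auto
  define U where "U = T \<inter> W"
  have U: "open U" "A \<subseteq> U" "U \<subseteq> W" using T W by (auto simp: U_def)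
  have Um [measurable]: "U \<in> sets lebesgue" "A \<in> sets lebesgue" using U A by auto
  have TA: "A \<union> (T - A) = T" using T by auto
  have Tm: "T \<in> lmeasurable" using fmeasurable.Un[OF A T(3)] unfolding TA .
  have UT: "U \<subseteq> T" by (simp add: U_def)
  have Ufin: "U \<in> lmeasurable" by (rule fmeasurableI2[OF Tm UT Um(1)])
  have "measure lebesgue (U - A) \<le> measure lebesgue (T - A)"
    by (rule measure_mono_fmeasurable[OF _ _ T(3)]) (use UT in auto)
  also have "\<dots> < e/2" using T(3,4) e by (simp add: emeasure_eq_measure2 ennreal_less_iff)
  finally have UA: "measure lebesgue (U - A) < e/2" .
  obtain \<phi> where \<phi>: "\<And>m. test_fun (\<phi> m)" "\<And>m x. 0 \<le> \<phi> m x" "\<And>m x. \<phi> m x \<le> 1"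
    "\<And>m x. x \<notin> U \<Longrightarrow> \<phi> m x = 0" "\<And>x. (\<lambda>m. \<phi> m x) \<longlonglongrightarrow> indicator U x"
    by (rule test_fun_approx_open[OF U(1)]) blast
  have iU: "integrable lebesgue (indicator U :: 'a \<Rightarrow> real)"
    using Ufin by (simp add: lmeasurable_iff_integrable)
  have iA: "integrable lebesgue (indicator A :: 'a \<Rightarrow> real)"
    using A by (simp add: lmeasurable_iff_integrable)
  have m: "\<phi> m \<in> borel_measurable lebesgue" for m
    using \<phi>(1) test_fun_integrable borel_measurable_integrable by blast
  have "(\<lambda>m. \<integral>x. \<bar>\<phi> m x - indicator U x\<bar> \<partial>lebesgue) \<longlonglongrightarrow> (\<integral>(x::'a). 0 \<partial>lebesgue)"
  proof (rule integral_dominated_convergence[where w="indicator U"])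
    show "AE x in lebesgue. (\<lambda>m. \<bar>\<phi> m x - indicator U x\<bar>) \<longlonglongrightarrow> 0"
      using \<phi>(5) by (intro AE_I2) (auto intro!: tendsto_rabs_zero simp: LIM_zero_iff)
    show "AE x in lebesgue. norm \<bar>\<phi> m x - indicator U x\<bar> \<le> indicator U x" for m
    proof (intro AE_I2)
      fix x
      show "norm \<bar>\<phi> m x - indicator U x\<bar> \<le> indicator U x"
        using \<phi>(2)[of m x] \<phi>(3)[of m x] \<phi>(4)[of x m] by (cases "x \<in> U") auto
    qed
  qed (use iU m in auto)
  then have "eventually (\<lambda>m. (\<integral>x. \<bar>\<phi> m x - indicator U x\<bar> \<partial>lebesgue) < e/2) sequentially"
    using e by (intro order_tendstoD(2)) auto
  then obtain m0 where m0: "(\<integral>x. \<bar>\<phi> m0 x - indicator U x\<bar> \<partial>lebesgue) < e/2"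
    by (auto simp: eventually_sequentially)
  have i\<phi>: "integrable lebesgue (\<phi> m0)" by (rule test_fun_integrable[OF \<phi>(1)])
  have i1: "integrable lebesgue (\<lambda>x. \<bar>\<phi> m0 x - indicator U x\<bar>)" using iU i\<phi> by auto
  have i2: "integrable lebesgue (\<lambda>x. \<bar>indicator U x - indicator A x\<bar> :: real)" using iU iA by auto
  have "(\<integral>x. \<bar>\<phi> m0 x - indicator A x\<bar> \<partial>lebesgue) \<le> (\<integral>x. \<bar>\<phi> m0 x - indicator U x\<bar> + \<bar>indicator U x - indicator A x\<bar> \<partial>lebesgue)"
    by (rule integral_mono) (use i1 i2 iA i\<phi> in auto)
  also have "\<dots> = (\<integral>x. \<bar>\<phi> m0 x - indicator U x\<bar> \<partial>lebesgue) + (\<integral>x. \<bar>indicator U x - indicator A x\<bar> \<partial>lebesgue)"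
    using i1 i2 by simp
  also have "(\<lambda>x. \<bar>indicator U x - indicator A x\<bar> :: real) = indicator (U - A)"
    using U by (auto simp: fun_eq_iff indicator_def)
  also have "(\<integral>x. indicator (U - A) x \<partial>lebesgue) = measure lebesgue (U - A)" by simp
  finally have "(\<integral>x. \<bar>\<phi> m0 x - indicator A x\<bar> \<partial>lebesgue) < e" using m0 UA by linarith
  then show thesis using that[of "\<phi> m0"] \<phi> U by blast
qed

section \<open>Continuity of translation in L^1\<close>

lemma translation_tendsto_continuous:
  fixes f :: "'a::euclidean_space \<Rightarrow> real"
  assumes c: "continuous_on UNIV f" and r: "\<And>x. r < norm x \<Longrightarrow> f x = 0"
  shows "((\<lambda>h. \<integral>x. \<bar>f (x + h) - f x\<bar> \<partial>lebesgue) \<longlongrightarrow> 0) (at 0)"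
  unfolding tendsto_at_iff_sequentially
proof (intro allI impI)
  fix X :: "nat \<Rightarrow> 'a" assume X: "X \<longlonglongrightarrow> 0"
  obtain C where C: "\<And>x. \<bar>f x\<bar> \<le> C" using bounded_support_bounded[OF c r] by blast
  obtain K where K: "\<And>n. norm (X n) \<le> K" using X by (meson BseqE convergentI convergent_imp_Bseq)
  have m: "f \<in> borel_measurable lebesgue" using c by (rule continuous_imp_lebesgue_measurable)
  have "(\<lambda>n. \<integral>x. \<bar>f (x + X n) - f x\<bar> \<partial>lebesgue) \<longlonglongrightarrow> (\<integral>(x::'a). 0 \<partial>lebesgue)"
  proof (rule integral_dominated_convergence[where w="\<lambda>x. 2 * C * indicator (cball (0::'a) (r + K)) x"])
    show "AE x in lebesgue. (\<lambda>n. \<bar>f (x + X n) - f x\<bar>) \<longlonglongrightarrow> 0"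
    proof (intro AE_I2 tendsto_rabs_zero)
      fix x
      have "(\<lambda>n. x + X n) \<longlonglongrightarrow> x + 0" by (intro tendsto_intros X)
      moreover have "isCont f (x + 0)" using c continuous_on_eq_continuous_at by blast
      ultimately have "(\<lambda>n. f (x + X n)) \<longlonglongrightarrow> f (x + 0)" by (rule isCont_tendsto_compose[rotated])
      then show "(\<lambda>n. f (x + X n) - f x) \<longlonglongrightarrow> 0" by (simp add: LIM_zero_iff)
    qed
    show "AE x in lebesgue. norm \<bar>f (x + X n) - f x\<bar> \<le> 2 * C * indicator (cball 0 (r + K)) x" for n
    proof (intro AE_I2)
      fix x
      show "norm \<bar>f (x + X n) - f x\<bar> \<le> 2 * C * indicator (cball 0 (r + K)) x"
      proof (cases "norm x \<le> r + K")
        case True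
        then show ?thesis using C[of x] C[of "x + X n"] by (auto simp: indicator_def)
      next
        case False
        moreover have "0 \<le> K" using K[of 0] norm_ge_zero[of "X 0"] by linarith
        moreover have "norm x - norm (X n) \<le> norm (x + X n)" by (rule norm_diff_ineq)
        ultimately have "r < norm x" "r < norm (x + X n)" using K[of n] by linarith+
        then show ?thesis using r False by simp
      qed
    qed
    show "integrable lebesgue (\<lambda>x. 2 * C * indicator (cball (0::'a) (r + K)) x :: real)"
      using lmeasurable_cball[of "0::'a" "r + K"] by (intro integrable_mult_right) (simp add: lmeasurable_iff_integrable)
  qed (use m lebesgue_translate(1)[OF m] in auto)
  then show "((\<lambda>h. \<integral>x. \<bar>f (x + h) - f x\<bar> \<partial>lebesgue) \<circ> X) \<longlonglongrightarrow> 0" by (simp add: o_def)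
qed

text \<open>Translation preserves the L^1 distance, so the error between \<open>f\<close> and its
  approximant \<open>g\<close> counts twice and the translation error of \<open>g\<close> once:
  three thirds of \<open>e\<close>.\<close>

lemma translation_tendsto_approx:
  fixes f :: "'a::euclidean_space \<Rightarrow> real"
  assumes f: "integrable lebesgue f"
    and approx: "\<And>e. e > 0 \<Longrightarrow> \<exists>g. integrable lebesgue g \<and> (\<integral>x. \<bar>g x - f x\<bar> \<partial>lebesgue) < e \<and>
      ((\<lambda>h. \<integral>x. \<bar>g (x + h) - g x\<bar> \<partial>lebesgue) \<longlongrightarrow> 0) (at 0)"
  shows "((\<lambda>h. \<integral>x. \<bar>f (x + h) - f x\<bar> \<partial>lebesgue) \<longlongrightarrow> 0) (at 0)"
proof (rule order_tendstoI)
  fix e :: real assume "e > 0"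
  then obtain g where g: "integrable lebesgue g" "(\<integral>x. \<bar>g x - f x\<bar> \<partial>lebesgue) < e/3"
    "((\<lambda>h. \<integral>x. \<bar>g (x + h) - g x\<bar> \<partial>lebesgue) \<longlongrightarrow> 0) (at 0)"
    using approx[of "e/3"] by auto
  have "eventually (\<lambda>h. (\<integral>x. \<bar>g (x + h) - g x\<bar> \<partial>lebesgue) < e/3) (at 0)"
    using g(3) \<open>e > 0\<close> by (intro order_tendstoD(2)) auto
  then show "eventually (\<lambda>h. (\<integral>x. \<bar>f (x + h) - f x\<bar> \<partial>lebesgue) < e) (at 0)"
  proof eventually_elim
    case (elim h)
    have i: "integrable lebesgue (\<lambda>x. g (x + h))" "integrable lebesgue (\<lambda>x. f (x + h))"
      using lebesgue_translate(2)[OF f] lebesgue_translate(2)[OF g(1)] by auto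
    have "(\<integral>x. \<bar>f (x + h) - f x\<bar> \<partial>lebesgue) \<le> (\<integral>x. \<bar>g (x + h) - f (x + h)\<bar> + (\<bar>g (x + h) - g x\<bar> + \<bar>g x - f x\<bar>) \<partial>lebesgue)"
      by (rule integral_mono) (use i f g(1) in auto)
    also have "\<dots> = (\<integral>x. \<bar>g (x + h) - f (x + h)\<bar> \<partial>lebesgue) + ((\<integral>x. \<bar>g (x + h) - g x\<bar> \<partial>lebesgue) + (\<integral>x. \<bar>g x - f x\<bar> \<partial>lebesgue))"
      using i f g(1) by simp
    also have "(\<integral>x. \<bar>g (x + h) - f (x + h)\<bar> \<partial>lebesgue) = (\<integral>x. \<bar>g x - f x\<bar> \<partial>lebesgue)"
      by (rule lebesgue_translate(3)[of "\<lambda>x. \<bar>g x - f x\<bar>"]) (use f g(1) in auto)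
    finally show ?case using elim g by linarith
  qed
next
  fix e :: real assume "e < 0"
  have "e < (\<integral>x. \<bar>f (x + h) - f x\<bar> \<partial>lebesgue)" for h
    by (rule less_le_trans[OF \<open>e < 0\<close>]) (auto intro: integral_nonneg_AE)
  then show "eventually (\<lambda>h. e < (\<integral>x. \<bar>f (x + h) - f x\<bar> \<partial>lebesgue)) (at 0)" by auto
qed

text \<open>Indicators are approximated by test functions, for which uniform bounds and a common
  support give the claim; sums follow from the triangle inequality and limits from the approximation
  lemma.\<close>

lemma translation_tendsto_L1:
  fixes f :: "'a::euclidean_space \<Rightarrow> real"
  assumes "integrable lebesgue f"
  shows "((\<lambda>h. \<integral>x. \<bar>f (x + h) - f x\<bar> \<partial>lebesgue) \<longlongrightarrow> 0) (at 0)"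
  using assms
proof (induction rule: integrable_induct)
  case (base A c)
  show ?case
  proof (rule translation_tendsto_approx)
    have Al: "A \<in> lmeasurable" using base by (auto simp: fmeasurable_def)
    show iA: "integrable lebesgue (\<lambda>x. indicator A x *\<^sub>R c)" using base by auto
    fix e :: real assume e: "e > 0"
    \<comment> \<open>Adding 1 in the denominator covers c = 0 and makes
      \<open>\<bar>c\<bar> * d\<close> strictly smaller than \<open>e\<close>.\<close>
    define d where "d = e / (1 + \<bar>c\<bar>)"
    have d: "d > 0" "\<bar>c\<bar> * d < e" using e by (auto simp: d_def divide_simps)
    obtain \<phi> where \<phi>: "test_fun \<phi>" "(\<integral>x. \<bar>\<phi> x - indicator A x\<bar> \<partial>lebesgue) < d"
      by (rule test_fun_approx_set[OF Al open_UNIV subset_UNIV d(1)]) blast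
    obtain r where r: "\<And>x. r < norm x \<Longrightarrow> \<phi> x = 0" using \<phi> by (auto simp: test_fun_def)
    have "(\<lambda>x. \<bar>\<phi> x * c - indicator A x *\<^sub>R c\<bar>) = (\<lambda>x. \<bar>c\<bar> * \<bar>\<phi> x - indicator A x\<bar>)"
      by (auto simp: abs_mult[symmetric] algebra_simps)
    then have "(\<integral>x. \<bar>\<phi> x * c - indicator A x *\<^sub>R c\<bar> \<partial>lebesgue) = \<bar>c\<bar> * (\<integral>x. \<bar>\<phi> x - indicator A x\<bar> \<partial>lebesgue)"
      by simp
    also have "\<dots> \<le> \<bar>c\<bar> * d" using \<phi> by (intro mult_left_mono) auto
    finally have "(\<integral>x. \<bar>\<phi> x * c - indicator A x *\<^sub>R c\<bar> \<partial>lebesgue) < e" using d by linarith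
    moreover have "((\<lambda>h. \<integral>x. \<bar>\<phi> (x + h) * c - \<phi> x * c\<bar> \<partial>lebesgue) \<longlongrightarrow> 0) (at 0)"
      by (rule translation_tendsto_continuous[of _ r]) (use r test_fun_continuous[OF \<phi>(1)] in \<open>auto intro!: continuous_intros\<close>)
    moreover have "integrable lebesgue (\<lambda>x. \<phi> x * c)" using test_fun_integrable[OF \<phi>(1)] by auto
    ultimately show "\<exists>g. integrable lebesgue g \<and> (\<integral>x. \<bar>g x - indicator A x *\<^sub>R c\<bar> \<partial>lebesgue) < e \<and>
      ((\<lambda>h. \<integral>x. \<bar>g (x + h) - g x\<bar> \<partial>lebesgue) \<longlongrightarrow> 0) (at 0)" by blast
  qed
next
  case (add f g)
  have lim0: "((\<lambda>h. (\<integral>x. \<bar>f (x + h) - f x\<bar> \<partial>lebesgue) + (\<integral>x. \<bar>g (x + h) - g x\<bar> \<partial>lebesgue)) \<longlongrightarrow> 0 + 0) (at 0)"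
    by (intro tendsto_add add.IH)
  have le: "norm (\<integral>x. \<bar>f (x + h) + g (x + h) - (f x + g x)\<bar> \<partial>lebesgue) \<le>
      (\<integral>x. \<bar>f (x + h) - f x\<bar> \<partial>lebesgue) + (\<integral>x. \<bar>g (x + h) - g x\<bar> \<partial>lebesgue)" for h
  proof -
    have i: "integrable lebesgue (\<lambda>x. f (x + h))" "integrable lebesgue (\<lambda>x. g (x + h))"
      using lebesgue_translate(2)[OF add.hyps(1)] lebesgue_translate(2)[OF add.hyps(2)] by auto
    have "(\<integral>x. \<bar>f (x + h) + g (x + h) - (f x + g x)\<bar> \<partial>lebesgue) \<le> (\<integral>x. \<bar>f (x + h) - f x\<bar> + \<bar>g (x + h) - g x\<bar> \<partial>lebesgue)"
      by (rule integral_mono) (use i add.hyps in auto)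
    then show ?thesis using i add.hyps by simp
  qed
  show ?case
    by (rule Lim_null_comparison[OF _ lim0[unfolded add_0_left]]) (intro always_eventually allI le)
next
  case (lim f s)
  show ?case
  proof (rule translation_tendsto_approx)
    fix e :: real assume e: "e > 0"
    \<comment> \<open>The induction rule supplies approximants with
      \<open>\<bar>s n x\<bar> \<le> 2 * \<bar>f x\<bar>\<close>, hence the majorant with factor
      3.\<close>
    have "(\<lambda>n. \<integral>x. \<bar>s n x - f x\<bar> \<partial>lebesgue) \<longlonglongrightarrow> (\<integral>(x::'a). 0 \<partial>lebesgue)"
    proof (rule integral_dominated_convergence[where w="\<lambda>x. 3 * \<bar>f x\<bar>"])
      show "AE x in lebesgue. (\<lambda>n. \<bar>s n x - f x\<bar>) \<longlonglongrightarrow> 0"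
        using lim.hyps(2) by (intro AE_I2) (auto intro!: tendsto_rabs_zero simp: LIM_zero_iff)
      have "norm \<bar>s n x - f x\<bar> \<le> 3 * \<bar>f x\<bar>" for x n
        using lim.hyps(3)[of x n] by auto
      then show "AE x in lebesgue. norm \<bar>s n x - f x\<bar> \<le> 3 * \<bar>f x\<bar>" for n by auto
    qed (use lim.hyps(1,4) in auto)
    then have "eventually (\<lambda>n. (\<integral>x. \<bar>s n x - f x\<bar> \<partial>lebesgue) < e) sequentially"
      using e by (intro order_tendstoD(2)) auto
    then obtain n where "(\<integral>x. \<bar>s n x - f x\<bar> \<partial>lebesgue) < e" by (auto simp: eventually_sequentially)
    then show "\<exists>g. integrable lebesgue g \<and> (\<integral>x. \<bar>g x - f x\<bar> \<partial>lebesgue) < e \<and>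
      ((\<lambda>h. \<integral>x. \<bar>g (x + h) - g x\<bar> \<partial>lebesgue) \<longlongrightarrow> 0) (at 0)"
      using lim.hyps(1) lim.IH by blast
  qed (rule lim.hyps(4))
qed

text \<open>Shifts shorter than 1 keep the ball of radius R inside that of radius R + 1, so the
  locally integrable function may be replaced by its integrable cut-off there.\<close>

lemma translation_tendsto_ball:
  fixes f :: "'a::euclidean_space \<Rightarrow> real"
  assumes "loc_integrable f"
  shows "((\<lambda>h. \<integral>x. indicator (ball 0 R) x * \<bar>f (x + h) - f x\<bar> \<partial>lebesgue) \<longlongrightarrow> 0) (at 0)"
proof -
  define F where "F x = indicator (ball 0 (R + 1)) x * f x" for x
  have F: "integrable lebesgue F" using assms unfolding F_def loc_integrable_iff_ball by auto
  have "eventually (\<lambda>h. h \<in> ball 0 1) (at (0::'a))" by (rule eventually_at_in_open') auto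
  then have ev: "eventually (\<lambda>h. norm (\<integral>x. indicator (ball 0 R) x * \<bar>f (x + h) - f x\<bar> \<partial>lebesgue) \<le> (\<integral>x. \<bar>F (x + h) - F x\<bar> \<partial>lebesgue)) (at 0)"
  proof eventually_elim
    case (elim h)
    have "norm x < R \<Longrightarrow> norm (x + h) < R + 1" for x using norm_triangle_ineq[of x h] elim by auto
    then have "indicator (ball 0 R) x * \<bar>f (x + h) - f x\<bar> \<le> \<bar>F (x + h) - F x\<bar>" for x
      by (auto simp: F_def indicator_def)
    moreover have "integrable lebesgue (\<lambda>x. \<bar>F (x + h) - F x\<bar>)" using F lebesgue_translate(2)[OF F] by auto
    ultimately have "(\<integral>x. indicator (ball 0 R) x * \<bar>f (x + h) - f x\<bar> \<partial>lebesgue) \<le> (\<integral>x. \<bar>F (x + h) - F x\<bar> \<partial>lebesgue)"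
      by (intro integral_mono') auto
    then show ?case by (simp add: integral_nonneg_AE)
  qed
  show ?thesis by (rule Lim_null_comparison[OF ev translation_tendsto_L1[OF F]])
qed

section \<open>Weak partial derivatives\<close>

text \<open>The ideal test function is the sign of \<open>w\<close> on the ball. It is the
  difference of the indicators of \<open>P\<close> and \<open>N\<close>; each is approximated by
  test functions with values in [0, 1], so their difference stays within [-1, 1] and is admissible
  in the hypothesis.\<close>

lemma test_fun_duality:
  fixes w :: "'a::euclidean_space \<Rightarrow> real"
  assumes w: "loc_integrable w"
    and le: "\<And>\<phi>. test_fun \<phi> \<Longrightarrow> (\<forall>x. \<bar>\<phi> x\<bar> \<le> 1) \<Longrightarrow> (\<forall>x. x \<notin> ball 0 R \<longrightarrow> \<phi> x = 0) \<Longrightarrow>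
      \<bar>\<integral>x. w x * \<phi> x \<partial>lebesgue\<bar> \<le> M"
  shows "(\<integral>x. indicator (ball 0 R) x * \<bar>w x\<bar> \<partial>lebesgue) \<le> M"
proof -
  define P where "P = {x. 0 < w x} \<inter> ball 0 R"
  define N where "N = {x. w x < 0} \<inter> ball 0 R"
  have wm [measurable]: "w \<in> borel_measurable lebesgue" by (rule loc_integrable_measurable[OF w])
  have "{x \<in> space lebesgue. 0 < w x} \<in> sets lebesgue" "{x \<in> space lebesgue. w x < 0} \<in> sets lebesgue"
    by measurable
  then have Wm: "{x. 0 < w x} \<in> sets lebesgue" "{x. w x < 0} \<in> sets lebesgue" by simp_all
  have P: "P \<in> lmeasurable" unfolding P_def
    by (rule fmeasurableI2[OF lmeasurable_ball[of 0 R]]) (use Wm in auto)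
  have N: "N \<in> lmeasurable" unfolding N_def
    by (rule fmeasurableI2[OF lmeasurable_ball[of 0 R]]) (use Wm in auto)
  have ex: "\<exists>\<phi>. test_fun \<phi> \<and> (\<forall>x. 0 \<le> \<phi> x \<and> \<phi> x \<le> 1) \<and> (\<forall>x. x \<notin> ball 0 R \<longrightarrow> \<phi> x = 0) \<and>
      (\<integral>x. \<bar>\<phi> x - indicator A x\<bar> \<partial>lebesgue) < 1 / real (Suc n)"
    if A: "A \<in> lmeasurable" "A \<subseteq> ball 0 R" for A n
  proof -
    have "(0::real) < 1 / real (Suc n)" by simp
    then show ?thesis
      by (rule test_fun_approx_set[OF A(1) open_ball A(2)]) blast
  qed
  have "\<forall>n. \<exists>\<phi>. test_fun \<phi> \<and> (\<forall>x. 0 \<le> \<phi> x \<and> \<phi> x \<le> 1) \<and> (\<forall>x. x \<notin> ball 0 R \<longrightarrow> \<phi> x = 0) \<and>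
      (\<integral>x. \<bar>\<phi> x - indicator P x\<bar> \<partial>lebesgue) < 1 / real (Suc n)"
    using ex[OF P] by (simp add: P_def)
  then obtain \<phi> where \<phi>: "\<And>n. test_fun (\<phi> n)" "\<And>n x. 0 \<le> \<phi> n x" "\<And>n x. \<phi> n x \<le> 1" "\<And>n x. x \<notin> ball 0 R \<Longrightarrow> \<phi> n x = 0"
      "\<And>n. (\<integral>x. \<bar>\<phi> n x - indicator P x\<bar> \<partial>lebesgue) < 1 / real (Suc n)"
    by metis
  have "\<forall>n. \<exists>\<phi>. test_fun \<phi> \<and> (\<forall>x. 0 \<le> \<phi> x \<and> \<phi> x \<le> 1) \<and> (\<forall>x. x \<notin> ball 0 R \<longrightarrow> \<phi> x = 0) \<and>
      (\<integral>x. \<bar>\<phi> x - indicator N x\<bar> \<partial>lebesgue) < 1 / real (Suc n)"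
    using ex[OF N] by (simp add: N_def)
  then obtain \<psi> where \<psi>: "\<And>n. test_fun (\<psi> n)" "\<And>n x. 0 \<le> \<psi> n x" "\<And>n x. \<psi> n x \<le> 1" "\<And>n x. x \<notin> ball 0 R \<Longrightarrow> \<psi> n x = 0"
      "\<And>n. (\<integral>x. \<bar>\<psi> n x - indicator N x\<bar> \<partial>lebesgue) < 1 / real (Suc n)"
    by metis
  \<comment> \<open>The error against the sign function tends to 0 in L^1, hence almost everywhere
    along a subsequence, and \<open>w\<close> on the ball is then a majorant of the
    pairings.\<close>
  define u where "u n x = (\<phi> n x - indicator P x) - (\<psi> n x - indicator N x)" for n x
  have i: "integrable lebesgue (\<phi> n)" "integrable lebesgue (\<psi> n)" for n
    by (rule test_fun_integrable, rule \<phi> \<psi>)+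
  have iPN: "integrable lebesgue (indicator P :: 'a \<Rightarrow> real)" "integrable lebesgue (indicator N :: 'a \<Rightarrow> real)"
    using P N by (simp_all add: lmeasurable_iff_integrable)
  have iu: "integrable lebesgue (u n)" for n
    unfolding u_def by (intro Bochner_Integration.integrable_diff i iPN)
  have u0: "(\<lambda>n. \<integral>x. norm (u n x) \<partial>lebesgue) \<longlonglongrightarrow> 0"
  proof (rule Lim_null_comparison)
    have "norm (\<integral>x. norm (u n x) \<partial>lebesgue) \<le> 2 * inverse (real (Suc n))" for n
    proof -
      have "(\<integral>x. norm (u n x) \<partial>lebesgue) \<le> (\<integral>x. \<bar>\<phi> n x - indicator P x\<bar> + \<bar>\<psi> n x - indicator N x\<bar> \<partial>lebesgue)"
        by (rule integral_mono) (use iu[of n] i[of n] iPN in \<open>auto simp: u_def\<close>)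
      also have "\<dots> = (\<integral>x. \<bar>\<phi> n x - indicator P x\<bar> \<partial>lebesgue) + (\<integral>x. \<bar>\<psi> n x - indicator N x\<bar> \<partial>lebesgue)"
        using i[of n] iPN by simp
      finally show ?thesis using \<phi>(5)[of n] \<psi>(5)[of n] by (simp add: inverse_eq_divide)
    qed
    then show "\<forall>\<^sub>F n in sequentially. norm (\<integral>x. norm (u n x) \<partial>lebesgue) \<le> 2 * inverse (real (Suc n))"
      by (rule always_eventually[OF allI])
    show "(\<lambda>n. 2 * inverse (real (Suc n))) \<longlonglongrightarrow> 0"
      using tendsto_mult[OF tendsto_const[of "2::real"] LIMSEQ_inverse_real_of_nat] by simp
  qed
  obtain r where r: "strict_mono r" "AE x in lebesgue. (\<lambda>n. u (r n) x) \<longlonglongrightarrow> 0"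
    using tendsto_L1_AE_subseq[OF iu u0] by blast
  have tf: "test_fun (\<lambda>x. \<phi> n x - \<psi> n x)" for n by (rule test_fun_diff[OF \<phi>(1) \<psi>(1)])
  have bd: "\<bar>\<phi> n x - \<psi> n x\<bar> \<le> 1" for n x
    using \<phi>(2,3)[of n x] \<psi>(2,3)[of n x] by linarith
  note iw = loc_integrable_ball_abs[OF w, of R]
  have "(\<lambda>n. \<integral>x. w x * (\<phi> (r n) x - \<psi> (r n) x) \<partial>lebesgue) \<longlonglongrightarrow> (\<integral>x. indicator (ball 0 R) x * \<bar>w x\<bar> \<partial>lebesgue)"
  proof (rule integral_dominated_convergence[OF _ _ iw])
    show "(\<lambda>x. indicator (ball 0 R) x * \<bar>w x\<bar>) \<in> borel_measurable lebesgue"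
      using iw by (rule borel_measurable_integrable)
    show "(\<lambda>x. w x * (\<phi> (r n) x - \<psi> (r n) x)) \<in> borel_measurable lebesgue" for n
      using loc_integrable_test_mult[OF w tf] by (rule borel_measurable_integrable)
    show "AE x in lebesgue. (\<lambda>n. w x * (\<phi> (r n) x - \<psi> (r n) x)) \<longlonglongrightarrow> indicator (ball 0 R) x * \<bar>w x\<bar>"
      using r(2)
    proof eventually_elim
      case (elim x)
      have "(\<lambda>n. w x * (u (r n) x + (indicator P x - indicator N x))) \<longlonglongrightarrow> w x * (0 + (indicator P x - indicator N x))"
        by (intro tendsto_mult tendsto_add tendsto_const elim)
      moreover have "w x * (0 + (indicator P x - indicator N x)) = indicator (ball 0 R) x * \<bar>w x\<bar>"
        by (auto simp: P_def N_def indicator_def)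
      ultimately show ?case by (simp add: u_def algebra_simps)
    qed
    show "AE x in lebesgue. norm (w x * (\<phi> (r n) x - \<psi> (r n) x)) \<le> indicator (ball 0 R) x * \<bar>w x\<bar>" for n
    proof (rule AE_I2)
      fix x
      show "norm (w x * (\<phi> (r n) x - \<psi> (r n) x)) \<le> indicator (ball 0 R) x * \<bar>w x\<bar>"
      proof (cases "x \<in> ball 0 R")
        case True
        have "\<bar>w x\<bar> * \<bar>\<phi> (r n) x - \<psi> (r n) x\<bar> \<le> \<bar>w x\<bar> * 1" by (intro mult_left_mono bd) auto
        then show ?thesis using True by (simp add: abs_mult)
      next
        case False
        then show ?thesis using \<phi>(4)[OF False] \<psi>(4)[OF False] by simp
      qed
    qed
  qed
  moreover have "(\<integral>x. w x * (\<phi> (r n) x - \<psi> (r n) x) \<partial>lebesgue) \<le> M" for n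
  proof -
    have "\<bar>\<integral>x. w x * (\<phi> (r n) x - \<psi> (r n) x) \<partial>lebesgue\<bar> \<le> M"
    proof (rule le[OF tf])
      show "\<forall>x. \<bar>\<phi> (r n) x - \<psi> (r n) x\<bar> \<le> 1" using bd by blast
      show "\<forall>x. x \<notin> ball 0 R \<longrightarrow> \<phi> (r n) x - \<psi> (r n) x = 0"
        using \<phi>(4)[of _ "r n"] \<psi>(4)[of _ "r n"] by simp
    qed
    then show ?thesis by linarith
  qed
  ultimately show ?thesis by (intro LIMSEQ_le_const2) auto
qed

text \<open>Vanishing pairings allow the duality bound with M = 0 on every ball of integer radius,
  and countably many such balls cover the space.\<close>

lemma fundamental_lemma:
  fixes w :: "'a::euclidean_space \<Rightarrow> real"
  assumes w: "loc_integrable w" and z: "\<And>\<phi>. test_fun \<phi> \<Longrightarrow> (\<integral>x. w x * \<phi> x \<partial>lebesgue) = 0"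
  shows "AE x in lebesgue. w x = 0"
proof -
  have "AE x in lebesgue. x \<in> ball 0 (real n) \<longrightarrow> w x = 0" for n :: nat
  proof -
    have i: "integrable lebesgue (\<lambda>x. \<bar>indicator (ball 0 (real n)) x * w x\<bar>)"
      using w unfolding loc_integrable_iff_ball by (intro Bochner_Integration.integrable_abs) blast
    have eq: "\<bar>indicator (ball 0 (real n)) x * w x\<bar> = indicator (ball 0 (real n)) x * \<bar>w x\<bar>" for x
      by (simp add: abs_mult)
    have "(\<integral>x. indicator (ball 0 (real n)) x * \<bar>w x\<bar> \<partial>lebesgue) \<le> 0"
      by (rule test_fun_duality[OF w]) (simp add: z)
    then have "(\<integral>x. \<bar>indicator (ball 0 (real n)) x * w x\<bar> \<partial>lebesgue) = 0"
      unfolding eq by (intro antisym integral_nonneg_AE) auto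
    then have "AE x in lebesgue. \<bar>indicator (ball 0 (real n)) x * w x\<bar> = 0"
      using integral_nonneg_eq_0_iff_AE[OF i] by simp
    then show ?thesis by eventually_elim (auto simp: indicator_def)
  qed
  then have "AE x in lebesgue. \<forall>n::nat. x \<in> ball 0 (real n) \<longrightarrow> w x = 0"
    unfolding AE_all_countable by blast
  then show ?thesis
  proof eventually_elim
    case (elim x)
    obtain n :: nat where "norm x < real n" using reals_Archimedean2 by blast
    then show ?case using elim by auto
  qed
qed

text \<open>A single coordinate of \<open>has_weak_gradient\<close>, separated from the
  integrability conditions because difference quotients and truncations are treated one direction at
  a time.\<close>

definition weak_partial :: "('a::euclidean_space \<Rightarrow> real) \<Rightarrow> 'a \<Rightarrow> ('a \<Rightarrow> real) \<Rightarrow> bool" where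
  "weak_partial u i g \<longleftrightarrow> (\<forall>\<phi> h. test_fun \<phi> \<longrightarrow> has_partial \<phi> i h \<longrightarrow>
     (\<integral>x. u x * h x \<partial>lebesgue) = - (\<integral>x. g x * \<phi> x \<partial>lebesgue))"

lemma weak_partialD: "weak_partial u i g \<Longrightarrow> test_fun \<phi> \<Longrightarrow> has_partial \<phi> i h \<Longrightarrow>
    (\<integral>x. u x * h x \<partial>lebesgue) = - (\<integral>x. g x * \<phi> x \<partial>lebesgue)"
  unfolding weak_partial_def by blast

lemma weak_partial_unique:
  assumes i: "i \<in> Basis" and g: "loc_integrable g" "weak_partial u i g" and h: "loc_integrable h" "weak_partial u i h"
  shows "AE x in lebesgue. g x = h x"
proof -
  have "AE x in lebesgue. g x - h x = 0"
  proof (rule fundamental_lemma[OF loc_integrable_diff[OF g(1) h(1)]])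
    fix \<phi> :: "'a \<Rightarrow> real" assume \<phi>: "test_fun \<phi>"
    obtain d where d: "has_partial \<phi> i d" using test_fun_has_partial[OF \<phi> i] by blast
    have "(\<integral>x. (g x - h x) * \<phi> x \<partial>lebesgue) = (\<integral>x. g x * \<phi> x \<partial>lebesgue) - (\<integral>x. h x * \<phi> x \<partial>lebesgue)"
      using loc_integrable_test_mult[OF g(1) \<phi>] loc_integrable_test_mult[OF h(1) \<phi>]
      by (simp add: left_diff_distrib)
    then show "(\<integral>x. (g x - h x) * \<phi> x \<partial>lebesgue) = 0"
      using weak_partialD[OF g(2) \<phi> d] weak_partialD[OF h(2) \<phi> d] by linarith
  qed
  then show ?thesis by eventually_elim simp
qed

section \<open>Difference quotients of weakly differentiable functions\<close>

lemma has_partial_line: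
  assumes "has_partial f i g"
  shows "((\<lambda>t. f (x + t *\<^sub>R i)) has_real_derivative g (x + t *\<^sub>R i)) (at t)"
proof -
  have "((\<lambda>s. f ((x + t *\<^sub>R i) + s *\<^sub>R i)) has_real_derivative g (x + t *\<^sub>R i)) (at 0)"
    using assms unfolding has_partial_def by blast
  then have "((\<lambda>s. f (x + (s + t) *\<^sub>R i)) has_real_derivative g (x + t *\<^sub>R i)) (at 0)"
    by (simp add: algebra_simps)
  then show ?thesis using DERIV_shift[of "\<lambda>s. f (x + s *\<^sub>R i)" _ 0 t] by simp
qed

lemma has_partial_shift: "has_partial f i g \<Longrightarrow> has_partial (\<lambda>x. f (x + a)) i (\<lambda>x. g (x + a))"
  unfolding has_partial_def
proof
  fix x assume "\<forall>x. ((\<lambda>t. f (x + t *\<^sub>R i)) has_real_derivative g x) (at 0)"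
  then have "((\<lambda>t. f ((x + a) + t *\<^sub>R i)) has_real_derivative g (x + a)) (at 0)" by blast
  then show "((\<lambda>t. f (x + t *\<^sub>R i + a)) has_real_derivative g (x + a)) (at 0)" by (simp add: add_ac)
qed

text \<open>The translation acts on the test function, so all differentiation falls on it and local
  integrability of \<open>u\<close> suffices. The quotients \<open>q n\<close> are bounded by the
  mean value inequality and live in one ball, because the steps are bounded by
  \<open>K\<close>.\<close>

lemma translated_pairing_DERIV_0:
  fixes u :: "'a::euclidean_space \<Rightarrow> real"
  assumes u: "loc_integrable u" and i: "i \<in> Basis" and \<phi>: "test_fun \<phi>" "has_partial \<phi> i h"
  shows "((\<lambda>s. \<integral>x. u x * \<phi> (x - s *\<^sub>R i) \<partial>lebesgue) has_real_derivative
           - (\<integral>x. u x * h x \<partial>lebesgue)) (at 0)"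
  unfolding DERIV_def tendsto_at_iff_sequentially
proof (intro allI impI)
  fix X :: "nat \<Rightarrow> real" assume X0: "\<forall>n. X n \<in> UNIV - {0}" and X: "X \<longlonglongrightarrow> 0"
  obtain r C where rC: "0 < r" "0 < C" "\<forall>x. r < norm x \<longrightarrow> \<phi> x = 0 \<and> h x = 0"
    "\<forall>x. \<bar>\<phi> x\<bar> \<le> C \<and> \<bar>h x\<bar> \<le> C" "continuous_on UNIV \<phi>" "continuous_on UNIV h"
    using test_fun_partial_bounds[OF \<phi>(1) i \<phi>(2)] by blast
  obtain K where K: "\<And>n. norm (X n) \<le> K" using X by (meson BseqE convergentI convergent_imp_Bseq)
  have K0: "0 \<le> K" using K[of 0] norm_ge_zero[of "X 0"] by linarith
  define q where "q n x = (\<phi> (x - X n *\<^sub>R i) - \<phi> x) / X n" for n x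
  have hm: "h \<in> borel_measurable lebesgue" "\<phi> \<in> borel_measurable lebesgue"
    using rC by (simp_all add: continuous_imp_lebesgue_measurable)
  have um: "u \<in> borel_measurable lebesgue" by (rule loc_integrable_measurable[OF u])
  have qm: "q n \<in> borel_measurable lebesgue" for n
    unfolding q_def using hm(2) lebesgue_translate(1)[OF hm(2), of "- (X n *\<^sub>R i)"] by simp
  have qb: "\<bar>q n x\<bar> \<le> C" for n x
  proof -
    have "norm (\<phi> (x + (- X n) *\<^sub>R i) - \<phi> (x + 0 *\<^sub>R i)) \<le> C * norm (- X n - 0)"
      by (rule field_differentiable_bound[where S=UNIV and f'="\<lambda>t. h (x + t *\<^sub>R i)"])
        (use rC has_partial_line[OF \<phi>(2)] in auto)
    then show ?thesis using X0 by (auto simp: q_def divide_simps)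
  qed
  have q0: "q n x = 0" if "r + K < norm x" for n x
  proof -
    have "norm x - norm (X n *\<^sub>R i) \<le> norm (x - X n *\<^sub>R i)" by (rule norm_triangle_ineq2)
    moreover have "norm (X n *\<^sub>R i) \<le> K" using K[of n] i by simp
    ultimately have "r < norm x" "r < norm (x - X n *\<^sub>R i)" using that K0 by linarith+
    then show ?thesis using rC by (simp add: q_def)
  qed
  have qlim: "(\<lambda>n. q n x) \<longlonglongrightarrow> - h x" for x
  proof -
    have "((\<lambda>t. \<phi> (x + t *\<^sub>R i)) has_real_derivative h x) (at 0)" using \<phi>(2) by (simp add: has_partial_def)
    then have "((\<lambda>t. (\<phi> (x + t *\<^sub>R i) - \<phi> x) / t) \<longlongrightarrow> h x) (at 0)" by (simp add: DERIV_def)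
    moreover have "filterlim (\<lambda>n. - X n) (at 0) sequentially"
      using X0 tendsto_minus[OF X] by (auto simp: filterlim_at)
    ultimately have "(\<lambda>n. (\<phi> (x + (- X n) *\<^sub>R i) - \<phi> x) / (- X n)) \<longlonglongrightarrow> h x"
      by (rule filterlim_compose)
    then have "(\<lambda>n. - ((\<phi> (x + (- X n) *\<^sub>R i) - \<phi> x) / (- X n))) \<longlonglongrightarrow> - h x" by (rule tendsto_minus)
    then show ?thesis by (simp add: q_def)
  qed
  have iC: "integrable lebesgue (\<lambda>x. C * (indicator (ball 0 (r + K + 1)) x * \<bar>u x\<bar>))"
    using loc_integrable_ball_abs[OF u] by simp
  have "(\<lambda>n. \<integral>x. u x * q n x \<partial>lebesgue) \<longlonglongrightarrow> (\<integral>x. u x * (- h x) \<partial>lebesgue)"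
  proof (rule integral_dominated_convergence[OF _ _ iC])
    show "(\<lambda>x. u x * - h x) \<in> borel_measurable lebesgue" "\<And>n. (\<lambda>x. u x * q n x) \<in> borel_measurable lebesgue"
      using um hm qm by simp_all
    show "AE x in lebesgue. (\<lambda>n. u x * q n x) \<longlonglongrightarrow> u x * - h x"
      by (intro AE_I2 tendsto_mult tendsto_const qlim)
    show "AE x in lebesgue. norm (u x * q n x) \<le> C * (indicator (ball 0 (r + K + 1)) x * \<bar>u x\<bar>)" for n
    proof (rule AE_I2)
      fix x
      show "norm (u x * q n x) \<le> C * (indicator (ball 0 (r + K + 1)) x * \<bar>u x\<bar>)"
      proof (cases "r + K < norm x")
        case True then show ?thesis using q0[OF True] rC by simp
      next
        case False
        then have "indicator (ball 0 (r + K + 1)) x = (1::real)" by (auto simp: indicator_def)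
        moreover have "\<bar>u x\<bar> * \<bar>q n x\<bar> \<le> \<bar>u x\<bar> * C" by (intro mult_left_mono qb) auto
        ultimately show ?thesis by (simp add: abs_mult mult.commute)
      qed
    qed
  qed
  moreover have "(\<integral>x. u x * q n x \<partial>lebesgue) =
     ((\<integral>x. u x * \<phi> (x - (0 + X n) *\<^sub>R i) \<partial>lebesgue) - (\<integral>x. u x * \<phi> (x - 0 *\<^sub>R i) \<partial>lebesgue)) / X n" for n
  proof -
    have "integrable lebesgue (\<lambda>x. u x * \<phi> (x - X n *\<^sub>R i))" "integrable lebesgue (\<lambda>x. u x * \<phi> x)"
      using loc_integrable_test_mult[OF u test_fun_shift[OF \<phi>(1), of "- (X n *\<^sub>R i)"]] loc_integrable_test_mult[OF u \<phi>(1)]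
      by simp_all
    then have "(\<integral>x. u x * \<phi> (x - X n *\<^sub>R i) - u x * \<phi> x \<partial>lebesgue) / X n =
      ((\<integral>x. u x * \<phi> (x - X n *\<^sub>R i) \<partial>lebesgue) - (\<integral>x. u x * \<phi> x \<partial>lebesgue)) / X n" by simp
    moreover have "u x * q n x = (u x * \<phi> (x - X n *\<^sub>R i) - u x * \<phi> x) / X n" for x
      by (simp add: q_def right_diff_distrib diff_divide_distrib)
    ultimately show ?thesis by simp
  qed
  ultimately show "((\<lambda>s. ((\<integral>x. u x * \<phi> (x - (0 + s) *\<^sub>R i) \<partial>lebesgue) - (\<integral>x. u x * \<phi> (x - 0 *\<^sub>R i) \<partial>lebesgue)) / s) \<circ> X)
      \<longlonglongrightarrow> - (\<integral>x. u x * h x \<partial>lebesgue)"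
    by (simp add: o_def)
qed

text \<open>Translating the test function moves the derivative at 0 to any \<open>s\<close>, and the
  weak derivative turns it into a pairing with \<open>g\<close>. A weakly differentiable
  \<open>u\<close> thus gives a classically differentiable function of one real variable.\<close>

lemma translated_pairing_DERIV:
  fixes u :: "'a::euclidean_space \<Rightarrow> real"
  assumes u: "loc_integrable u" and i: "i \<in> Basis" and \<phi>: "test_fun \<phi>" and g: "weak_partial u i g"
  shows "((\<lambda>s. \<integral>x. u x * \<phi> (x - s *\<^sub>R i) \<partial>lebesgue) has_real_derivative
           (\<integral>x. g x * \<phi> (x - s *\<^sub>R i) \<partial>lebesgue)) (at s)"
proof -
  obtain h where h: "has_partial \<phi> i h" using test_fun_has_partial[OF \<phi> i] by blast
  have t: "test_fun (\<lambda>x. \<phi> (x - s *\<^sub>R i))" using test_fun_shift[OF \<phi>, of "- (s *\<^sub>R i)"] by simp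
  have p: "has_partial (\<lambda>x. \<phi> (x - s *\<^sub>R i)) i (\<lambda>x. h (x - s *\<^sub>R i))"
    using has_partial_shift[OF h, of "- (s *\<^sub>R i)"] by simp
  have "((\<lambda>a. \<integral>x. u x * \<phi> (x - a *\<^sub>R i - s *\<^sub>R i) \<partial>lebesgue) has_real_derivative
           (\<integral>x. g x * \<phi> (x - s *\<^sub>R i) \<partial>lebesgue)) (at 0)"
    using translated_pairing_DERIV_0[OF u i t p] weak_partialD[OF g t p] by simp
  then have "((\<lambda>a. \<integral>x. u x * \<phi> (x - (a + s) *\<^sub>R i) \<partial>lebesgue) has_real_derivative
           (\<integral>x. g x * \<phi> (x - s *\<^sub>R i) \<partial>lebesgue)) (at 0)"
    by (simp add: scaleR_add_left diff_diff_eq)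
  then show ?thesis using DERIV_shift[of "\<lambda>a. \<integral>x. u x * \<phi> (x - a *\<^sub>R i) \<partial>lebesgue" _ 0 s] by simp
qed

lemma pairing_translate:
  assumes "loc_integrable u" "test_fun \<phi>"
  shows "(\<integral>x. u x * \<phi> (x - a) \<partial>lebesgue) = (\<integral>x. u (x + a) * \<phi> x \<partial>lebesgue)"
proof -
  have "integrable lebesgue (\<lambda>x. u x * \<phi> (x - a))"
    using loc_integrable_test_mult[OF assms(1) test_fun_shift[OF assms(2), of "- a"]] by simp
  then have "(\<lambda>x. u x * \<phi> (x - a)) \<in> borel_measurable lebesgue" by (rule borel_measurable_integrable)
  from lebesgue_translate(3)[OF this, of a] show ?thesis by simp
qed

definition dquot :: "'a::euclidean_space \<Rightarrow> real \<Rightarrow> ('a \<Rightarrow> real) \<Rightarrow> 'a \<Rightarrow> real" where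
  "dquot i t u x = (u (x + t *\<^sub>R i) - u x) / t"

lemma loc_integrable_dquot: "loc_integrable u \<Longrightarrow> loc_integrable (dquot i t u)"
  using loc_integrable_lincomb[OF loc_integrable_shift[of u "t *\<^sub>R i"], of u "1/t" "-1/t"]
  unfolding dquot_def by (simp add: diff_divide_distrib)

lemma pairing_dquot:
  assumes u: "loc_integrable u" and \<phi>: "test_fun \<phi>"
  shows "(\<integral>x. dquot i t u x * \<phi> x \<partial>lebesgue) =
    ((\<integral>x. u x * \<phi> (x - t *\<^sub>R i) \<partial>lebesgue) - (\<integral>x. u x * \<phi> x \<partial>lebesgue)) / t"
proof -
  have i: "integrable lebesgue (\<lambda>x. u (x + t *\<^sub>R i) * \<phi> x)" "integrable lebesgue (\<lambda>x. u x * \<phi> x)"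
    using loc_integrable_test_mult[OF loc_integrable_shift[OF u] \<phi>] loc_integrable_test_mult[OF u \<phi>] by simp_all
  have "dquot i t u x * \<phi> x = (u (x + t *\<^sub>R i) * \<phi> x - u x * \<phi> x) / t" for x
    by (simp add: dquot_def left_diff_distrib)
  then show ?thesis using i pairing_translate[OF u \<phi>] by simp
qed

text \<open>The mean value theorem applied to the translated pairing, with the intermediate point
  depending on the test function; duality makes the bound uniform.\<close>

lemma dquot_estimate:
  fixes u :: "'a::euclidean_space \<Rightarrow> real"
  assumes u: "loc_integrable u" and g: "loc_integrable g" "weak_partial u i g" and i: "i \<in> Basis" and t: "t \<noteq> 0"
    and le: "\<And>s. \<bar>s\<bar> < \<bar>t\<bar> \<Longrightarrow> s \<noteq> 0 \<Longrightarrow> (\<integral>x. indicator (ball 0 R) x * \<bar>g (x + s *\<^sub>R i) - g x\<bar> \<partial>lebesgue) \<le> M"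
  shows "(\<integral>x. indicator (ball 0 R) x * \<bar>dquot i t u x - g x\<bar> \<partial>lebesgue) \<le> M"
proof (rule test_fun_duality)
  show "loc_integrable (\<lambda>x. dquot i t u x - g x)"
    by (intro loc_integrable_diff loc_integrable_dquot u g)
  fix \<phi> :: "'a \<Rightarrow> real"
  assume \<phi>: "test_fun \<phi>" "\<forall>x. \<bar>\<phi> x\<bar> \<le> 1" "\<forall>x. x \<notin> ball 0 R \<longrightarrow> \<phi> x = 0"
  define F where "F s = (\<integral>x. u x * \<phi> (x - s *\<^sub>R i) \<partial>lebesgue)" for s
  define F' where "F' s = (\<integral>x. g x * \<phi> (x - s *\<^sub>R i) \<partial>lebesgue)" for s
  have D: "(F has_real_derivative F' s) (at s)" for s
    unfolding F_def F'_def by (rule translated_pairing_DERIV[OF u i \<phi>(1) g(2)])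
  \<comment> \<open>The intermediate point is nonzero. This matters because continuity of
    translation is available as a limit at 0, which says nothing about the shift 0 itself.\<close>
  have "\<exists>s. \<bar>s\<bar> < \<bar>t\<bar> \<and> s \<noteq> 0 \<and> (F t - F 0) / t = F' s"
  proof (cases "t > 0")
    case True
    obtain s where "0 < s" "s < t" "F t - F 0 = (t - 0) * F' s"
      using MVT2[OF True, of F F'] D by blast
    then show ?thesis using True by (intro exI[of _ s]) auto
  next
    case False
    then have "t < 0" using t by simp
    obtain s where "t < s" "s < 0" "F 0 - F t = (0 - t) * F' s"
      using MVT2[OF \<open>t < 0\<close>, of F F'] D by blast
    then show ?thesis using \<open>t < 0\<close> by (intro exI[of _ s]) (auto simp: field_simps)
  qed
  then obtain s where s: "\<bar>s\<bar> < \<bar>t\<bar>" "s \<noteq> 0" "(F t - F 0) / t = F' s" by blast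
  have i1: "integrable lebesgue (\<lambda>x. dquot i t u x * \<phi> x)" "integrable lebesgue (\<lambda>x. g x * \<phi> x)"
    "integrable lebesgue (\<lambda>x. g (x + s *\<^sub>R i) * \<phi> x)"
    by (intro loc_integrable_test_mult loc_integrable_dquot loc_integrable_shift u g \<phi>)+
  have "(\<integral>x. dquot i t u x * \<phi> x \<partial>lebesgue) = F' s"
    using pairing_dquot[OF u \<phi>(1)] s(3) by (simp add: F_def)
  also have "\<dots> = (\<integral>x. g (x + s *\<^sub>R i) * \<phi> x \<partial>lebesgue)"
    unfolding F'_def by (rule pairing_translate[OF g(1) \<phi>(1)])
  finally have "(\<integral>x. (dquot i t u x - g x) * \<phi> x \<partial>lebesgue) = (\<integral>x. (g (x + s *\<^sub>R i) - g x) * \<phi> x \<partial>lebesgue)"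
    using i1 by (simp add: left_diff_distrib)
  also have "\<bar>\<dots>\<bar> \<le> (\<integral>x. indicator (ball 0 R) x * \<bar>g (x + s *\<^sub>R i) - g x\<bar> \<partial>lebesgue)"
  proof -
    have iB: "integrable lebesgue (\<lambda>x. indicator (ball 0 R) x * \<bar>g (x + s *\<^sub>R i) - g x\<bar>)"
      by (rule loc_integrable_ball_abs[OF loc_integrable_diff[OF loc_integrable_shift[OF g(1)] g(1)]])
    have "\<bar>\<integral>x. (g (x + s *\<^sub>R i) - g x) * \<phi> x \<partial>lebesgue\<bar> \<le> (\<integral>x. \<bar>(g (x + s *\<^sub>R i) - g x) * \<phi> x\<bar> \<partial>lebesgue)"
      by (rule integral_abs_bound)
    also have "\<dots> \<le> (\<integral>x. indicator (ball 0 R) x * \<bar>g (x + s *\<^sub>R i) - g x\<bar> \<partial>lebesgue)"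
    proof (rule integral_mono'[OF iB])
      fix x
      show "\<bar>(g (x + s *\<^sub>R i) - g x) * \<phi> x\<bar> \<le> indicator (ball 0 R) x * \<bar>g (x + s *\<^sub>R i) - g x\<bar>"
      proof (cases "x \<in> ball 0 R")
        case True
        have "\<bar>g (x + s *\<^sub>R i) - g x\<bar> * \<bar>\<phi> x\<bar> \<le> \<bar>g (x + s *\<^sub>R i) - g x\<bar> * 1"
          using \<phi>(2) by (intro mult_left_mono) auto
        then show ?thesis using True by (simp add: abs_mult)
      next
        case False
        then have "\<phi> x = 0" using \<phi>(3) by blast
        then show ?thesis by simp
      qed
    qed auto
    finally show ?thesis .
  qed
  also have "\<dots> \<le> M" by (rule le[OF s(1,2)])
  finally show "\<bar>\<integral>x. (dquot i t u x - g x) * \<phi> x \<partial>lebesgue\<bar> \<le> M" .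
qed

text \<open>On a ball the quotient is as close to \<open>g\<close> as the short translates of
  \<open>g\<close> are, so continuity of translation in L^1 gives strong convergence.\<close>

lemma dquot_tendsto:
  fixes u :: "'a::euclidean_space \<Rightarrow> real"
  assumes u: "loc_integrable u" and g: "loc_integrable g" "weak_partial u i g" and i: "i \<in> Basis"
    and X: "X \<longlonglongrightarrow> 0" "\<And>n. X n \<noteq> 0"
  shows "(\<lambda>n. \<integral>x. indicator (ball 0 R) x * \<bar>dquot i (X n) u x - g x\<bar> \<partial>lebesgue) \<longlonglongrightarrow> 0"
proof (rule order_tendstoI)
  fix e :: real assume e: "e > 0"
  have "eventually (\<lambda>h. (\<integral>x. indicator (ball 0 R) x * \<bar>g (x + h) - g x\<bar> \<partial>lebesgue) < e/2) (at 0)"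
    using translation_tendsto_ball[OF g(1)] e by (intro order_tendstoD(2)) auto
  then obtain d where d: "d > 0" "\<And>h. h \<noteq> 0 \<Longrightarrow> norm h < d \<Longrightarrow> (\<integral>x. indicator (ball 0 R) x * \<bar>g (x + h) - g x\<bar> \<partial>lebesgue) < e/2"
    unfolding eventually_at by (auto simp: dist_norm)
  have "eventually (\<lambda>n. \<bar>X n\<bar> < d) sequentially"
    using tendsto_rabs_zero[OF X(1)] d(1) by (intro order_tendstoD(2)) auto
  then show "eventually (\<lambda>n. (\<integral>x. indicator (ball 0 R) x * \<bar>dquot i (X n) u x - g x\<bar> \<partial>lebesgue) < e) sequentially"
  proof eventually_elim
    case (elim n)
    have "(\<integral>x. indicator (ball 0 R) x * \<bar>dquot i (X n) u x - g x\<bar> \<partial>lebesgue) \<le> e/2"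
    proof (rule dquot_estimate[OF u g i X(2)])
      fix s assume s: "\<bar>s\<bar> < \<bar>X n\<bar>" "s \<noteq> 0"
      have "i \<noteq> 0" using i by auto
      then show "(\<integral>x. indicator (ball 0 R) x * \<bar>g (x + s *\<^sub>R i) - g x\<bar> \<partial>lebesgue) \<le> e/2"
        using d(2)[of "s *\<^sub>R i"] s elim i by auto
    qed
    then show ?case using e by simp
  qed
next
  fix e :: real assume "e < 0"
  have "e < (\<integral>x. indicator (ball 0 R) x * \<bar>dquot i (X n) u x - g x\<bar> \<partial>lebesgue)" for n
    by (rule less_le_trans[OF \<open>e < 0\<close>]) (rule integral_nonneg_AE, simp)
  then show "eventually (\<lambda>n. e < (\<integral>x. indicator (ball 0 R) x * \<bar>dquot i (X n) u x - g x\<bar> \<partial>lebesgue)) sequentially"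
    by (rule always_eventually[OF allI])
qed

text \<open>A converse to the preceding convergence: if the quotients of \<open>v\<close> converge
  in L^1 on a ball that carries the test function, the limit satisfies integration by parts for it.
  This is how a weak derivative of a truncated function is recognised.\<close>

lemma weak_partial_pairing_from_dquot:
  fixes v :: "'a::euclidean_space \<Rightarrow> real"
  assumes v: "loc_integrable v" and g: "loc_integrable g" and i: "i \<in> Basis"
    and \<phi>: "test_fun \<phi>" "has_partial \<phi> i h" and supp: "\<And>x. x \<notin> ball 0 R \<Longrightarrow> \<phi> x = 0"
    and X: "X \<longlonglongrightarrow> 0" "\<And>n. X n \<noteq> 0"
    and lim: "(\<lambda>n. \<integral>x. indicator (ball 0 R) x * \<bar>dquot i (X n) v x - g x\<bar> \<partial>lebesgue) \<longlonglongrightarrow> 0"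
  shows "(\<integral>x. v x * h x \<partial>lebesgue) = - (\<integral>x. g x * \<phi> x \<partial>lebesgue)"
proof -
  obtain C where C: "0 < C" "\<forall>x. \<bar>\<phi> x\<bar> \<le> C"
    using test_fun_partial_bounds[OF \<phi>(1) i \<phi>(2)] by blast
  have fl: "filterlim X (at 0) sequentially" using X by (auto simp: filterlim_at)
  have "((\<lambda>s. ((\<integral>x. v x * \<phi> (x - (0 + s) *\<^sub>R i) \<partial>lebesgue) - (\<integral>x. v x * \<phi> (x - 0 *\<^sub>R i) \<partial>lebesgue)) / s)
      \<longlongrightarrow> - (\<integral>x. v x * h x \<partial>lebesgue)) (at 0)"
    using translated_pairing_DERIV_0[OF v i \<phi>] unfolding DERIV_def .
  from filterlim_compose[OF this fl]
  have 1: "(\<lambda>n. \<integral>x. dquot i (X n) v x * \<phi> x \<partial>lebesgue) \<longlonglongrightarrow> - (\<integral>x. v x * h x \<partial>lebesgue)"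
    by (simp add: pairing_dquot[OF v \<phi>(1)])
  have "(\<lambda>n. (\<integral>x. dquot i (X n) v x * \<phi> x \<partial>lebesgue) - (\<integral>x. g x * \<phi> x \<partial>lebesgue)) \<longlonglongrightarrow> 0"
  proof (rule Lim_null_comparison)
    show "(\<lambda>n. C * (\<integral>x. indicator (ball 0 R) x * \<bar>dquot i (X n) v x - g x\<bar> \<partial>lebesgue)) \<longlonglongrightarrow> 0"
      using tendsto_mult[OF tendsto_const[of C] lim] by simp
    have "norm ((\<integral>x. dquot i (X n) v x * \<phi> x \<partial>lebesgue) - (\<integral>x. g x * \<phi> x \<partial>lebesgue))
        \<le> C * (\<integral>x. indicator (ball 0 R) x * \<bar>dquot i (X n) v x - g x\<bar> \<partial>lebesgue)" for n
    proof -
      define w where "w x = dquot i (X n) v x - g x" for x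
      have w: "loc_integrable w" unfolding w_def by (intro loc_integrable_diff loc_integrable_dquot v g)
      have iw: "integrable lebesgue (\<lambda>x. C * (indicator (ball 0 R) x * \<bar>w x\<bar>))"
        using loc_integrable_ball_abs[OF w] by simp
      have "(\<integral>x. dquot i (X n) v x * \<phi> x \<partial>lebesgue) - (\<integral>x. g x * \<phi> x \<partial>lebesgue) = (\<integral>x. w x * \<phi> x \<partial>lebesgue)"
        using loc_integrable_test_mult[OF loc_integrable_dquot[OF v] \<phi>(1)] loc_integrable_test_mult[OF g \<phi>(1)]
        by (simp add: w_def left_diff_distrib)
      also have "\<bar>\<dots>\<bar> \<le> (\<integral>x. \<bar>w x * \<phi> x\<bar> \<partial>lebesgue)" by (rule integral_abs_bound)
      also have "\<dots> \<le> (\<integral>x. C * (indicator (ball 0 R) x * \<bar>w x\<bar>) \<partial>lebesgue)"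
      proof (rule integral_mono'[OF iw])
        fix x
        show "\<bar>w x * \<phi> x\<bar> \<le> C * (indicator (ball 0 R) x * \<bar>w x\<bar>)"
        proof (cases "x \<in> ball 0 R")
          case True
          have "\<bar>w x\<bar> * \<bar>\<phi> x\<bar> \<le> \<bar>w x\<bar> * C" using C by (intro mult_left_mono) auto
          then show ?thesis using True by (simp add: abs_mult mult.commute)
        next
          case False
          then show ?thesis using supp[OF False] C by simp
        qed
      qed (use C in auto)
      finally show ?thesis by (simp add: w_def)
    qed
    then show "\<forall>\<^sub>F n in sequentially. norm ((\<integral>x. dquot i (X n) v x * \<phi> x \<partial>lebesgue) - (\<integral>x. g x * \<phi> x \<partial>lebesgue))
        \<le> C * (\<integral>x. indicator (ball 0 R) x * \<bar>dquot i (X n) v x - g x\<bar> \<partial>lebesgue)"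
      by (rule always_eventually[OF allI])
  qed
  then have "(\<lambda>n. \<integral>x. dquot i (X n) v x * \<phi> x \<partial>lebesgue) \<longlonglongrightarrow> (\<integral>x. g x * \<phi> x \<partial>lebesgue)"
    by (simp add: LIM_zero_iff)
  from LIMSEQ_unique[OF this 1] show ?thesis by simp
qed

section \<open>Chain rule for truncations\<close>

lemma trunc_bounds: "\<alpha> \<ge> 0 \<Longrightarrow> \<bar>trunc \<alpha> s\<bar> \<le> \<alpha>" "\<alpha> \<ge> 0 \<Longrightarrow> \<bar>trunc \<alpha> s\<bar> \<le> \<bar>s\<bar>"
  by (auto simp: trunc_def min_def max_def)

lemma trunc_lipschitz: "\<bar>trunc \<alpha> s - trunc \<alpha> t\<bar> \<le> \<bar>s - t\<bar>"
  by (auto simp: trunc_def min_def max_def)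

lemma continuous_trunc [continuous_intros]: "continuous_on A (trunc \<alpha>)"
  unfolding trunc_def[abs_def] by (intro continuous_intros)

lemma trunc_measurable [measurable]: "trunc \<alpha> \<in> borel_measurable borel"
  by (intro borel_measurable_continuous_onI continuous_trunc)

text \<open>One-sided derivative of the truncation along a sequence approaching from side \<open>s\<close>.\<close>

definition trunc_dir :: "real \<Rightarrow> real \<Rightarrow> real \<Rightarrow> real \<Rightarrow> real" where
  "trunc_dir \<alpha> s y g = (if \<bar>y\<bar> < \<alpha> then g else if y = \<alpha> then s * min (s * g) 0
     else if y = - \<alpha> then s * max (s * g) 0 else 0)"

lemma trunc_dir_abs: "s = 1 \<or> s = -1 \<Longrightarrow> \<bar>trunc_dir \<alpha> s y g\<bar> \<le> \<bar>g\<bar>"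
  unfolding trunc_dir_def by (auto simp: min_def max_def)

text \<open>Off the levels the truncation is locally the identity or constant. At a level its
  increment is \<open>min (y n - y0) 0\<close> or \<open>max (y n - y0) 0\<close>. Division by the
  positive \<open>\<tau> n\<close> commutes with \<open>min\<close> and \<open>max\<close>, which
  are continuous; the sign \<open>s\<close> is carried separately for this reason.\<close>

lemma trunc_dir_tendsto:
  fixes y :: "nat \<Rightarrow> real"
  assumes a: "\<alpha> > 0" and s: "s = 1 \<or> s = - 1" and t: "\<And>n. \<tau> n > 0"
    and y: "y \<longlonglongrightarrow> y0" and d: "(\<lambda>n. (y n - y0) / (s * \<tau> n)) \<longlonglongrightarrow> g"
  shows "(\<lambda>n. (trunc \<alpha> (y n) - trunc \<alpha> y0) / (s * \<tau> n)) \<longlonglongrightarrow> trunc_dir \<alpha> s y0 g"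
proof -
  have sd: "(\<lambda>n. (y n - y0) / \<tau> n) \<longlonglongrightarrow> s * g"
  proof -
    have "(\<lambda>n. s * ((y n - y0) / (s * \<tau> n))) \<longlonglongrightarrow> s * g" by (intro tendsto_mult tendsto_const d)
    then show ?thesis using s by auto
  qed
  consider "\<bar>y0\<bar> < \<alpha>" | "\<bar>y0\<bar> > \<alpha>" | "y0 = \<alpha>" | "y0 = - \<alpha>" by linarith
  then show ?thesis
  proof cases
    case 1
    have "eventually (\<lambda>n. \<bar>y n\<bar> < \<alpha>) sequentially" using tendsto_rabs[OF y] 1 by (rule order_tendstoD(2))
    then have "eventually (\<lambda>n. (y n - y0) / (s * \<tau> n) = (trunc \<alpha> (y n) - trunc \<alpha> y0) / (s * \<tau> n)) sequentially"
      by eventually_elim (use 1 in \<open>simp add: trunc_def\<close>)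
    from Lim_transform_eventually[OF d this] show ?thesis using 1 by (simp add: trunc_dir_def)
  next
    case 2
    have "eventually (\<lambda>n. trunc \<alpha> (y n) = trunc \<alpha> y0) sequentially"
    proof (cases "y0 > 0")
      case True
      then have "\<alpha> < y0" using 2 by simp
      have "eventually (\<lambda>n. \<alpha> < y n) sequentially" using y \<open>\<alpha> < y0\<close> by (rule order_tendstoD(1))
      then show ?thesis by eventually_elim (use \<open>\<alpha> < y0\<close> in \<open>simp add: trunc_def\<close>)
    next
      case False
      then have "y0 < - \<alpha>" using 2 by simp
      have "eventually (\<lambda>n. y n < - \<alpha>) sequentially" using y \<open>y0 < - \<alpha>\<close> by (rule order_tendstoD(2))
      then show ?thesis by eventually_elim (use \<open>y0 < - \<alpha>\<close> a in \<open>simp add: trunc_def\<close>)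
    qed
    then have "eventually (\<lambda>n. 0 = (trunc \<alpha> (y n) - trunc \<alpha> y0) / (s * \<tau> n)) sequentially"
      by eventually_elim simp
    from Lim_transform_eventually[OF tendsto_const this] show ?thesis
      using 2 a by (auto simp: trunc_dir_def)
  next
    case 3
    have lim: "(\<lambda>n. s * min ((y n - y0) / \<tau> n) 0) \<longlonglongrightarrow> s * min (s * g) 0"
      by (intro tendsto_mult tendsto_min tendsto_const sd)
    have "eventually (\<lambda>n. - \<alpha> < y n) sequentially"
      by (rule order_tendstoD(1)[OF y]) (use 3 a in simp)
    then have "eventually (\<lambda>n. s * min ((y n - y0) / \<tau> n) 0 = (trunc \<alpha> (y n) - trunc \<alpha> y0) / (s * \<tau> n)) sequentially"
    proof eventually_elim
      case (elim n)
      have *: "trunc \<alpha> (y n) - trunc \<alpha> y0 = min (y n - y0) 0" using elim 3 a by (simp add: trunc_def min_def max_def)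
      have **: "min ((y n - y0) / \<tau> n) 0 = min (y n - y0) 0 / \<tau> n"
        using t[of n] by (auto simp: min_def divide_simps)
      show ?case unfolding * ** using s by auto
    qed
    from Lim_transform_eventually[OF lim this] show ?thesis using 3 a by (simp add: trunc_dir_def)
  next
    case 4
    have lim: "(\<lambda>n. s * max ((y n - y0) / \<tau> n) 0) \<longlonglongrightarrow> s * max (s * g) 0"
      by (intro tendsto_mult tendsto_max tendsto_const sd)
    have "eventually (\<lambda>n. y n < \<alpha>) sequentially"
      by (rule order_tendstoD(2)[OF y]) (use 4 a in simp)
    then have "eventually (\<lambda>n. s * max ((y n - y0) / \<tau> n) 0 = (trunc \<alpha> (y n) - trunc \<alpha> y0) / (s * \<tau> n)) sequentially"
    proof eventually_elim
      case (elim n)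
      have *: "trunc \<alpha> (y n) - trunc \<alpha> y0 = max (y n - y0) 0" using elim 4 a by (simp add: trunc_def min_def max_def)
      have **: "max ((y n - y0) / \<tau> n) 0 = max (y n - y0) 0 / \<tau> n"
        using t[of n] by (auto simp: max_def divide_simps)
      show ?case unfolding * ** using s by auto
    qed
    from Lim_transform_eventually[OF lim this] show ?thesis using 4 a by (simp add: trunc_dir_def)
  qed
qed

text \<open>Dominated convergence with moving majorants \<open>d n\<close> that converge in L^1. The
  positive part of \<open>\<bar>c n x - G x\<bar> - \<bar>d n x - g x\<bar>\<close> has the fixed
  majorant \<open>2 * \<bar>g x\<bar>\<close>, since \<open>\<bar>d n x\<bar> - \<bar>d n x - g
  x\<bar> \<le> \<bar>g x\<bar>\<close>; the subtracted term has vanishing integral.\<close>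

lemma L1_dominated_transfer:
  fixes d c :: "nat \<Rightarrow> 'b \<Rightarrow> real"
  assumes m: "\<And>n. d n \<in> borel_measurable M" "\<And>n. c n \<in> borel_measurable M" "G \<in> borel_measurable M" "integrable M g"
    and d: "AE x in M. (\<lambda>n. d n x) \<longlonglongrightarrow> g x" "(\<lambda>n. \<integral>x. \<bar>d n x - g x\<bar> \<partial>M) \<longlonglongrightarrow> 0" "\<And>n. integrable M (d n)"
    and c: "AE x in M. (\<lambda>n. c n x) \<longlonglongrightarrow> G x" "\<And>n x. \<bar>c n x\<bar> \<le> \<bar>d n x\<bar>" "\<And>x. \<bar>G x\<bar> \<le> \<bar>g x\<bar>"
  shows "(\<lambda>n. \<integral>x. \<bar>c n x - G x\<bar> \<partial>M) \<longlonglongrightarrow> 0"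
proof -
  have gm: "g \<in> borel_measurable M" using m(4) by (rule borel_measurable_integrable)
  define a where "a n x = max 0 (\<bar>c n x - G x\<bar> - \<bar>d n x - g x\<bar>)" for n x
  have am: "a n \<in> borel_measurable M" for n unfolding a_def using m(1)[of n] m(2)[of n] m(3) gm by simp
  have ab: "\<bar>a n x\<bar> \<le> 2 * \<bar>g x\<bar>" for n x
    using c(2)[of n x] c(3)[of x] unfolding a_def by linarith
  have ig: "integrable M (\<lambda>x. 2 * \<bar>g x\<bar>)" using m(4) by simp
  have "(\<lambda>n. \<integral>x. a n x \<partial>M) \<longlonglongrightarrow> (\<integral>x. 0 \<partial>M)"
  proof (rule integral_dominated_convergence[OF _ am ig])
    show "AE x in M. (\<lambda>n. a n x) \<longlonglongrightarrow> 0" using d(1) c(1)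
    proof eventually_elim
      case (elim x)
      have "(\<lambda>n. a n x) \<longlonglongrightarrow> max 0 (\<bar>G x - G x\<bar> - \<bar>g x - g x\<bar>)"
        unfolding a_def by (intro tendsto_intros elim)
      then show ?case by simp
    qed
    show "AE x in M. norm (a n x) \<le> 2 * \<bar>g x\<bar>" for n by (rule AE_I2) (use ab in simp)
  qed simp
  then have "(\<lambda>n. (\<integral>x. a n x \<partial>M) + (\<integral>x. \<bar>d n x - g x\<bar> \<partial>M)) \<longlonglongrightarrow> 0 + 0"
    by (intro tendsto_add d(2)) simp
  then have l: "(\<lambda>n. (\<integral>x. a n x \<partial>M) + (\<integral>x. \<bar>d n x - g x\<bar> \<partial>M)) \<longlonglongrightarrow> 0" by simp
  have ia: "integrable M (a n)" for n
    by (rule Bochner_Integration.integrable_bound[OF ig am]) (rule AE_I2, use ab[of n] in simp)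
  have "norm (\<integral>x. \<bar>c n x - G x\<bar> \<partial>M) \<le> (\<integral>x. a n x \<partial>M) + (\<integral>x. \<bar>d n x - g x\<bar> \<partial>M)" for n
  proof -
    have id: "integrable M (\<lambda>x. \<bar>d n x - g x\<bar>)" using d(3)[of n] m(4) by simp
    have "(\<integral>x. \<bar>c n x - G x\<bar> \<partial>M) \<le> (\<integral>x. a n x + \<bar>d n x - g x\<bar> \<partial>M)"
      by (rule integral_mono'[OF Bochner_Integration.integrable_add[OF ia id]]) (auto simp: a_def)
    also have "\<dots> = (\<integral>x. a n x \<partial>M) + (\<integral>x. \<bar>d n x - g x\<bar> \<partial>M)" using ia[of n] id by simp
    finally show ?thesis by (simp add: integral_nonneg_AE)
  qed
  then show ?thesis by (intro Lim_null_comparison[OF always_eventually[OF allI] l])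
qed

text \<open>Truncation is 1-Lipschitz, so the quotients of the truncated function are dominated by
  those of \<open>u\<close>. Along a subsequence the latter converge almost everywhere as well as in
  L^1, which identifies the pointwise limit and transfers the L^1 convergence.\<close>

lemma weak_partial_trunc_dir:
  fixes u :: "'a::euclidean_space \<Rightarrow> real"
  assumes u: "loc_integrable u" and g: "loc_integrable g" "weak_partial u i g" and i: "i \<in> Basis"
    and a: "\<alpha> > 0" and s: "s = 1 \<or> s = - 1"
  shows "loc_integrable (\<lambda>x. trunc_dir \<alpha> s (u x) (g x))"
    and "weak_partial (\<lambda>x. trunc \<alpha> (u x)) i (\<lambda>x. trunc_dir \<alpha> s (u x) (g x))"
proof -
  have um [measurable]: "u \<in> borel_measurable lebesgue" by (rule loc_integrable_measurable[OF u])
  have gm [measurable]: "g \<in> borel_measurable lebesgue" by (rule loc_integrable_measurable[OF g(1)])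
  have tm: "(\<lambda>x. trunc_dir \<alpha> s (u x) (g x)) \<in> borel_measurable lebesgue"
    unfolding trunc_dir_def by measurable
  show td: "loc_integrable (\<lambda>x. trunc_dir \<alpha> s (u x) (g x))"
    by (rule loc_integrable_bound[OF g(1) tm]) (simp add: trunc_dir_abs[OF s])
  have Tm: "(\<lambda>x. trunc \<alpha> (u x)) \<in> borel_measurable lebesgue" by measurable
  have Tl: "loc_integrable (\<lambda>x. trunc \<alpha> (u x))"
    by (rule loc_integrable_bound[OF u Tm]) (use a in \<open>simp add: trunc_bounds\<close>)
  show "weak_partial (\<lambda>x. trunc \<alpha> (u x)) i (\<lambda>x. trunc_dir \<alpha> s (u x) (g x))"
    unfolding weak_partial_def
  proof (intro allI impI)
    fix \<phi> h :: "'a \<Rightarrow> real" assume \<phi>: "test_fun \<phi>" "has_partial \<phi> i h"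
    obtain R0 where R0: "\<forall>x. R0 < norm x \<longrightarrow> \<phi> x = 0" using \<phi>(1) by (auto simp: test_fun_def)
    define R where "R = R0 + 1"
    have supp: "\<phi> x = 0" if "x \<notin> ball 0 R" for x using R0 that by (auto simp: R_def)
    define B where "B = ball (0::'a) R"
    \<comment> \<open>All steps have the sign of \<open>s\<close>; this fixed side makes the
      quotients converge even where \<open>u\<close> equals a truncation level.\<close>
    define X where "X n = s * inverse (real (Suc n))" for n
    have X: "X \<longlonglongrightarrow> 0" unfolding X_def
      using tendsto_mult[OF tendsto_const[of s] LIMSEQ_inverse_real_of_nat] by simp
    have X0: "X n \<noteq> 0" for n using s by (auto simp: X_def)
    define D where "D n x = indicator B x * (dquot i (X n) u x - g x)" for n x
    have iD: "integrable lebesgue (D n)" for n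
      using loc_integrable_diff[OF loc_integrable_dquot[OF u, of i "X n"] g(1)]
      unfolding D_def B_def loc_integrable_iff_ball by blast
    have "(\<lambda>n. \<integral>x. norm (D n x) \<partial>lebesgue) \<longlonglongrightarrow> 0"
      using dquot_tendsto[OF u g i X X0, of R] by (simp add: D_def B_def abs_mult)
    then obtain r where r: "strict_mono r" "AE x in lebesgue. (\<lambda>n. D (r n) x) \<longlonglongrightarrow> 0"
      using tendsto_L1_AE_subseq[of lebesgue D, OF iD] by blast
    define Y where "Y = (\<lambda>n. X (r n))"
    have Y: "Y \<longlonglongrightarrow> 0" "\<And>n. Y n \<noteq> 0"
      using LIMSEQ_subseq_LIMSEQ[OF X r(1)] X0 by (auto simp: Y_def o_def)
    have iG: "integrable lebesgue (\<lambda>x. indicator B x * g x)" "integrable lebesgue (\<lambda>x. indicator B x * dquot i (Y n) u x)"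
      "integrable lebesgue (\<lambda>x. indicator B x * trunc_dir \<alpha> s (u x) (g x))"
      "integrable lebesgue (\<lambda>x. indicator B x * dquot i (Y n) (\<lambda>x. trunc \<alpha> (u x)) x)" for n
      using g(1) loc_integrable_dquot[OF u, of i "Y n"] td loc_integrable_dquot[OF Tl, of i "Y n"]
      unfolding B_def loc_integrable_iff_ball by blast+
    have "(\<lambda>n. \<integral>x. \<bar>indicator B x * dquot i (Y n) (\<lambda>x. trunc \<alpha> (u x)) x - indicator B x * trunc_dir \<alpha> s (u x) (g x)\<bar> \<partial>lebesgue) \<longlonglongrightarrow> 0"
    proof (rule L1_dominated_transfer[where d="\<lambda>n x. indicator B x * dquot i (Y n) u x" and g="\<lambda>x. indicator B x * g x"])
      show "(\<lambda>n. \<integral>x. \<bar>indicator B x * dquot i (Y n) u x - indicator B x * g x\<bar> \<partial>lebesgue) \<longlonglongrightarrow> 0"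
        using dquot_tendsto[OF u g i Y, of R] by (simp add: B_def abs_mult right_diff_distrib[symmetric])
      show "AE x in lebesgue. (\<lambda>n. indicator B x * dquot i (Y n) u x) \<longlonglongrightarrow> indicator B x * g x"
        using r(2)
      proof eventually_elim
        case (elim x)
        have "(\<lambda>n. D (r n) x + indicator B x * g x) \<longlonglongrightarrow> 0 + indicator B x * g x"
          by (intro tendsto_add tendsto_const elim)
        then show ?case by (simp add: D_def Y_def right_diff_distrib)
      qed
      show "AE x in lebesgue. (\<lambda>n. indicator B x * dquot i (Y n) (\<lambda>x. trunc \<alpha> (u x)) x) \<longlonglongrightarrow> indicator B x * trunc_dir \<alpha> s (u x) (g x)"
        using r(2)
      proof eventually_elim
        case (elim x)
        show ?case
        proof (cases "x \<in> B")
          case True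
          have "(\<lambda>n. D (r n) x + g x) \<longlonglongrightarrow> 0 + g x" by (intro tendsto_add tendsto_const elim)
          then have dq: "(\<lambda>n. dquot i (Y n) u x) \<longlonglongrightarrow> g x" using True by (simp add: D_def Y_def)
          \<comment> \<open>Convergence of \<open>u\<close> along these steps is read off from the
            quotients: a convergent factor times a step tending to 0.\<close>
          have "(\<lambda>n. u x + Y n * dquot i (Y n) u x) \<longlonglongrightarrow> u x + 0 * g x"
            by (intro tendsto_add tendsto_mult tendsto_const dq Y)
          then have y: "(\<lambda>n. u (x + Y n *\<^sub>R i)) \<longlonglongrightarrow> u x" using Y(2) by (simp add: dquot_def)
          have Ys: "Y n = s * inverse (real (Suc (r n)))" for n by (simp add: Y_def X_def)
          have "(\<lambda>n. (trunc \<alpha> (u (x + Y n *\<^sub>R i)) - trunc \<alpha> (u x)) / (s * inverse (real (Suc (r n))))) \<longlonglongrightarrow> trunc_dir \<alpha> s (u x) (g x)"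
            by (rule trunc_dir_tendsto[OF a s _ y]) (use dq in \<open>simp_all add: dquot_def Ys\<close>)
          then show ?thesis using True by (simp add: dquot_def Ys)
        qed simp
      qed
      show "\<bar>indicator B x * dquot i (Y n) (\<lambda>x. trunc \<alpha> (u x)) x\<bar> \<le> \<bar>indicator B x * dquot i (Y n) u x\<bar>" for n x
        using trunc_lipschitz[of \<alpha> "u (x + Y n *\<^sub>R i)" "u x"]
        by (simp add: dquot_def abs_mult mult_left_mono divide_right_mono)
      show "\<bar>indicator B x * trunc_dir \<alpha> s (u x) (g x)\<bar> \<le> \<bar>indicator B x * g x\<bar>" for x
        using trunc_dir_abs[OF s] by (simp add: abs_mult mult_left_mono)
    qed (use iG borel_measurable_integrable[OF iG(2)] borel_measurable_integrable[OF iG(3)] borel_measurable_integrable[OF iG(4)] in \<open>simp_all\<close>)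
    then have "(\<lambda>n. \<integral>x. indicator (ball 0 R) x * \<bar>dquot i (Y n) (\<lambda>x. trunc \<alpha> (u x)) x - trunc_dir \<alpha> s (u x) (g x)\<bar> \<partial>lebesgue) \<longlonglongrightarrow> 0"
      by (simp add: B_def abs_mult right_diff_distrib[symmetric])
    from weak_partial_pairing_from_dquot[OF Tl td i \<phi> supp Y this]
    show "(\<integral>x. trunc \<alpha> (u x) * h x \<partial>lebesgue) = - (\<integral>x. trunc_dir \<alpha> s (u x) (g x) * \<phi> x \<partial>lebesgue)" by simp
  qed
qed

lemma weak_partial_AE_cong:
  assumes "weak_partial u i g" "AE x in lebesgue. u x = u' x" "AE x in lebesgue. g x = g' x"
    "i \<in> Basis" "u \<in> borel_measurable lebesgue" "g \<in> borel_measurable lebesgue"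
    "u' \<in> borel_measurable lebesgue" "g' \<in> borel_measurable lebesgue"
  shows "weak_partial u' i g'"
  unfolding weak_partial_def
proof (intro allI impI)
  fix \<phi> h :: "'a \<Rightarrow> real" assume \<phi>: "test_fun \<phi>" "has_partial \<phi> i h"
  have "continuous_on UNIV \<phi>" "continuous_on UNIV h" using test_fun_partial_bounds[OF \<phi>(1) assms(4) \<phi>(2)] by blast+
  then have m: "\<phi> \<in> borel_measurable lebesgue" "h \<in> borel_measurable lebesgue"
    by (simp_all add: continuous_imp_lebesgue_measurable)
  have "(\<integral>x. u' x * h x \<partial>lebesgue) = (\<integral>x. u x * h x \<partial>lebesgue)"
    by (rule integral_cong_AE) (use assms m in \<open>auto elim: eventually_mono\<close>)
  moreover have "(\<integral>x. g' x * \<phi> x \<partial>lebesgue) = (\<integral>x. g x * \<phi> x \<partial>lebesgue)"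
    by (rule integral_cong_AE) (use assms m in \<open>auto elim: eventually_mono\<close>)
  ultimately show "(\<integral>x. u' x * h x \<partial>lebesgue) = - (\<integral>x. g' x * \<phi> x \<partial>lebesgue)"
    using weak_partialD[OF assms(1) \<phi>] by simp
qed

text \<open>The right and left directional limits are both weak derivatives of the truncation, so they
  agree almost everywhere; this forces the derivative to vanish on the level sets.\<close>

lemma weak_partial_trunc:
  fixes u :: "'a::euclidean_space \<Rightarrow> real"
  assumes u: "loc_integrable u" and g: "loc_integrable g" "weak_partial u i g" and i: "i \<in> Basis" and a: "\<alpha> > 0"
  shows "weak_partial (\<lambda>x. trunc \<alpha> (u x)) i (\<lambda>x. if \<bar>u x\<bar> < \<alpha> then g x else 0)"
proof -
  have um [measurable]: "u \<in> borel_measurable lebesgue" by (rule loc_integrable_measurable[OF u])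
  have gm [measurable]: "g \<in> borel_measurable lebesgue" by (rule loc_integrable_measurable[OF g(1)])
  have Tm: "(\<lambda>x. trunc \<alpha> (u x)) \<in> borel_measurable lebesgue" by measurable
  have Tl: "loc_integrable (\<lambda>x. trunc \<alpha> (u x))"
    by (rule loc_integrable_bound[OF u Tm]) (use a in \<open>simp add: trunc_bounds\<close>)
  note p = weak_partial_trunc_dir[OF u g i a, of 1, simplified]
  note n = weak_partial_trunc_dir[OF u g i a, of "-1", simplified]
  have "AE x in lebesgue. trunc_dir \<alpha> 1 (u x) (g x) = trunc_dir \<alpha> (- 1) (u x) (g x)"
    by (rule weak_partial_unique[OF i p n])
  \<comment> \<open>At the level \<open>\<alpha>\<close> the two candidates are min(g, 0) and max(g,
    0), at the opposite level the same in reverse order; equality makes both zero.\<close>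
  then have "AE x in lebesgue. trunc_dir \<alpha> 1 (u x) (g x) = (if \<bar>u x\<bar> < \<alpha> then g x else 0)"
    by eventually_elim (use a in \<open>auto simp: trunc_dir_def min_def max_def split: if_splits\<close>)
  then show ?thesis
    by (intro weak_partial_AE_cong[OF p(2) AE_I2[OF refl] _ i loc_integrable_measurable[OF Tl] loc_integrable_measurable[OF p(1)]
      loc_integrable_measurable[OF Tl]]) measurable
qed

section \<open>Weak gradients\<close>

lemma has_weak_gradient_iff:
  "has_weak_gradient u G \<longleftrightarrow> loc_integrable u \<and> G \<in> borel_measurable lebesgue \<and>
     (\<forall>i\<in>Basis. loc_integrable (\<lambda>x. G x \<bullet> i) \<and> weak_partial u i (\<lambda>x. G x \<bullet> i))"
  unfolding has_weak_gradient_def weak_partial_def by blast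

lemma has_weak_gradient_unique:
  assumes "has_weak_gradient u G" "has_weak_gradient u H"
  shows "AE x in lebesgue. G x = H x"
proof -
  have "AE x in lebesgue. \<forall>i\<in>Basis. G x \<bullet> i = H x \<bullet> i"
  proof (rule AE_finite_allI[OF finite_Basis])
    fix i :: 'a assume i: "i \<in> Basis"
    show "AE x in lebesgue. G x \<bullet> i = H x \<bullet> i"
      by (rule weak_partial_unique[OF i, of _ u]) (use assms i in \<open>simp_all add: has_weak_gradient_iff\<close>)
  qed
  then show ?thesis by eventually_elim (rule euclidean_eqI, blast)
qed

text \<open>\<open>wgrad\<close> selects a gradient by choice and is thereby determined only up to a
  null set, so identities for it are stated almost everywhere.\<close>

lemma wgrad_eqI:
  assumes "has_weak_gradient u G"
  shows "has_weak_gradient u (wgrad u)" "AE x in lebesgue. wgrad u x = G x"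
proof -
  show "has_weak_gradient u (wgrad u)" unfolding wgrad_def by (rule someI[of "has_weak_gradient u", OF assms])
  then show "AE x in lebesgue. wgrad u x = G x" using assms by (rule has_weak_gradient_unique)
qed

lemma has_weak_gradient_lincomb:
  assumes u: "has_weak_gradient u G" and v: "has_weak_gradient v H"
  shows "has_weak_gradient (\<lambda>x. a * u x + b * v x) (\<lambda>x. a *\<^sub>R G x + b *\<^sub>R H x)"
  unfolding has_weak_gradient_iff
proof (intro conjI ballI)
  have l: "loc_integrable u" "loc_integrable v" using u v unfolding has_weak_gradient_iff by blast+
  then show "loc_integrable (\<lambda>x. a * u x + b * v x)" by (rule loc_integrable_lincomb)
  have "G \<in> borel_measurable lebesgue" "H \<in> borel_measurable lebesgue"
    using u v unfolding has_weak_gradient_iff by blast+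
  then show "(\<lambda>x. a *\<^sub>R G x + b *\<^sub>R H x) \<in> borel_measurable lebesgue" by simp
  fix i :: 'a assume i: "i \<in> Basis"
  have gl: "loc_integrable (\<lambda>x. G x \<bullet> i)" "loc_integrable (\<lambda>x. H x \<bullet> i)"
    and w: "weak_partial u i (\<lambda>x. G x \<bullet> i)" "weak_partial v i (\<lambda>x. H x \<bullet> i)"
    using u v i unfolding has_weak_gradient_iff by blast+
  show "loc_integrable (\<lambda>x. (a *\<^sub>R G x + b *\<^sub>R H x) \<bullet> i)"
    using loc_integrable_lincomb[OF gl, of a b] by (simp add: inner_add_left)
  show "weak_partial (\<lambda>x. a * u x + b * v x) i (\<lambda>x. (a *\<^sub>R G x + b *\<^sub>R H x) \<bullet> i)"
    unfolding weak_partial_def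
  proof (intro allI impI)
    fix \<phi> h :: "'a \<Rightarrow> real" assume \<phi>: "test_fun \<phi>" "has_partial \<phi> i h"
    have i1: "integrable lebesgue (\<lambda>x. u x * h x)" "integrable lebesgue (\<lambda>x. v x * h x)"
      using test_fun_partial_integrable[OF l(1) \<phi>(1) i \<phi>(2)] test_fun_partial_integrable[OF l(2) \<phi>(1) i \<phi>(2)] .
    have i2: "integrable lebesgue (\<lambda>x. (G x \<bullet> i) * \<phi> x)" "integrable lebesgue (\<lambda>x. (H x \<bullet> i) * \<phi> x)"
      using loc_integrable_test_mult[OF gl(1) \<phi>(1)] loc_integrable_test_mult[OF gl(2) \<phi>(1)] .
    have "(\<integral>x. (a * u x + b * v x) * h x \<partial>lebesgue) = (\<integral>x. a * (u x * h x) + b * (v x * h x) \<partial>lebesgue)"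
      by (simp add: algebra_simps)
    also have "\<dots> = a * (\<integral>x. u x * h x \<partial>lebesgue) + b * (\<integral>x. v x * h x \<partial>lebesgue)" using i1 by simp
    also have "\<dots> = - (a * (\<integral>x. (G x \<bullet> i) * \<phi> x \<partial>lebesgue) + b * (\<integral>x. (H x \<bullet> i) * \<phi> x \<partial>lebesgue))"
      using weak_partialD[OF w(1) \<phi>] weak_partialD[OF w(2) \<phi>] by simp
    also have "a * (\<integral>x. (G x \<bullet> i) * \<phi> x \<partial>lebesgue) + b * (\<integral>x. (H x \<bullet> i) * \<phi> x \<partial>lebesgue) =
        (\<integral>x. a * ((G x \<bullet> i) * \<phi> x) + b * ((H x \<bullet> i) * \<phi> x) \<partial>lebesgue)" using i2 by simp
    also have "\<dots> = (\<integral>x. ((a *\<^sub>R G x + b *\<^sub>R H x) \<bullet> i) * \<phi> x \<partial>lebesgue)"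
      by (simp add: inner_add_left algebra_simps)
    finally show "(\<integral>x. (a * u x + b * v x) * h x \<partial>lebesgue) = - (\<integral>x. ((a *\<^sub>R G x + b *\<^sub>R H x) \<bullet> i) * \<phi> x \<partial>lebesgue)" .
  qed
qed

lemma has_weak_gradient_trunc:
  assumes u: "has_weak_gradient u G" and a: "\<alpha> > 0"
  shows "has_weak_gradient (\<lambda>x. trunc \<alpha> (u x)) (\<lambda>x. if \<bar>u x\<bar> < \<alpha> then G x else 0)"
  unfolding has_weak_gradient_iff
proof (intro conjI ballI)
  have l: "loc_integrable u" and Gm [measurable]: "G \<in> borel_measurable lebesgue" using u unfolding has_weak_gradient_iff by blast+
  have um [measurable]: "u \<in> borel_measurable lebesgue" by (rule loc_integrable_measurable[OF l])
  have Tm: "(\<lambda>x. trunc \<alpha> (u x)) \<in> borel_measurable lebesgue" by measurable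
  show "loc_integrable (\<lambda>x. trunc \<alpha> (u x))"
    by (rule loc_integrable_bound[OF l Tm]) (use a in \<open>simp add: trunc_bounds\<close>)
  show Gm2: "(\<lambda>x. if \<bar>u x\<bar> < \<alpha> then G x else 0) \<in> borel_measurable lebesgue" by measurable
  fix i :: 'a assume i: "i \<in> Basis"
  have g: "loc_integrable (\<lambda>x. G x \<bullet> i)" "weak_partial u i (\<lambda>x. G x \<bullet> i)"
    using u i unfolding has_weak_gradient_iff by blast+
  have m: "(\<lambda>x. (if \<bar>u x\<bar> < \<alpha> then G x else 0) \<bullet> i) \<in> borel_measurable lebesgue" using Gm2 by simp
  show "loc_integrable (\<lambda>x. (if \<bar>u x\<bar> < \<alpha> then G x else 0) \<bullet> i)"
    by (rule loc_integrable_bound[OF g(1) m]) simp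
  have "(\<lambda>x. (if \<bar>u x\<bar> < \<alpha> then G x else 0) \<bullet> i) = (\<lambda>x. if \<bar>u x\<bar> < \<alpha> then G x \<bullet> i else 0)" by auto
  then show "weak_partial (\<lambda>x. trunc \<alpha> (u x)) i (\<lambda>x. (if \<bar>u x\<bar> < \<alpha> then G x else 0) \<bullet> i)"
    using weak_partial_trunc[OF l g i a] by simp
qed

lemma has_weak_gradient_AE_cong:
  assumes u: "has_weak_gradient u G" and eq: "AE x in lebesgue. u x = v x" "v \<in> borel_measurable lebesgue"
  shows "has_weak_gradient v G"
  unfolding has_weak_gradient_iff
proof (intro conjI ballI)
  have l: "loc_integrable u" using u unfolding has_weak_gradient_iff by blast
  show "loc_integrable v"
    by (rule loc_integrable_bound[OF l eq(2)]) (use eq(1) in \<open>auto elim: eventually_mono\<close>)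
  show "G \<in> borel_measurable lebesgue" using u unfolding has_weak_gradient_iff by blast
  fix i :: 'a assume i: "i \<in> Basis"
  show g: "loc_integrable (\<lambda>x. G x \<bullet> i)" using u i unfolding has_weak_gradient_iff by blast
  show "weak_partial v i (\<lambda>x. G x \<bullet> i)"
    by (rule weak_partial_AE_cong[of u i "\<lambda>x. G x \<bullet> i"])
      (use u i eq loc_integrable_measurable[OF l] loc_integrable_measurable[OF g] in \<open>auto simp: has_weak_gradient_iff\<close>)
qed

lemma pairing_dominated_tendsto:
  fixes v :: "nat \<Rightarrow> 'a::euclidean_space \<Rightarrow> real"
  assumes F: "loc_integrable F" and v: "\<And>n. v n \<in> borel_measurable lebesgue" "u \<in> borel_measurable lebesgue"
    and le: "\<And>n. AE x in lebesgue. \<bar>v n x\<bar> \<le> F x" and lim: "AE x in lebesgue. (\<lambda>n. v n x) \<longlonglongrightarrow> u x"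
    and h: "continuous_on UNIV h" "\<forall>x. \<bar>h x\<bar> \<le> C" "\<forall>x. r < norm x \<longrightarrow> h x = 0"
  shows "(\<lambda>n. \<integral>x. v n x * h x \<partial>lebesgue) \<longlonglongrightarrow> (\<integral>x. u x * h x \<partial>lebesgue)"
proof -
  have hm: "h \<in> borel_measurable lebesgue" by (rule continuous_imp_lebesgue_measurable[OF h(1)])
  have i: "integrable lebesgue (\<lambda>x. F x * \<bar>h x\<bar>)"
    by (rule loc_integrable_mult_bounded[OF F, of _ C r]) (use hm h in auto)
  show ?thesis
  proof (rule integral_dominated_convergence[OF _ _ i])
    show "AE x in lebesgue. (\<lambda>n. v n x * h x) \<longlonglongrightarrow> u x * h x"
      using lim by eventually_elim (intro tendsto_mult tendsto_const)
    show "AE x in lebesgue. norm (v n x * h x) \<le> F x * \<bar>h x\<bar>" for n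
      using le[of n] by eventually_elim (simp add: abs_mult mult_right_mono)
  qed (use v hm in simp_all)
qed

text \<open>Each test function lives on a ball, so locally integrable majorants of the functions and
  of the gradients let both sides of integration by parts pass to the limit.\<close>

lemma has_weak_gradient_dominated_limit:
  fixes v :: "nat \<Rightarrow> 'a::euclidean_space \<Rightarrow> real"
  assumes v: "\<And>n. has_weak_gradient (v n) (G n)"
    and F: "loc_integrable F" "\<And>n. AE x in lebesgue. \<bar>v n x\<bar> \<le> F x" "AE x in lebesgue. (\<lambda>n. v n x) \<longlonglongrightarrow> u x"
    and \<Gamma>: "loc_integrable \<Gamma>" "\<And>n. AE x in lebesgue. norm (G n x) \<le> \<Gamma> x" "AE x in lebesgue. (\<lambda>n. G n x) \<longlonglongrightarrow> H x"
    and m: "u \<in> borel_measurable lebesgue" "H \<in> borel_measurable lebesgue"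
  shows "has_weak_gradient u H"
  unfolding has_weak_gradient_iff
proof (intro conjI ballI)
  have vm: "v n \<in> borel_measurable lebesgue" for n
    using v[of n] loc_integrable_measurable unfolding has_weak_gradient_iff by blast
  have "AE x in lebesgue. \<forall>n. \<bar>v n x\<bar> \<le> F x" using F(2) unfolding AE_all_countable by blast
  then have "AE x in lebesgue. \<bar>u x\<bar> \<le> \<bar>F x\<bar>"
    using F(3)
  proof eventually_elim
    case (elim x)
    have "\<bar>u x\<bar> \<le> F x"
      by (rule LIMSEQ_le_const2[OF tendsto_rabs[OF elim(2)]]) (use elim(1) in blast)
    then show ?case by simp
  qed
  then show "loc_integrable u" by (rule loc_integrable_bound[OF F(1) m(1)])
  show "H \<in> borel_measurable lebesgue" by (rule m)
  fix i :: 'a assume i: "i \<in> Basis"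
  have g: "loc_integrable (\<lambda>x. G n x \<bullet> i)" "weak_partial (v n) i (\<lambda>x. G n x \<bullet> i)" for n
    using v[of n] i unfolding has_weak_gradient_iff by blast+
  have gm: "(\<lambda>x. G n x \<bullet> i) \<in> borel_measurable lebesgue" for n by (rule loc_integrable_measurable[OF g(1)])
  have Hm: "(\<lambda>x. H x \<bullet> i) \<in> borel_measurable lebesgue" using m(2) by simp
  have gle: "AE x in lebesgue. \<bar>G n x \<bullet> i\<bar> \<le> \<Gamma> x" for n
    using \<Gamma>(2)[of n] by eventually_elim (use Basis_le_norm[OF i] order_trans in blast)
  have glim: "AE x in lebesgue. (\<lambda>n. G n x \<bullet> i) \<longlonglongrightarrow> H x \<bullet> i"
    using \<Gamma>(3) by eventually_elim (intro tendsto_inner tendsto_const)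
  have "AE x in lebesgue. \<forall>n. \<bar>G n x \<bullet> i\<bar> \<le> \<Gamma> x" using gle unfolding AE_all_countable by blast
  then have "AE x in lebesgue. \<bar>H x \<bullet> i\<bar> \<le> \<bar>\<Gamma> x\<bar>"
    using glim
  proof eventually_elim
    case (elim x)
    have "\<bar>H x \<bullet> i\<bar> \<le> \<Gamma> x"
      by (rule LIMSEQ_le_const2[OF tendsto_rabs[OF elim(2)]]) (use elim(1) in blast)
    then show ?case by simp
  qed
  then show "loc_integrable (\<lambda>x. H x \<bullet> i)" by (rule loc_integrable_bound[OF \<Gamma>(1) Hm])
  show "weak_partial u i (\<lambda>x. H x \<bullet> i)" unfolding weak_partial_def
  proof (intro allI impI)
    fix \<phi> h :: "'a \<Rightarrow> real" assume \<phi>: "test_fun \<phi>" "has_partial \<phi> i h"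
    obtain r C where rC: "\<forall>x. r < norm x \<longrightarrow> \<phi> x = 0" "\<forall>x. r < norm x \<longrightarrow> h x = 0"
      "\<forall>x. \<bar>\<phi> x\<bar> \<le> C" "\<forall>x. \<bar>h x\<bar> \<le> C" "continuous_on UNIV \<phi>" "continuous_on UNIV h"
      using test_fun_partial_bounds[OF \<phi>(1) i \<phi>(2)] by auto
    have "(\<lambda>n. \<integral>x. v n x * h x \<partial>lebesgue) \<longlonglongrightarrow> (\<integral>x. u x * h x \<partial>lebesgue)"
      by (rule pairing_dominated_tendsto[OF F(1) vm m(1) F(2,3) rC(6,4,2)])
    moreover have "(\<lambda>n. - (\<integral>x. (G n x \<bullet> i) * \<phi> x \<partial>lebesgue)) \<longlonglongrightarrow> - (\<integral>x. (H x \<bullet> i) * \<phi> x \<partial>lebesgue)"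
      by (rule tendsto_minus[OF pairing_dominated_tendsto[OF \<Gamma>(1) gm Hm gle glim rC(5,3,1)]])
    ultimately show "(\<integral>x. u x * h x \<partial>lebesgue) = - (\<integral>x. (H x \<bullet> i) * \<phi> x \<partial>lebesgue)"
      using weak_partialD[OF g(2) \<phi>] LIMSEQ_unique by simp
  qed
qed

section \<open>Inequalities for powers of norms\<close>

lemma powr_midpoint:
  fixes x y q :: real
  assumes "x \<ge> 0" "y \<ge> 0" "q \<ge> 1"
  shows "((x + y) / 2) powr q \<le> (x powr q + y powr q) / 2"
proof -
  \<comment> \<open>If one argument vanishes, the claim is exactly this inequality for the other
    one.\<close>
  have half: "(z / 2) powr q \<le> z powr q / 2" if "z \<ge> 0" for z :: real
  proof -
    have "(1 / 2 :: real) powr q \<le> (1 / 2) powr 1" by (rule powr_mono') (use assms in auto)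
    then have "z powr q * (1 / 2) powr q \<le> z powr q * (1 / 2)" by (intro mult_left_mono) auto
    moreover have "(z / 2) powr q = z powr q * (1 / 2) powr q" using that by (simp add: powr_mult[symmetric])
    ultimately show ?thesis by simp
  qed
  show ?thesis
  proof (cases "x = 0 \<or> y = 0")
    case True
    then show ?thesis using half[of x] half[of y] assms by auto
  next
    case False
    then have xy: "x > 0" "y > 0" using assms by auto
    have "((1 / 2) *\<^sub>R x + (1 / 2) *\<^sub>R y) powr q \<le> (1 / 2) * x powr q + (1 / 2) * y powr q"
      using convex_onD[OF powr_convex[OF assms(3)], of "1/2" x y] xy by simp
    then show ?thesis by (simp add: add_divide_distrib)
  qed
qed

text \<open>After division by the sum \<open>s\<close>, both arguments lie in [0, 1], where a power
  with exponent at least 1 does not exceed the identity; the two fractions add up to 1.\<close>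

lemma powr_superadditive:
  fixes x y q :: real
  assumes "x \<ge> 0" "y \<ge> 0" "q \<ge> 1"
  shows "x powr q + y powr q \<le> (x + y) powr q"
proof (cases "x + y = 0")
  case True
  then have "x = 0" "y = 0" using assms by auto
  then show ?thesis by simp
next
  case False
  define s where "s = x + y"
  have s: "s > 0" using False assms by (simp add: s_def)
  have *: "z powr q \<le> s powr q * (z / s)" if "z \<ge> 0" "z \<le> s" for z
  proof -
    have "(z / s) powr q \<le> (z / s) powr 1" by (rule powr_mono') (use assms that s in auto)
    then have "(z / s) powr q \<le> z / s" using that s by simp
    then have "s powr q * (z / s) powr q \<le> s powr q * (z / s)" by (intro mult_left_mono) auto
    moreover have "s powr q * (z / s) powr q = z powr q" using that s by (simp add: powr_mult[symmetric])
    ultimately show ?thesis by simp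
  qed
  have "x powr q + y powr q \<le> s powr q * (x / s) + s powr q * (y / s)"
    by (intro add_mono *) (use assms in \<open>auto simp: s_def\<close>)
  also have "\<dots> = s powr q * ((x + y) / s)" by (simp add: add_divide_distrib distrib_left)
  also have "\<dots> = s powr q" using s by (simp add: s_def)
  finally show ?thesis by (simp add: s_def)
qed

text \<open>\<open>0 powr 0\<close> is 0, so for p = 2 the factor \<open>r powr (p - 2)\<close>
  drops from 1 to 0 at r = 0. The second factor vanishes there too, and the identity
  survives.\<close>

lemma powr_diff_two_mult_square:
  fixes r p :: real
  assumes "r \<ge> 0"
  shows "r powr (p - 2) * r\<^sup>2 = r powr p"
proof (cases "r = 0")
  case False
  then have "r powr 2 = r\<^sup>2" using assms by (simp add: powr_numeral)
  then have "r powr (p - 2) * r\<^sup>2 = r powr (p - 2) * r powr 2" by (simp only:)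
  also have "\<dots> = r powr (p - 2 + 2)" by (rule powr_add[symmetric])
  finally show ?thesis by simp
qed simp

lemma powr_diff_two_mult:
  fixes r p :: real
  assumes "r \<ge> 0"
  shows "r powr (p - 2) * r = r powr (p - 1)"
proof (cases "r = 0")
  case False
  then have "r powr (p - 2) * r powr 1 = r powr (p - 1)" by (simp only: powr_add[symmetric]) simp
  then show ?thesis using assms by simp
qed simp

lemma norm_powr_sq: "norm a powr p = ((norm a)\<^sup>2) powr (p / 2)" for a :: "'b::real_normed_vector"
proof (cases "a = 0")
  case False
  then have "norm a powr 2 = (norm a)\<^sup>2" by (simp add: powr_numeral)
  then have "((norm a)\<^sup>2) powr (p / 2) = (norm a powr 2) powr (p / 2)" by (simp only:)
  also have "\<dots> = norm a powr (2 * (p / 2))" by (rule powr_powr)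
  finally show ?thesis by simp
qed simp

text \<open>By the parallelogram law the squared norms of half sum and half difference add up to the
  mean of the squared norms of \<open>a\<close> and \<open>b\<close>. The power p/2, which is at
  least 1, is superadditive for the first pair and midpoint convex for the second.\<close>

lemma clarkson:
  fixes a b :: "'b::real_inner"
  assumes "p \<ge> 2"
  shows "norm ((a + b) /\<^sub>R 2) powr p + norm ((a - b) /\<^sub>R 2) powr p \<le> (norm a powr p + norm b powr p) / 2"
proof -
  define x where "x = (norm ((a + b) /\<^sub>R 2))\<^sup>2"
  define y where "y = (norm ((a - b) /\<^sub>R 2))\<^sup>2"
  have xy: "x + y = ((norm a)\<^sup>2 + (norm b)\<^sup>2) / 2"
    unfolding x_def y_def power2_norm_eq_inner by (simp add: inner_add inner_diff inner_commute field_simps)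
  have "norm ((a + b) /\<^sub>R 2) powr p + norm ((a - b) /\<^sub>R 2) powr p = x powr (p/2) + y powr (p/2)"
    unfolding x_def y_def by (simp only: norm_powr_sq[symmetric])
  also have "\<dots> \<le> (x + y) powr (p/2)" by (rule powr_superadditive) (use assms in \<open>auto simp: x_def y_def\<close>)
  also have "\<dots> \<le> (((norm a)\<^sup>2) powr (p/2) + ((norm b)\<^sup>2) powr (p/2)) / 2"
    unfolding xy by (rule powr_midpoint) (use assms in auto)
  finally show ?thesis by (simp only: norm_powr_sq[symmetric])
qed

text \<open>Bounding the sum by twice the larger norm gives a crude constant, but one valid for
  every exponent from 0 on; the exponent p - 2 may be below 1.\<close>

lemma norm_add_powr:
  fixes a b :: "'b::real_normed_vector"
  assumes "p \<ge> 0"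
  shows "norm (a + b) powr p \<le> 2 powr p * (norm a powr p + norm b powr p)"
proof -
  have "norm (a + b) \<le> 2 * max (norm a) (norm b)" using norm_triangle_ineq[of a b] by linarith
  then have "norm (a + b) powr p \<le> (2 * max (norm a) (norm b)) powr p" by (intro powr_mono2) (use assms in auto)
  also have "\<dots> = 2 powr p * max (norm a) (norm b) powr p" by (rule powr_mult)
  also have "\<dots> \<le> 2 powr p * (norm a powr p + norm b powr p)"
    by (intro mult_left_mono) (auto simp: max_def)
  finally show ?thesis .
qed

text \<open>The right side splits into (s + t)/2 times the squared distance and a product of two
  differences with the same sign, since r^(p-2) is nondecreasing. The distance to the power p - 2 is
  at most 2^(p-2) (s + t), and 2^(1-p) 2^(p-2) = 1/2 accounts for the constant.\<close>

lemma duality_map_monotone: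
  fixes a b :: "'b::real_inner"
  assumes p: "p \<ge> 2"
  shows "2 powr (1 - p) * norm (a - b) powr p \<le>
    (norm a powr (p - 2) *\<^sub>R a - norm b powr (p - 2) *\<^sub>R b) \<bullet> (a - b)"
proof -
  define s where "s = norm a powr (p - 2)"
  define t where "t = norm b powr (p - 2)"
  have s: "s \<ge> 0" "t \<ge> 0" by (auto simp: s_def t_def)
  have st: "0 \<le> (s - t) * ((norm a)\<^sup>2 - (norm b)\<^sup>2)"
  proof (cases "norm a \<le> norm b")
    case True
    then have "s \<le> t" unfolding s_def t_def using p by (intro powr_mono2) auto
    moreover have "(norm a)\<^sup>2 \<le> (norm b)\<^sup>2" using True by (intro power_mono) auto
    ultimately show ?thesis by (intro mult_nonpos_nonpos) auto
  next
    case False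
    then have "t \<le> s" unfolding s_def t_def using p by (intro powr_mono2) auto
    moreover have "(norm b)\<^sup>2 \<le> (norm a)\<^sup>2" using False by (intro power_mono) auto
    ultimately show ?thesis by (intro mult_nonneg_nonneg) auto
  qed
  have id: "(s *\<^sub>R a - t *\<^sub>R b) \<bullet> (a - b) = (s + t) / 2 * (norm (a - b))\<^sup>2 + (s - t) * ((norm a)\<^sup>2 - (norm b)\<^sup>2) / 2"
    unfolding power2_norm_eq_inner by (simp add: inner_diff inner_commute field_simps)
  have "norm (a - b) powr (p - 2) \<le> 2 powr (p - 2) * (norm a powr (p - 2) + norm b powr (p - 2))"
    using norm_add_powr[of "p - 2" a "- b"] p by simp
  then have le: "norm (a - b) powr (p - 2) \<le> 2 powr (p - 2) * (s + t)" by (simp add: s_def t_def)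
  have np: "norm (a - b) powr p = norm (a - b) powr (p - 2) * (norm (a - b))\<^sup>2"
    by (simp add: powr_diff_two_mult_square)
  have "2 powr (1 - p) * norm (a - b) powr p \<le> 2 powr (1 - p) * (2 powr (p - 2) * (s + t) * (norm (a - b))\<^sup>2)"
    unfolding np by (intro mult_left_mono mult_right_mono le) auto
  also have "\<dots> = (2 powr (1 - p) * 2 powr (p - 2)) * ((s + t) * (norm (a - b))\<^sup>2)" by (simp add: mult_ac)
  also have "2 powr (1 - p) * 2 powr (p - 2) = (2::real) powr (- 1)" by (simp add: powr_add[symmetric])
  also have "\<dots> = 1 / 2" by (simp add: powr_minus)
  finally show ?thesis using st id unfolding s_def t_def by simp
qed

lemma young_powr:
  fixes x y :: real
  assumes "p > 1" "x \<ge> 0" "y \<ge> 0"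
  shows "x * y powr (p - 1) \<le> x powr p / p + (1 - 1 / p) * y powr p"
proof -
  define q where "q = p / (p - 1)"
  have q: "q > 1" "1 / p + 1 / q = 1" "(p - 1) * q = p" "1 / q = 1 - 1 / p" using assms by (auto simp: q_def field_simps)
  have "x * y powr (p - 1) \<le> x powr p / p + (y powr (p - 1)) powr q / q"
    by (rule Youngs_inequality[OF assms(1) q(1,2) assms(2) powr_ge_zero])
  also have "(y powr (p - 1)) powr q = y powr p" by (simp only: powr_powr q(3))
  also have "y powr p / q = (1 - 1 / p) * y powr p" by (simp only: q(4)[symmetric]) simp
  finally show ?thesis .
qed

text \<open>The supporting hyperplane inequality for the p-th power of the norm at \<open>c\<close>,
  divided by p. It comes from Cauchy-Schwarz for the mixed term followed by Young's
  inequality.\<close>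

lemma norm_powr_convex:
  fixes a c :: "'b::real_inner"
  assumes p: "p \<ge> 2"
  shows "(norm c powr p - norm a powr p) / p \<le> norm c powr (p - 2) * (c \<bullet> (c - a))"
proof -
  have cc: "norm c powr (p - 2) * (c \<bullet> c) = norm c powr p"
    unfolding power2_norm_eq_inner[symmetric] by (simp add: powr_diff_two_mult_square)
  have c1: "norm c powr (p - 2) * norm c = norm c powr (p - 1)" by (rule powr_diff_two_mult) simp
  have "norm c powr (p - 2) * (c \<bullet> a) \<le> norm c powr (p - 2) * (norm c * norm a)"
    by (intro mult_left_mono norm_cauchy_schwarz) auto
  also have "\<dots> = norm a * norm c powr (p - 1)" using c1 by (simp add: mult_ac)
  also have "\<dots> \<le> norm a powr p / p + (1 - 1 / p) * norm c powr p" by (rule young_powr) (use p in auto)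
  finally have "norm c powr (p - 2) * (c \<bullet> a) \<le> norm a powr p / p + (norm c powr p - norm c powr p / p)"
    by (simp add: left_diff_distrib)
  then show ?thesis unfolding inner_diff_right right_diff_distrib cc diff_divide_distrib by linarith
qed

section \<open>Fast Cauchy sequences in \<open>L\<^sup>p\<close>\<close>

text \<open>\<open>H\<close> is the sum of the weighted powers 2^(pn) d_n^p, whose integrals are at
  most 2^(-n). Each single term lies below the sum, and its p-th root is 2^n d_n.\<close>

lemma fast_dominated:
  fixes d :: "nat \<Rightarrow> 'b \<Rightarrow> real"
  assumes p: "p \<ge> 1" and d0: "\<And>n x. 0 \<le> d n x" and i: "\<And>n. integrable M (\<lambda>x. d n x powr p)"
    and le: "\<And>n. (\<integral>x. d n x powr p \<partial>M) \<le> 2 powr (- (p + 1) * real n)"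
  shows "\<exists>H. integrable M H \<and> (\<forall>x. 0 \<le> H x) \<and> (AE x in M. \<forall>n. d n x \<le> (1/2) ^ n * H x powr (1 / p))"
proof -
  define w where "w n x = 2 powr (p * real n) * d n x powr p" for n x
  have w0: "0 \<le> w n x" for n x by (simp add: w_def)
  have iw: "integrable M (w n)" for n unfolding w_def using i by simp
  have wle: "(\<integral>x. w n x \<partial>M) \<le> (1/2) ^ n" for n
  proof -
    have "(\<integral>x. w n x \<partial>M) = 2 powr (p * real n) * (\<integral>x. d n x powr p \<partial>M)" by (simp add: w_def)
    also have "\<dots> \<le> 2 powr (p * real n) * 2 powr (- (p + 1) * real n)" by (intro mult_left_mono le) auto
    also have "\<dots> = 2 powr (- real n)" by (simp add: powr_add[symmetric] algebra_simps)
    also have "\<dots> = (1/2) ^ n" by (simp add: powr_minus powr_realpow power_divide inverse_eq_divide)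
    finally show ?thesis .
  qed
  have sg: "summable (\<lambda>n. (1/2 :: real) ^ n)" by (rule summable_geometric) simp
  have sw: "summable (\<lambda>n. \<integral>x. norm (w n x) \<partial>M)"
    by (rule summable_comparison_test[OF _ sg]) (use wle w0 in \<open>auto simp: integral_nonneg_AE intro!: exI[of _ 0]\<close>)
  have "(\<integral>\<^sup>+x. (\<Sum>n. ennreal (w n x)) \<partial>M) = (\<Sum>n. \<integral>\<^sup>+x. ennreal (w n x) \<partial>M)"
    by (rule nn_integral_suminf) (use iw borel_measurable_integrable in measurable)
  also have "\<dots> = (\<Sum>n. ennreal (\<integral>x. w n x \<partial>M))"
    by (intro suminf_cong nn_integral_eq_integral iw) (simp add: w0)
  also have "\<dots> = ennreal (\<Sum>n. \<integral>x. w n x \<partial>M)"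
    by (rule suminf_ennreal2) (use sw w0 in \<open>auto simp: integral_nonneg_AE\<close>)
  finally have fin: "(\<integral>\<^sup>+x. (\<Sum>n. ennreal (w n x)) \<partial>M) \<noteq> \<infinity>" by simp
  have wm: "w n \<in> borel_measurable M" for n using iw by (rule borel_measurable_integrable)
  have "AE x in M. (\<Sum>n. ennreal (w n x)) \<noteq> \<infinity>"
    by (rule nn_integral_PInf_AE[OF _ fin]) (use wm in measurable)
  then have ae: "AE x in M. summable (\<lambda>n. w n x)"
    by eventually_elim (rule summable_suminf_not_top, use w0 in auto)
  have iH: "integrable M (\<lambda>x. \<Sum>n. w n x)"
    by (rule integrable_suminf[OF iw _ sw]) (use ae w0 in simp)
  \<comment> \<open>The absolute value keeps \<open>H\<close> nonnegative also on the null set where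
    the series diverges and its sum is unspecified.\<close>
  define H where "H x = \<bar>\<Sum>n. w n x\<bar>" for x
  show ?thesis
  proof (intro exI[of _ H] conjI allI)
    show "integrable M H" unfolding H_def using iH by (rule Bochner_Integration.integrable_abs)
    show "0 \<le> H x" for x by (simp add: H_def)
    show "AE x in M. \<forall>n. d n x \<le> (1/2) ^ n * H x powr (1 / p)"
      using ae
    proof eventually_elim
      case (elim x)
      show ?case
      proof
        fix n
        have "w n x \<le> (\<Sum>n. w n x)"
          using sum_le_suminf[OF elim, of "{n}"] w0 by simp
        then have "w n x \<le> H x" unfolding H_def by linarith
        then have "w n x powr (1/p) \<le> H x powr (1/p)" using p w0 by (intro powr_mono2) auto
        moreover have "w n x powr (1/p) = 2 ^ n * d n x"
        proof -
          have "w n x powr (1/p) = (2 powr (p * real n)) powr (1/p) * (d n x powr p) powr (1/p)"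
            unfolding w_def by (rule powr_mult)
          also have "\<dots> = 2 powr real n * d n x" using p d0[of n x] by (simp add: powr_powr)
          finally show ?thesis by (simp add: powr_realpow)
        qed
        ultimately have "2 ^ n * d n x \<le> H x powr (1/p)" by simp
        then show "d n x \<le> (1/2) ^ n * H x powr (1 / p)" by (simp add: power_divide field_simps)
      qed
    qed
  qed
qed

lemma summable_diff_convergent:
  fixes f :: "nat \<Rightarrow> 'b::banach"
  assumes "\<And>n. norm (f (Suc n) - f n) \<le> (1/2) ^ n * c"
  shows "convergent f" "norm (f n) \<le> norm (f 0) + 2 * c"
proof -
  have sg: "(\<lambda>n. (1/2 :: real) ^ n) sums 2" using geometric_sums[of "1/2 :: real"] by simp
  have sc: "(\<lambda>n. (1/2) ^ n * c) sums (2 * c)" by (rule sums_mult2[OF sg])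
  have s: "summable (\<lambda>n. f (Suc n) - f n)"
    by (rule summable_comparison_test[OF _ sums_summable[OF sc]]) (use assms in auto)
  have "f = (\<lambda>n. (\<Sum>k<n. f (Suc k) - f k) + f 0)" by (simp add: sum_lessThan_telescope)
  moreover have "convergent (\<lambda>n. (\<Sum>k<n. f (Suc k) - f k) + f 0)"
    by (rule convergentI[OF tendsto_add[OF summable_LIMSEQ[OF s] tendsto_const]])
  ultimately show "convergent f" by simp
  have c0: "c \<ge> 0" using order_trans[OF norm_ge_zero assms[of 0]] by simp
  have "norm (f n - f 0) = norm (\<Sum>k<n. f (Suc k) - f k)" by (simp add: sum_lessThan_telescope)
  also have "\<dots> \<le> (\<Sum>k<n. (1/2) ^ k * c)" by (intro sum_norm_le assms)
  also have "\<dots> \<le> 2 * c"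
    using sum_le_suminf[OF sums_summable[OF sc], of "{..<n}"] c0 sums_unique[OF sc] by simp
  finally show "norm (f n) \<le> norm (f 0) + 2 * c" using norm_triangle_ineq2[of "f n" "f 0"] by linarith
qed

text \<open>The steps are at most 2^(-n) H^(1/p), so the sequence converges and never leaves the
  ball of radius 2 H^(1/p) around its first member. This radius plus the norm of the first member is
  the majorant.\<close>

lemma Lp_fast_Cauchy:
  fixes f :: "nat \<Rightarrow> 'b \<Rightarrow> 'c::euclidean_space"
  assumes p: "p \<ge> 1" and f: "\<And>n. f n \<in> borel_measurable M" and i0: "integrable M (\<lambda>x. norm (f 0 x) powr p)"
    and i: "\<And>n. integrable M (\<lambda>x. norm (f (Suc n) x - f n x) powr p)"
    and le: "\<And>n. (\<integral>x. norm (f (Suc n) x - f n x) powr p \<partial>M) \<le> 2 powr (- (p + 1) * real n)"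
  shows "\<exists>F. F \<in> borel_measurable M \<and> (\<forall>x. 0 \<le> F x) \<and> integrable M (\<lambda>x. F x powr p) \<and>
    (AE x in M. (\<forall>n. norm (f n x) \<le> F x) \<and> convergent (\<lambda>n. f n x))"
proof -
  obtain H where H: "integrable M H" "\<forall>x. 0 \<le> H x"
      "AE x in M. \<forall>n. norm (f (Suc n) x - f n x) \<le> (1/2) ^ n * H x powr (1 / p)"
    using fast_dominated[OF p norm_ge_zero i le] by blast
  have Hm: "H \<in> borel_measurable M" using H(1) by (rule borel_measurable_integrable)
  define F where "F x = norm (f 0 x) + 2 * H x powr (1 / p)" for x
  show ?thesis
  proof (intro exI[of _ F] conjI allI)
    show Fm: "F \<in> borel_measurable M" unfolding F_def using f[of 0] Hm by measurable
    show "0 \<le> F x" for x by (simp add: F_def)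
    show "AE x in M. (\<forall>n. norm (f n x) \<le> F x) \<and> convergent (\<lambda>n. f n x)"
      using H(3)
    proof eventually_elim
      case (elim x)
      have "norm (f n x) \<le> F x" for n
        unfolding F_def by (rule summable_diff_convergent(2)) (use elim in blast)
      moreover have "convergent (\<lambda>n. f n x)" by (rule summable_diff_convergent(1)) (use elim in blast)
      ultimately show ?case by blast
    qed
    have iB: "integrable M (\<lambda>x. 2 powr p * (norm (f 0 x) powr p + 2 powr p * H x))"
      using i0 H(1) by simp
    have "F x powr p \<le> 2 powr p * (norm (f 0 x) powr p + 2 powr p * H x)" for x
    proof -
      have "norm (norm (f 0 x) + 2 * H x powr (1 / p)) powr p \<le> 2 powr p * (norm (norm (f 0 x)) powr p + norm (2 * H x powr (1 / p)) powr p)"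
        by (rule norm_add_powr) (use p in simp)
      moreover have "norm (2 * H x powr (1 / p)) powr p = 2 powr p * H x"
        using p H(2) by (simp add: powr_mult powr_powr)
      ultimately show ?thesis by (simp add: F_def)
    qed
    then show "integrable M (\<lambda>x. F x powr p)"
      by (intro Bochner_Integration.integrable_bound[OF iB] AE_I2) (use Fm H(2) in auto)
  qed
qed

section \<open>The energy space\<close>

lemma Lp_loc_integrable:
  fixes u :: "'a::euclidean_space \<Rightarrow> real"
  assumes p: "p \<ge> 1" and u: "u \<in> borel_measurable lebesgue" "integrable lebesgue (\<lambda>x. \<bar>u x\<bar> powr p)"
  shows "loc_integrable u"
proof -
  have "integrable lebesgue (\<lambda>x. indicator (ball 0 R) x * u x)" for R
  proof (rule Bochner_Integration.integrable_bound)
    show "integrable lebesgue (\<lambda>x. indicator (ball 0 R) x + \<bar>u x\<bar> powr p)"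
      using u(2) lmeasurable_ball[of "0::'a" R] by (simp add: lmeasurable_iff_integrable)
    show "(\<lambda>x. indicator (ball 0 R) x * u x) \<in> borel_measurable lebesgue"
      by (rule indicator_ball_mult_measurable[OF u(1)])
    have "\<bar>y\<bar> \<le> 1 + \<bar>y\<bar> powr p" for y :: real
    proof (cases "\<bar>y\<bar> \<le> 1")
      case False
      then have "\<bar>y\<bar> powr 1 \<le> \<bar>y\<bar> powr p" using p by (intro powr_mono) auto
      then show ?thesis by simp
    qed (simp add: add_increasing2)
    then show "AE x in lebesgue. norm (indicator (ball 0 R) x * u x) \<le> norm (indicator (ball 0 R) x + \<bar>u x\<bar> powr p)"
      by (intro AE_I2) (auto simp: indicator_def)
  qed
  then show ?thesis using u(1) by (simp add: loc_integrable_iff_ball)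
qed

lemma Lp_lincomb:
  fixes G H :: "'b \<Rightarrow> 'c::euclidean_space"
  assumes p: "p \<ge> 0" and m: "G \<in> borel_measurable M" "H \<in> borel_measurable M"
    and i: "integrable M (\<lambda>x. norm (G x) powr p)" "integrable M (\<lambda>x. norm (H x) powr p)"
  shows "integrable M (\<lambda>x. norm (a *\<^sub>R G x + b *\<^sub>R H x) powr p)"
proof (rule Bochner_Integration.integrable_bound)
  show "integrable M (\<lambda>x. 2 powr p * (\<bar>a\<bar> powr p * norm (G x) powr p + \<bar>b\<bar> powr p * norm (H x) powr p))"
    using i by simp
  show "(\<lambda>x. norm (a *\<^sub>R G x + b *\<^sub>R H x) powr p) \<in> borel_measurable M" using m by measurable
  show "AE x in M. norm (norm (a *\<^sub>R G x + b *\<^sub>R H x) powr p) \<le> norm (2 powr p * (\<bar>a\<bar> powr p * norm (G x) powr p + \<bar>b\<bar> powr p * norm (H x) powr p))"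
  proof (rule AE_I2)
    fix x
    have "norm (a *\<^sub>R G x + b *\<^sub>R H x) powr p \<le> 2 powr p * (norm (a *\<^sub>R G x) powr p + norm (b *\<^sub>R H x) powr p)"
      by (rule norm_add_powr[OF p])
    also have "\<dots> = 2 powr p * (\<bar>a\<bar> powr p * norm (G x) powr p + \<bar>b\<bar> powr p * norm (H x) powr p)"
      by (simp add: powr_mult)
    finally show "norm (norm (a *\<^sub>R G x + b *\<^sub>R H x) powr p) \<le> norm (2 powr p * (\<bar>a\<bar> powr p * norm (G x) powr p + \<bar>b\<bar> powr p * norm (H x) powr p))"
      by simp
  qed
qed

lemma Lp_clarkson:
  fixes G H :: "'b \<Rightarrow> 'c::euclidean_space"
  assumes p: "p \<ge> 2" and m: "G \<in> borel_measurable M" "H \<in> borel_measurable M"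
    and i: "integrable M (\<lambda>x. norm (G x) powr p)" "integrable M (\<lambda>x. norm (H x) powr p)"
  shows "(\<integral>x. norm ((G x + H x) /\<^sub>R 2) powr p \<partial>M) + (\<integral>x. norm ((G x - H x) /\<^sub>R 2) powr p \<partial>M)
    \<le> ((\<integral>x. norm (G x) powr p \<partial>M) + (\<integral>x. norm (H x) powr p \<partial>M)) / 2"
proof -
  have 1: "integrable M (\<lambda>x. norm ((G x + H x) /\<^sub>R 2) powr p)"
    using Lp_lincomb[OF _ m i, of "1/2" "1/2"] p by (simp add: scaleR_add_right)
  have 2: "integrable M (\<lambda>x. norm ((G x - H x) /\<^sub>R 2) powr p)"
    using Lp_lincomb[OF _ m i, of "1/2" "-1/2"] p by (simp add: scaleR_diff_right)
  have "(\<integral>x. norm ((G x + H x) /\<^sub>R 2) powr p + norm ((G x - H x) /\<^sub>R 2) powr p \<partial>M)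
      \<le> (\<integral>x. (norm (G x) powr p + norm (H x) powr p) / 2 \<partial>M)"
    by (rule integral_mono) (use 1 2 i clarkson[OF p] in simp_all)
  then show ?thesis using 1 2 i by simp
qed

lemma Lp_dominated_tendsto:
  fixes f :: "nat \<Rightarrow> 'b \<Rightarrow> 'c::euclidean_space"
  assumes p: "p > 0" and m: "\<And>n. f n \<in> borel_measurable M" "g \<in> borel_measurable M" "F \<in> borel_measurable M"
    and F: "integrable M (\<lambda>x. F x powr p)" "\<And>n. AE x in M. norm (f n x) \<le> F x" "AE x in M. (\<lambda>n. f n x) \<longlonglongrightarrow> g x"
  shows "(\<lambda>n. \<integral>x. norm (f n x) powr p \<partial>M) \<longlonglongrightarrow> (\<integral>x. norm (g x) powr p \<partial>M)"
    and "integrable M (\<lambda>x. norm (g x) powr p)"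
proof -
  have m1: "(\<lambda>x. norm (g x) powr p) \<in> borel_measurable M" "\<And>n. (\<lambda>x. norm (f n x) powr p) \<in> borel_measurable M"
    using m by measurable
  have l: "AE x in M. (\<lambda>n. norm (f n x) powr p) \<longlonglongrightarrow> norm (g x) powr p"
    using F(3)
  proof eventually_elim
    case (elim x)
    show ?case by (rule tendsto_powr2[OF tendsto_norm[OF elim] tendsto_const _ p]) simp
  qed
  have b: "AE x in M. norm (norm (f n x) powr p) \<le> F x powr p" for n
    using F(2)[of n] by eventually_elim (use p in \<open>auto intro!: powr_mono2\<close>)
  show "(\<lambda>n. \<integral>x. norm (f n x) powr p \<partial>M) \<longlonglongrightarrow> (\<integral>x. norm (g x) powr p \<partial>M)"
    by (rule integral_dominated_convergence[OF m1 F(1) l b])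
  show "integrable M (\<lambda>x. norm (g x) powr p)"
    by (rule integrable_dominated_convergence[OF m1 F(1) l b])
qed

lemma half_scaleR_add: "(1/2) *\<^sub>R G + (1/2) *\<^sub>R H = (G + H) /\<^sub>R 2" for G H :: "'b::real_vector"
  by (simp add: scaleR_add_right inverse_eq_divide)

lemma norm_half_powr: "norm (z /\<^sub>R 2) powr p = norm z powr p / 2 powr p" for z :: "'b::real_normed_vector"
  by (simp add: powr_divide)

locale potential =
  fixes V :: "'a::euclidean_space \<Rightarrow> real" and p :: real
  assumes p2: "p \<ge> 2" and V_meas: "V \<in> borel_measurable lebesgue" and V_ge_1: "AE x in lebesgue. 1 \<le> V x"
begin

abbreviation X :: "('a \<Rightarrow> real) \<Rightarrow> bool" where "X \<equiv> Xspace V p"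

definition energy :: "('a \<Rightarrow> real) \<Rightarrow> real" where
  "energy v = (\<integral>x. norm (wgrad v x) powr p \<partial>lebesgue) + (\<integral>x. V x * \<bar>v x\<bar> powr p \<partial>lebesgue)"

text \<open>Multiplication by V^(1/p) turns the potential term into a plain p-th power, so the facts
  proved for gradients apply to it verbatim.\<close>

definition wt :: "'a \<Rightarrow> real" where "wt x = V x powr (1 / p)"

lemma wt_meas: "wt \<in> borel_measurable lebesgue"
  unfolding wt_def[abs_def] using V_meas by measurable

lemma wt_ge_1: "AE x in lebesgue. 1 \<le> wt x"
  using V_ge_1
proof eventually_elim
  case (elim x)
  then show ?case unfolding wt_def using p2 by (intro ge_one_powr_ge_zero) auto
qed

text \<open>The quantifier over \<open>y\<close> stands inside, so one null set serves every
  function substituted for \<open>y\<close>.\<close>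

lemma wt_powr: "AE x in lebesgue. \<forall>y. norm (wt x * y) powr p = V x * \<bar>y\<bar> powr p"
  using V_ge_1
proof eventually_elim
  case (elim x)
  have "norm (wt x * y) powr p = wt x powr p * \<bar>y\<bar> powr p" for y
    by (simp add: wt_def abs_mult powr_mult)
  moreover have "wt x powr p = V x" using elim p2 by (simp add: wt_def powr_powr)
  ultimately show ?case by simp
qed

lemma weighted_integral:
  assumes "v \<in> borel_measurable lebesgue"
  shows "(\<integral>x. V x * \<bar>v x\<bar> powr p \<partial>lebesgue) = (\<integral>x. norm (wt x * v x) powr p \<partial>lebesgue)"
    and "integrable lebesgue (\<lambda>x. V x * \<bar>v x\<bar> powr p) \<longleftrightarrow> integrable lebesgue (\<lambda>x. norm (wt x * v x) powr p)"
proof -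
  have m: "(\<lambda>x. V x * \<bar>v x\<bar> powr p) \<in> borel_measurable lebesgue" "(\<lambda>x. norm (wt x * v x) powr p) \<in> borel_measurable lebesgue"
    using assms V_meas wt_meas by measurable
  have ae: "AE x in lebesgue. V x * \<bar>v x\<bar> powr p = norm (wt x * v x) powr p"
    using wt_powr by eventually_elim simp
  show "(\<integral>x. V x * \<bar>v x\<bar> powr p \<partial>lebesgue) = (\<integral>x. norm (wt x * v x) powr p \<partial>lebesgue)"
    by (rule integral_cong_AE[OF m ae])
  show "integrable lebesgue (\<lambda>x. V x * \<bar>v x\<bar> powr p) \<longleftrightarrow> integrable lebesgue (\<lambda>x. norm (wt x * v x) powr p)"
    by (rule integrable_cong_AE[OF m ae])
qed

lemma weighted_imp_unweighted:
  assumes v: "v \<in> borel_measurable lebesgue" "integrable lebesgue (\<lambda>x. V x * \<bar>v x\<bar> powr p)"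
  shows "integrable lebesgue (\<lambda>x. \<bar>v x\<bar> powr p)"
    and "(\<integral>x. \<bar>v x\<bar> powr p \<partial>lebesgue) \<le> (\<integral>x. V x * \<bar>v x\<bar> powr p \<partial>lebesgue)"
proof -
  have ae: "AE x in lebesgue. \<bar>v x\<bar> powr p \<le> V x * \<bar>v x\<bar> powr p"
    using V_ge_1
  proof eventually_elim
    case (elim x)
    have "1 * \<bar>v x\<bar> powr p \<le> V x * \<bar>v x\<bar> powr p" by (rule mult_right_mono[OF elim]) simp
    then show ?case by simp
  qed
  have m: "(\<lambda>x. \<bar>v x\<bar> powr p) \<in> borel_measurable lebesgue" using v(1) by measurable
  show i: "integrable lebesgue (\<lambda>x. \<bar>v x\<bar> powr p)"
    by (rule Bochner_Integration.integrable_bound[OF v(2) m]) (use ae in \<open>eventually_elim, simp\<close>)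
  show "(\<integral>x. \<bar>v x\<bar> powr p \<partial>lebesgue) \<le> (\<integral>x. V x * \<bar>v x\<bar> powr p \<partial>lebesgue)"
    by (rule integral_mono_AE[OF i v(2) ae])
qed

lemma XspaceD:
  assumes "X v"
  shows "has_weak_gradient v (wgrad v)" "wgrad v \<in> borel_measurable lebesgue" "v \<in> borel_measurable lebesgue"
    "integrable lebesgue (\<lambda>x. norm (wgrad v x) powr p)" "integrable lebesgue (\<lambda>x. V x * \<bar>v x\<bar> powr p)"
    "integrable lebesgue (\<lambda>x. \<bar>v x\<bar> powr p)" "integrable lebesgue (\<lambda>x. norm (wt x * v x) powr p)"
proof -
  obtain G where G: "has_weak_gradient v G" "Lp p (\<lambda>x. norm (G x))"
    using assms unfolding Xspace_def W1p_def by blast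
  show h: "has_weak_gradient v (wgrad v)" by (rule wgrad_eqI(1)[OF G(1)])
  then show wm: "wgrad v \<in> borel_measurable lebesgue" unfolding has_weak_gradient_iff by blast
  show vm: "v \<in> borel_measurable lebesgue" using assms unfolding Xspace_def W1p_def Lp_def by blast
  have Gm: "G \<in> borel_measurable lebesgue" using G(1) unfolding has_weak_gradient_iff by blast
  have "integrable lebesgue (\<lambda>x. norm (G x) powr p)" using G(2) unfolding Lp_def by simp
  moreover have "integrable lebesgue (\<lambda>x. norm (wgrad v x) powr p) \<longleftrightarrow> integrable lebesgue (\<lambda>x. norm (G x) powr p)"
  proof (rule integrable_cong_AE)
    show "AE x in lebesgue. norm (wgrad v x) powr p = norm (G x) powr p"
      using wgrad_eqI(2)[OF G(1)] by eventually_elim simp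
  qed (use wm Gm in measurable)
  ultimately show "integrable lebesgue (\<lambda>x. norm (wgrad v x) powr p)" by blast
  show iV: "integrable lebesgue (\<lambda>x. V x * \<bar>v x\<bar> powr p)" using assms unfolding Xspace_def by blast
  show "integrable lebesgue (\<lambda>x. \<bar>v x\<bar> powr p)" by (rule weighted_imp_unweighted(1)[OF vm iV])
  show "integrable lebesgue (\<lambda>x. norm (wt x * v x) powr p)" using iV weighted_integral(2)[OF vm] by blast
qed

lemma XspaceI:
  assumes G: "has_weak_gradient v G" "integrable lebesgue (\<lambda>x. norm (G x) powr p)"
    and v: "integrable lebesgue (\<lambda>x. V x * \<bar>v x\<bar> powr p)"
  shows "X v" "energy v = (\<integral>x. norm (G x) powr p \<partial>lebesgue) + (\<integral>x. V x * \<bar>v x\<bar> powr p \<partial>lebesgue)"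
    "AE x in lebesgue. wgrad v x = G x"
proof -
  have vm: "v \<in> borel_measurable lebesgue" using G(1) loc_integrable_measurable unfolding has_weak_gradient_iff by blast
  have Gm: "G \<in> borel_measurable lebesgue" using G(1) unfolding has_weak_gradient_iff by blast
  have wm: "wgrad v \<in> borel_measurable lebesgue" using wgrad_eqI(1)[OF G(1)] unfolding has_weak_gradient_iff by blast
  have "Lp p v" unfolding Lp_def using vm weighted_imp_unweighted(1)[OF vm v] by blast
  moreover have "Lp p (\<lambda>x. norm (G x))" unfolding Lp_def using Gm G(2) by simp
  ultimately show "X v" unfolding Xspace_def W1p_def using G(1) v by blast
  show ae: "AE x in lebesgue. wgrad v x = G x" by (rule wgrad_eqI(2)[OF G(1)])
  have "(\<integral>x. norm (wgrad v x) powr p \<partial>lebesgue) = (\<integral>x. norm (G x) powr p \<partial>lebesgue)"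
  proof (rule integral_cong_AE)
    show "AE x in lebesgue. norm (wgrad v x) powr p = norm (G x) powr p" using ae by eventually_elim simp
  qed (use wm Gm in measurable)
  then show "energy v = (\<integral>x. norm (G x) powr p \<partial>lebesgue) + (\<integral>x. V x * \<bar>v x\<bar> powr p \<partial>lebesgue)"
    by (simp add: energy_def)
qed

lemma weighted_nonneg: "0 \<le> (\<integral>x. V x * \<bar>v x\<bar> powr p \<partial>lebesgue)"
  by (rule integral_nonneg_AE) (use V_ge_1 in \<open>eventually_elim, simp\<close>)

lemma energy_nonneg: "0 \<le> energy v"
  unfolding energy_def by (intro add_nonneg_nonneg weighted_nonneg) (rule integral_nonneg_AE, simp)

lemma Xnorm_energy: "Xnorm V p v = energy v powr (1 / p)" "Xnorm V p v powr p = energy v"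
proof -
  show 1: "Xnorm V p v = energy v powr (1 / p)" by (simp add: Xnorm_def energy_def)
  show "Xnorm V p v powr p = energy v" unfolding 1 using p2 energy_nonneg[of v] by (simp add: powr_powr)
qed

lemma X_lincomb:
  assumes u: "X u" and v: "X v"
  shows "X (\<lambda>x. a * u x + b * v x)"
    "AE x in lebesgue. wgrad (\<lambda>x. a * u x + b * v x) x = a *\<^sub>R wgrad u x + b *\<^sub>R wgrad v x"
    "energy (\<lambda>x. a * u x + b * v x) = (\<integral>x. norm (a *\<^sub>R wgrad u x + b *\<^sub>R wgrad v x) powr p \<partial>lebesgue)
       + (\<integral>x. norm (a *\<^sub>R (wt x * u x) + b *\<^sub>R (wt x * v x)) powr p \<partial>lebesgue)"
proof -
  note u = XspaceD[OF u] and v = XspaceD[OF v]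
  have p0: "p \<ge> 0" using p2 by simp
  have m: "(\<lambda>x. a * u x + b * v x) \<in> borel_measurable lebesgue" using u(3) v(3) by simp
  have mw: "(\<lambda>x. wt x * u x) \<in> borel_measurable lebesgue" "(\<lambda>x. wt x * v x) \<in> borel_measurable lebesgue"
    using u(3) v(3) wt_meas by simp_all
  have eq: "wt x * (a * u x + b * v x) = a *\<^sub>R (wt x * u x) + b *\<^sub>R (wt x * v x)" for x by (simp add: algebra_simps)
  have "integrable lebesgue (\<lambda>x. norm (wt x * (a * u x + b * v x)) powr p)"
    unfolding eq by (rule Lp_lincomb[OF p0 mw u(7) v(7)])
  then have iV: "integrable lebesgue (\<lambda>x. V x * \<bar>a * u x + b * v x\<bar> powr p)"
    using weighted_integral(2)[OF m] by simp
  have "integrable lebesgue (\<lambda>x. norm (a *\<^sub>R wgrad u x + b *\<^sub>R wgrad v x) powr p)"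
    by (rule Lp_lincomb[OF p0 u(2) v(2) u(4) v(4)])
  note I = XspaceI[OF has_weak_gradient_lincomb[OF u(1) v(1)] this iV]
  show "X (\<lambda>x. a * u x + b * v x)"
    "AE x in lebesgue. wgrad (\<lambda>x. a * u x + b * v x) x = a *\<^sub>R wgrad u x + b *\<^sub>R wgrad v x"
    by (rule I)+
  show "energy (\<lambda>x. a * u x + b * v x) = (\<integral>x. norm (a *\<^sub>R wgrad u x + b *\<^sub>R wgrad v x) powr p \<partial>lebesgue)
       + (\<integral>x. norm (a *\<^sub>R (wt x * u x) + b *\<^sub>R (wt x * v x)) powr p \<partial>lebesgue)"
    using I(2) weighted_integral(1)[OF m] unfolding eq by simp
qed

lemma energy_wt: "X v \<Longrightarrow> energy v = (\<integral>x. norm (wgrad v x) powr p \<partial>lebesgue) + (\<integral>x. norm (wt x * v x) powr p \<partial>lebesgue)"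
  unfolding energy_def using weighted_integral(1)[OF XspaceD(3)] by simp

lemma X_diff:
  assumes "X u" "X v"
  shows "X (\<lambda>x. u x - v x)" "AE x in lebesgue. wgrad (\<lambda>x. u x - v x) x = wgrad u x - wgrad v x"
    "energy (\<lambda>x. u x - v x) = (\<integral>x. norm (wgrad u x - wgrad v x) powr p \<partial>lebesgue)
       + (\<integral>x. norm (wt x * u x - wt x * v x) powr p \<partial>lebesgue)"
  using X_lincomb[OF assms, of 1 "-1"] by simp_all

lemma X_mid: "X u \<Longrightarrow> X v \<Longrightarrow> X (\<lambda>x. (u x + v x) / 2)"
  using X_lincomb(1)[of u v "1/2" "1/2"] by (simp add: add_divide_distrib)

lemma energy_clarkson:
  assumes u: "X u" and v: "X v"
  shows "energy (\<lambda>x. (u x + v x) / 2) + energy (\<lambda>x. u x - v x) / 2 powr p \<le> (energy u + energy v) / 2"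
proof -
  note U = XspaceD[OF u] and W = XspaceD[OF v]
  have mw: "(\<lambda>x. wt x * u x) \<in> borel_measurable lebesgue" "(\<lambda>x. wt x * v x) \<in> borel_measurable lebesgue"
    using U(3) W(3) wt_meas by simp_all
  have 1: "energy (\<lambda>x. (u x + v x) / 2) = (\<integral>x. norm ((wgrad u x + wgrad v x) /\<^sub>R 2) powr p \<partial>lebesgue)
      + (\<integral>x. norm ((wt x * u x + wt x * v x) /\<^sub>R 2) powr p \<partial>lebesgue)"
  proof -
    have "(\<lambda>x. (u x + v x) / 2) = (\<lambda>x. (1/2) * u x + (1/2) * v x)" by (simp add: add_divide_distrib)
    then show ?thesis using X_lincomb(3)[OF u v, of "1/2" "1/2"] by (simp only: half_scaleR_add)
  qed
  have 2: "energy (\<lambda>x. u x - v x) / 2 powr p = (\<integral>x. norm ((wgrad u x - wgrad v x) /\<^sub>R 2) powr p \<partial>lebesgue)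
      + (\<integral>x. norm ((wt x * u x - wt x * v x) /\<^sub>R 2) powr p \<partial>lebesgue)"
    unfolding norm_half_powr X_diff(3)[OF u v] by (simp add: add_divide_distrib)
  show ?thesis
    unfolding 1 2 energy_wt[OF u] energy_wt[OF v]
    using Lp_clarkson[OF p2 U(2) W(2) U(4) W(4)] Lp_clarkson[OF p2 mw U(7) W(7)] by (simp add: add_divide_distrib)
qed

lemma X_trunc:
  assumes v: "X v" and a: "\<alpha> > 0"
  shows "X (\<lambda>x. trunc \<alpha> (v x))"
    "AE x in lebesgue. wgrad (\<lambda>x. trunc \<alpha> (v x)) x = (if \<bar>v x\<bar> < \<alpha> then wgrad v x else 0)"
proof -
  note U = XspaceD[OF v]
  have vm [measurable]: "v \<in> borel_measurable lebesgue" and gm [measurable]: "wgrad v \<in> borel_measurable lebesgue"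
    using U by blast+
  note Vm [measurable] = V_meas
  have 1: "integrable lebesgue (\<lambda>x. norm (if \<bar>v x\<bar> < \<alpha> then wgrad v x else 0) powr p)"
  proof (rule Bochner_Integration.integrable_bound[OF U(4)])
    show "(\<lambda>x. norm (if \<bar>v x\<bar> < \<alpha> then wgrad v x else 0) powr p) \<in> borel_measurable lebesgue" by measurable
    show "AE x in lebesgue. norm (norm (if \<bar>v x\<bar> < \<alpha> then wgrad v x else 0) powr p) \<le> norm (norm (wgrad v x) powr p)"
      by (rule AE_I2) simp
  qed
  have 2: "integrable lebesgue (\<lambda>x. V x * \<bar>trunc \<alpha> (v x)\<bar> powr p)"
  proof (rule Bochner_Integration.integrable_bound[OF U(5)])
    show "(\<lambda>x. V x * \<bar>trunc \<alpha> (v x)\<bar> powr p) \<in> borel_measurable lebesgue" by measurable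
    show "AE x in lebesgue. norm (V x * \<bar>trunc \<alpha> (v x)\<bar> powr p) \<le> norm (V x * \<bar>v x\<bar> powr p)"
    proof (rule AE_I2)
      fix x
      have "\<bar>trunc \<alpha> (v x)\<bar> powr p \<le> \<bar>v x\<bar> powr p"
        using a p2 by (intro powr_mono2 trunc_bounds) auto
      then show "norm (V x * \<bar>trunc \<alpha> (v x)\<bar> powr p) \<le> norm (V x * \<bar>v x\<bar> powr p)"
        by (simp add: abs_mult mult_left_mono)
    qed
  qed
  show "X (\<lambda>x. trunc \<alpha> (v x))"
    "AE x in lebesgue. wgrad (\<lambda>x. trunc \<alpha> (v x)) x = (if \<bar>v x\<bar> < \<alpha> then wgrad v x else 0)"
    by (rule XspaceI[OF has_weak_gradient_trunc[OF U(1) a] 1 2])+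
qed

lemma X_AE_cong:
  assumes u: "X u" and eq: "AE x in lebesgue. u x = v x" "v \<in> borel_measurable lebesgue"
  shows "X v" "energy v = energy u"
proof -
  note U = XspaceD[OF u]
  have m: "(\<lambda>x. V x * \<bar>v x\<bar> powr p) \<in> borel_measurable lebesgue" "(\<lambda>x. V x * \<bar>u x\<bar> powr p) \<in> borel_measurable lebesgue"
    using V_meas U(3) eq(2) by measurable
  have ae: "AE x in lebesgue. V x * \<bar>v x\<bar> powr p = V x * \<bar>u x\<bar> powr p" using eq(1) by eventually_elim simp
  have i: "integrable lebesgue (\<lambda>x. V x * \<bar>v x\<bar> powr p)" using integrable_cong_AE[OF m ae] U(5) by blast
  note I = XspaceI[OF has_weak_gradient_AE_cong[OF U(1) eq] U(4) i]
  show "X v" by (rule I)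
  show "energy v = energy u" unfolding I(2) integral_cong_AE[OF m ae] by (simp add: energy_def)
qed

text \<open>Completeness of X in usable form: besides the limit it returns almost everywhere
  convergence, convergence of the energies, and an L^p majorant \<open>F\<close>, with which the
  pairing with a datum passes to the limit.\<close>

lemma fast_limit:
  assumes v: "\<And>n. X (v n)" and fast: "\<And>n. energy (\<lambda>x. v (Suc n) x - v n x) \<le> 2 powr (- (p + 1) * real n)"
  shows "\<exists>u F. X u \<and> (AE x in lebesgue. (\<lambda>n. v n x) \<longlonglongrightarrow> u x) \<and> (\<lambda>n. energy (v n)) \<longlonglongrightarrow> energy u \<and>
    F \<in> borel_measurable lebesgue \<and> integrable lebesgue (\<lambda>x. F x powr p) \<and> (\<forall>n. AE x in lebesgue. \<bar>v n x\<bar> \<le> F x)"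
proof -
  note U = XspaceD[OF v]
  have p1: "p \<ge> 1" "p \<ge> 0" "p > 0" using p2 by auto
  have wm: "(\<lambda>x. wt x * v n x) \<in> borel_measurable lebesgue" for n using U(3)[of n] wt_meas by simp
  have split: "(\<integral>x. norm (wgrad (v (Suc n)) x - wgrad (v n) x) powr p \<partial>lebesgue) \<le> 2 powr (- (p + 1) * real n)"
    "(\<integral>x. norm (wt x * v (Suc n) x - wt x * v n x) powr p \<partial>lebesgue) \<le> 2 powr (- (p + 1) * real n)" for n
  proof -
    have "0 \<le> (\<integral>x. norm (wgrad (v (Suc n)) x - wgrad (v n) x) powr p \<partial>lebesgue)"
      "0 \<le> (\<integral>x. norm (wt x * v (Suc n) x - wt x * v n x) powr p \<partial>lebesgue)"
      by (intro integral_nonneg_AE; simp)+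
    then show "(\<integral>x. norm (wgrad (v (Suc n)) x - wgrad (v n) x) powr p \<partial>lebesgue) \<le> 2 powr (- (p + 1) * real n)"
      "(\<integral>x. norm (wt x * v (Suc n) x - wt x * v n x) powr p \<partial>lebesgue) \<le> 2 powr (- (p + 1) * real n)"
      using fast[of n] unfolding X_diff(3)[OF v v] by linarith+
  qed
  have i1: "integrable lebesgue (\<lambda>x. norm (wgrad (v (Suc n)) x - wgrad (v n) x) powr p)" for n
    using Lp_lincomb[OF p1(2) U(2) U(2) U(4) U(4), of 1 "Suc n" "-1" n] by simp
  have i2: "integrable lebesgue (\<lambda>x. norm (wt x * v (Suc n) x - wt x * v n x) powr p)" for n
    using Lp_lincomb[OF p1(2) wm wm U(7) U(7), of 1 "Suc n" "-1" n] by simp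
  obtain F1 where F1: "F1 \<in> borel_measurable lebesgue" "\<forall>x. 0 \<le> F1 x" "integrable lebesgue (\<lambda>x. F1 x powr p)"
     "AE x in lebesgue. (\<forall>n. norm (wgrad (v n) x) \<le> F1 x) \<and> convergent (\<lambda>n. wgrad (v n) x)"
    using Lp_fast_Cauchy[where f="\<lambda>n. wgrad (v n)", OF p1(1) U(2) U(4) i1 split(1)] by blast
  obtain F2 where F2: "F2 \<in> borel_measurable lebesgue" "\<forall>x. 0 \<le> F2 x" "integrable lebesgue (\<lambda>x. F2 x powr p)"
     "AE x in lebesgue. (\<forall>n. norm (wt x * v n x) \<le> F2 x) \<and> convergent (\<lambda>n. wt x * v n x)"
    using Lp_fast_Cauchy[where f="\<lambda>n x. wt x * v n x", OF p1(1) wm U(7) i2 split(2)] by blast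
  \<comment> \<open>\<open>lim\<close> is measurable on the whole space; its value on the null set
    of divergence is immaterial.\<close>
  define u where "u x = lim (\<lambda>n. v n x)" for x
  define G where "G x = lim (\<lambda>n. wgrad (v n) x)" for x
  have um: "u \<in> borel_measurable lebesgue" unfolding u_def[abs_def] by (rule borel_measurable_lim_metric[OF U(3)])
  have Gm: "G \<in> borel_measurable lebesgue" unfolding G_def[abs_def] by (rule borel_measurable_lim_metric[OF U(2)])
  have Gl: "AE x in lebesgue. (\<lambda>n. wgrad (v n) x) \<longlonglongrightarrow> G x"
    using F1(4) by eventually_elim (simp add: G_def convergent_LIMSEQ_iff)
  have ul: "AE x in lebesgue. (\<lambda>n. v n x) \<longlonglongrightarrow> u x"
    using F2(4) wt_ge_1
  proof eventually_elim
    case (elim x)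
    then obtain l where "(\<lambda>n. wt x * v n x) \<longlonglongrightarrow> l" by (auto simp: convergent_def)
    then have "(\<lambda>n. inverse (wt x) * (wt x * v n x)) \<longlonglongrightarrow> inverse (wt x) * l" by (intro tendsto_mult tendsto_const)
    moreover have "inverse (wt x) * (wt x * y) = y" for y using elim(2) by (simp add: field_simps)
    ultimately have "convergent (\<lambda>n. v n x)" by (auto simp: convergent_def)
    then show ?case by (simp add: u_def convergent_LIMSEQ_iff)
  qed
  have wul: "AE x in lebesgue. (\<lambda>n. wt x * v n x) \<longlonglongrightarrow> wt x * u x"
    using ul by eventually_elim (intro tendsto_mult tendsto_const)
  have b1: "AE x in lebesgue. norm (wgrad (v n) x) \<le> F1 x" for n using F1(4) by eventually_elim blast
  have b2: "AE x in lebesgue. norm (wt x * v n x) \<le> F2 x" for n using F2(4) by eventually_elim blast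
  have b3: "AE x in lebesgue. \<bar>v n x\<bar> \<le> F2 x" for n
    using b2[of n] wt_ge_1
  proof eventually_elim
    case (elim x)
    have "1 * \<bar>v n x\<bar> \<le> wt x * \<bar>v n x\<bar>" by (rule mult_right_mono[OF elim(2)]) simp
    then show ?case using elim by (simp add: abs_mult)
  qed
  have wum: "(\<lambda>x. wt x * u x) \<in> borel_measurable lebesgue" using um wt_meas by simp
  note d1 = Lp_dominated_tendsto[OF p1(3) U(2) Gm F1(1,3) b1 Gl]
  note d2 = Lp_dominated_tendsto[OF p1(3) wm wum F2(1,3) b2 wul]
  have l1: "loc_integrable F1" by (rule Lp_loc_integrable[OF p1(1) F1(1)]) (use F1(2,3) in simp)
  have l2: "loc_integrable F2" by (rule Lp_loc_integrable[OF p1(1) F2(1)]) (use F2(2,3) in simp)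
  have h: "has_weak_gradient u G"
    by (rule has_weak_gradient_dominated_limit[OF U(1) l2 b3 ul l1 b1 Gl um Gm])
  have iV: "integrable lebesgue (\<lambda>x. V x * \<bar>u x\<bar> powr p)" using d2(2) weighted_integral(2)[OF um] by blast
  note I = XspaceI[OF h d1(2) iV]
  have "(\<lambda>n. energy (v n)) \<longlonglongrightarrow> energy u"
    unfolding energy_wt[OF v] I(2) weighted_integral(1)[OF um] by (intro tendsto_add d1 d2)
  then show ?thesis using I(1) ul F2(1,3) b3 by blast
qed

end

section \<open>The duality map of the p-th power of the norm\<close>

lemma duality_pairing_bound:
  fixes a b :: "'c::real_inner"
  assumes p: "p \<ge> 2"
  shows "\<bar>norm a powr (p - 2) * (a \<bullet> b)\<bar> \<le> norm a powr p + norm b powr p"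
proof -
  have a1: "norm a powr (p - 2) * norm a = norm a powr (p - 1)" by (rule powr_diff_two_mult) simp
  have "\<bar>norm a powr (p - 2) * (a \<bullet> b)\<bar> \<le> norm a powr (p - 2) * (norm a * norm b)"
    unfolding abs_mult by (intro mult_mono Cauchy_Schwarz_ineq2) auto
  also have "\<dots> = norm b * norm a powr (p - 1)" using a1 by (simp add: mult_ac)
  also have "\<dots> \<le> norm b powr p / p + (1 - 1 / p) * norm a powr p" by (rule young_powr) (use p in auto)
  also have "\<dots> \<le> 1 * norm b powr p + 1 * norm a powr p"
  proof (rule add_mono)
    have "1 / p * norm b powr p \<le> 1 * norm b powr p" by (rule mult_right_mono) (use p in \<open>auto simp: field_simps\<close>)
    then show "norm b powr p / p \<le> 1 * norm b powr p" by simp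
    show "(1 - 1 / p) * norm a powr p \<le> 1 * norm a powr p" by (rule mult_right_mono) (use p in auto)
  qed
  finally show ?thesis by simp
qed

text \<open>At l = 0 the power p - 2 may be 0 and then fails to be continuous. Cauchy-Schwarz bounds
  the pairing there by \<open>norm (a n) powr (p - 1) * norm b\<close>, whose exponent is at least
  1.\<close>

lemma duality_map_tendsto:
  fixes a :: "nat \<Rightarrow> 'c::real_inner"
  assumes p: "p \<ge> 2" and a: "a \<longlonglongrightarrow> l"
  shows "(\<lambda>n. norm (a n) powr (p - 2) * (a n \<bullet> b)) \<longlonglongrightarrow> norm l powr (p - 2) * (l \<bullet> b)"
proof (cases "l = 0")
  case False
  then have "norm l \<noteq> 0" by simp
  then show ?thesis by (intro tendsto_mult tendsto_powr tendsto_norm tendsto_inner a tendsto_const)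
next
  case True
  have "(\<lambda>n. norm (a n) powr (p - 1) * norm b) \<longlonglongrightarrow> norm l powr (p - 1) * norm b"
    by (intro tendsto_mult tendsto_const tendsto_powr2 tendsto_norm a) (use p in auto)
  then have l0: "(\<lambda>n. norm (a n) powr (p - 1) * norm b) \<longlonglongrightarrow> 0" using True by simp
  have "norm (norm (a n) powr (p - 2) * (a n \<bullet> b)) \<le> norm (a n) powr (p - 1) * norm b" for n
  proof -
    have a1: "norm (a n) powr (p - 2) * norm (a n) = norm (a n) powr (p - 1)" by (rule powr_diff_two_mult) simp
    have "\<bar>norm (a n) powr (p - 2) * (a n \<bullet> b)\<bar> \<le> norm (a n) powr (p - 2) * (norm (a n) * norm b)"
      unfolding abs_mult by (intro mult_mono Cauchy_Schwarz_ineq2) auto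
    then show ?thesis unfolding mult.assoc[symmetric] a1 by simp
  qed
  then have "(\<lambda>n. norm (a n) powr (p - 2) * (a n \<bullet> b)) \<longlonglongrightarrow> 0"
    by (intro Lim_null_comparison[OF always_eventually[OF allI] l0])
  then show ?thesis using True by simp
qed

lemma duality_map_measurable:
  fixes G H :: "'b \<Rightarrow> 'c::euclidean_space"
  assumes "G \<in> borel_measurable M" "H \<in> borel_measurable M"
  shows "(\<lambda>x. norm (G x) powr (p - 2) * (G x \<bullet> H x)) \<in> borel_measurable M"
  using assms by measurable

lemma duality_pairing_integrable:
  fixes G H :: "'b \<Rightarrow> 'c::euclidean_space"
  assumes p: "p \<ge> 2" and m: "G \<in> borel_measurable M" "H \<in> borel_measurable M"
    and i: "integrable M (\<lambda>x. norm (G x) powr p)" "integrable M (\<lambda>x. norm (H x) powr p)"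
  shows "integrable M (\<lambda>x. norm (G x) powr (p - 2) * (G x \<bullet> H x))"
proof (rule Bochner_Integration.integrable_bound[OF Bochner_Integration.integrable_add[OF i]])
  show "(\<lambda>x. norm (G x) powr (p - 2) * (G x \<bullet> H x)) \<in> borel_measurable M" by (rule duality_map_measurable[OF m])
  show "AE x in M. norm (norm (G x) powr (p - 2) * (G x \<bullet> H x)) \<le> norm (norm (G x) powr p + norm (H x) powr p)"
    by (rule AE_I2) (use duality_pairing_bound[OF p] in simp)
qed

text \<open>The inequality is the supporting hyperplane at G + tH, evaluated at G and integrated.
  For the limit, steps at most 1 keep the p-th power of the norm of G + tH below 2^p times the sum
  of those of G and H.\<close>

lemma Lp_directional:
  fixes G H :: "'b \<Rightarrow> 'c::euclidean_space"
  assumes p: "p \<ge> 2" and m: "G \<in> borel_measurable M" "H \<in> borel_measurable M"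
    and i: "integrable M (\<lambda>x. norm (G x) powr p)" "integrable M (\<lambda>x. norm (H x) powr p)"
  shows "((\<integral>x. norm (G x + t *\<^sub>R H x) powr p \<partial>M) - (\<integral>x. norm (G x) powr p \<partial>M)) / p
     \<le> t * (\<integral>x. norm (G x + t *\<^sub>R H x) powr (p - 2) * ((G x + t *\<^sub>R H x) \<bullet> H x) \<partial>M)"
    and "(\<lambda>n. \<integral>x. norm (G x + inverse (real (Suc n)) *\<^sub>R H x) powr (p - 2) * ((G x + inverse (real (Suc n)) *\<^sub>R H x) \<bullet> H x) \<partial>M)
     \<longlonglongrightarrow> (\<integral>x. norm (G x) powr (p - 2) * (G x \<bullet> H x) \<partial>M)"
proof -
  have p0: "p \<ge> 0" using p by simp
  have it: "integrable M (\<lambda>x. norm (G x + t *\<^sub>R H x) powr p)" for t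
    using Lp_lincomb[OF p0 m i, of 1 t] by simp
  have mt: "(\<lambda>x. G x + t *\<^sub>R H x) \<in> borel_measurable M" for t using m by measurable
  have ib: "integrable M (\<lambda>x. norm (G x + t *\<^sub>R H x) powr (p - 2) * ((G x + t *\<^sub>R H x) \<bullet> H x))" for t
    by (rule duality_pairing_integrable[OF p mt m(2) it i(2)])
  have "(\<integral>x. (norm (G x + t *\<^sub>R H x) powr p - norm (G x) powr p) / p \<partial>M)
     \<le> (\<integral>x. t * (norm (G x + t *\<^sub>R H x) powr (p - 2) * ((G x + t *\<^sub>R H x) \<bullet> H x)) \<partial>M)"
  proof (rule integral_mono)
    fix x
    show "(norm (G x + t *\<^sub>R H x) powr p - norm (G x) powr p) / p \<le> t * (norm (G x + t *\<^sub>R H x) powr (p - 2) * ((G x + t *\<^sub>R H x) \<bullet> H x))"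
      using norm_powr_convex[OF p, of "G x + t *\<^sub>R H x" "G x"] by (simp add: mult_ac)
  qed (use it[of t] i ib[of t] in simp_all)
  then show "((\<integral>x. norm (G x + t *\<^sub>R H x) powr p \<partial>M) - (\<integral>x. norm (G x) powr p \<partial>M)) / p
     \<le> t * (\<integral>x. norm (G x + t *\<^sub>R H x) powr (p - 2) * ((G x + t *\<^sub>R H x) \<bullet> H x) \<partial>M)"
    using it[of t] i ib[of t] by simp
  have idom: "integrable M (\<lambda>x. 2 powr p * (norm (G x) powr p + norm (H x) powr p) + norm (H x) powr p)" using i by simp
  show "(\<lambda>n. \<integral>x. norm (G x + inverse (real (Suc n)) *\<^sub>R H x) powr (p - 2) * ((G x + inverse (real (Suc n)) *\<^sub>R H x) \<bullet> H x) \<partial>M)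
     \<longlonglongrightarrow> (\<integral>x. norm (G x) powr (p - 2) * (G x \<bullet> H x) \<partial>M)"
  proof (rule integral_dominated_convergence[OF _ _ idom])
    show "(\<lambda>x. norm (G x) powr (p - 2) * (G x \<bullet> H x)) \<in> borel_measurable M" by (rule duality_map_measurable[OF m])
    show "(\<lambda>x. norm (G x + inverse (real (Suc n)) *\<^sub>R H x) powr (p - 2) * ((G x + inverse (real (Suc n)) *\<^sub>R H x) \<bullet> H x)) \<in> borel_measurable M" for n
      by (rule duality_map_measurable[OF mt m(2)])
    show "AE x in M. (\<lambda>n. norm (G x + inverse (real (Suc n)) *\<^sub>R H x) powr (p - 2) * ((G x + inverse (real (Suc n)) *\<^sub>R H x) \<bullet> H x))
        \<longlonglongrightarrow> norm (G x) powr (p - 2) * (G x \<bullet> H x)"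
    proof (intro AE_I2 duality_map_tendsto[OF p])
      fix x
      have "(\<lambda>n. G x + inverse (real (Suc n)) *\<^sub>R H x) \<longlonglongrightarrow> G x + 0 *\<^sub>R H x"
        by (intro tendsto_add tendsto_scaleR tendsto_const LIMSEQ_inverse_real_of_nat)
      then show "(\<lambda>n. G x + inverse (real (Suc n)) *\<^sub>R H x) \<longlonglongrightarrow> G x" by simp
    qed
    show "AE x in M. norm (norm (G x + inverse (real (Suc n)) *\<^sub>R H x) powr (p - 2) * ((G x + inverse (real (Suc n)) *\<^sub>R H x) \<bullet> H x))
        \<le> 2 powr p * (norm (G x) powr p + norm (H x) powr p) + norm (H x) powr p" for n
    proof (rule AE_I2)
      fix x
      define t where "t = inverse (real (Suc n))"
      have t: "0 \<le> t" "t \<le> 1" by (auto simp: t_def field_simps)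
      have "\<bar>norm (G x + t *\<^sub>R H x) powr (p - 2) * ((G x + t *\<^sub>R H x) \<bullet> H x)\<bar> \<le> norm (G x + t *\<^sub>R H x) powr p + norm (H x) powr p"
        by (rule duality_pairing_bound[OF p])
      moreover have "norm (G x + t *\<^sub>R H x) powr p \<le> 2 powr p * (norm (G x) powr p + norm (t *\<^sub>R H x) powr p)"
        by (rule norm_add_powr[OF p0])
      moreover have "norm (t *\<^sub>R H x) powr p \<le> norm (H x) powr p"
        using t p by (intro powr_mono2) (auto simp: mult_left_le_one_le)
      then have "2 powr p * (norm (G x) powr p + norm (t *\<^sub>R H x) powr p) \<le> 2 powr p * (norm (G x) powr p + norm (H x) powr p)"
        by (intro mult_left_mono) auto
      ultimately show "norm (norm (G x + inverse (real (Suc n)) *\<^sub>R H x) powr (p - 2) * ((G x + inverse (real (Suc n)) *\<^sub>R H x) \<bullet> H x))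
        \<le> 2 powr p * (norm (G x) powr p + norm (H x) powr p) + norm (H x) powr p"
        unfolding t_def[symmetric] real_norm_def by linarith
    qed
  qed
qed

lemma geometric_rate_tendsto: "(\<lambda>n. 2 powr (- (p + 1) * real n)) \<longlonglongrightarrow> 0" if "p \<ge> (0::real)"
proof -
  have "(\<lambda>n. (2 powr (- (p + 1))) ^ n) \<longlonglongrightarrow> (0::real)"
    using that by (intro LIMSEQ_power_zero) (auto simp: powr_less_one)
  moreover have "(2 powr (- (p + 1))) ^ n = (2::real) powr (- (p + 1) * real n)" for n
    by (simp only: powr_powr[symmetric] powr_realpow[OF powr_gt_zero[THEN iffD2], of 2] zero_neq_numeral not_False_eq_True)
  ultimately show ?thesis by simp
qed

context potential
begin

section \<open>Existence of weak energy solutions\<close>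

text \<open>Young's inequality for conjugate exponents. The factor 1/p on the term in
  \<open>v\<close> is kept because it is absorbed exactly by \<open>energy v / p\<close>; the factor
  on the datum term is dropped.\<close>

lemma pairing_bound:
  assumes g: "Lp (p / (p - 1)) g" and v: "v \<in> borel_measurable lebesgue" "integrable lebesgue (\<lambda>x. \<bar>v x\<bar> powr p)"
  shows "integrable lebesgue (\<lambda>x. g x * v x)"
    "\<bar>\<integral>x. g x * v x \<partial>lebesgue\<bar> \<le> (\<integral>x. \<bar>v x\<bar> powr p \<partial>lebesgue) / p + (\<integral>x. \<bar>g x\<bar> powr (p / (p - 1)) \<partial>lebesgue)"
proof -
  define q where "q = p / (p - 1)"
  have q: "q > 1" "1 / p + 1 / q = 1" using p2 by (auto simp: q_def field_simps)
  have g: "g \<in> borel_measurable lebesgue" "integrable lebesgue (\<lambda>x. \<bar>g x\<bar> powr q)" using g by (auto simp: Lp_def q_def)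
  have i: "integrable lebesgue (\<lambda>x. \<bar>v x\<bar> powr p / p + \<bar>g x\<bar> powr q)" using g v by simp
  have le: "\<bar>g x * v x\<bar> \<le> \<bar>v x\<bar> powr p / p + \<bar>g x\<bar> powr q" for x
  proof -
    have "\<bar>v x\<bar> * \<bar>g x\<bar> \<le> \<bar>v x\<bar> powr p / p + \<bar>g x\<bar> powr q / q"
      by (rule Youngs_inequality) (use p2 q in auto)
    moreover have "\<bar>g x\<bar> powr q / q \<le> \<bar>g x\<bar> powr q"
      using q(1) by (simp add: divide_le_eq mult_le_cancel_left1)
    ultimately show ?thesis by (simp add: abs_mult mult.commute)
  qed
  have m: "(\<lambda>x. g x * v x) \<in> borel_measurable lebesgue" using g v by simp
  show "integrable lebesgue (\<lambda>x. g x * v x)"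
    by (rule Bochner_Integration.integrable_bound[OF i m]) (rule AE_I2, use le order_trans abs_ge_self in \<open>simp, blast\<close>)
  have "\<bar>\<integral>x. g x * v x \<partial>lebesgue\<bar> \<le> (\<integral>x. \<bar>g x * v x\<bar> \<partial>lebesgue)" by (rule integral_abs_bound)
  also have "\<dots> \<le> (\<integral>x. \<bar>v x\<bar> powr p / p + \<bar>g x\<bar> powr q \<partial>lebesgue)"
    by (rule integral_mono'[OF i le]) (use p2 in simp)
  also have "\<dots> = (\<integral>x. \<bar>v x\<bar> powr p \<partial>lebesgue) / p + (\<integral>x. \<bar>g x\<bar> powr q \<partial>lebesgue)" using g v by simp
  finally show "\<bar>\<integral>x. g x * v x \<partial>lebesgue\<bar> \<le> (\<integral>x. \<bar>v x\<bar> powr p \<partial>lebesgue) / p + (\<integral>x. \<bar>g x\<bar> powr (p / (p - 1)) \<partial>lebesgue)"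
    by (simp add: q_def)
qed

text \<open>The Dirichlet-type functional whose Euler-Lagrange equation is the weak energy equation
  with datum \<open>g\<close>.\<close>

definition functional :: "('a \<Rightarrow> real) \<Rightarrow> ('a \<Rightarrow> real) \<Rightarrow> real" where
  "functional g v = energy v / p - (\<integral>x. g x * v x \<partial>lebesgue)"

lemma X_zero: "X (\<lambda>x. 0)"
proof -
  have "has_weak_gradient (\<lambda>x::'a. 0) (\<lambda>x. 0)"
    by (simp add: has_weak_gradient_def loc_integrable_const)
  then show ?thesis by (rule XspaceI(1)) simp_all
qed

lemma functional_bounded_below:
  assumes g: "Lp (p / (p - 1)) g" and v: "X v"
  shows "- (\<integral>x. \<bar>g x\<bar> powr (p / (p - 1)) \<partial>lebesgue) \<le> functional g v"
proof -
  note U = XspaceD[OF v]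
  have "(\<integral>x. \<bar>v x\<bar> powr p \<partial>lebesgue) \<le> (\<integral>x. V x * \<bar>v x\<bar> powr p \<partial>lebesgue)"
    by (rule weighted_imp_unweighted(2)[OF U(3,5)])
  moreover have "0 \<le> (\<integral>x. norm (wgrad v x) powr p \<partial>lebesgue)" by (rule integral_nonneg_AE) simp
  ultimately have "(\<integral>x. \<bar>v x\<bar> powr p \<partial>lebesgue) \<le> energy v" unfolding energy_def by linarith
  then have "(\<integral>x. \<bar>v x\<bar> powr p \<partial>lebesgue) / p \<le> energy v / p" using p2 by (intro divide_right_mono) auto
  then show ?thesis using pairing_bound(2)[OF g U(3,6)] unfolding functional_def by linarith
qed

text \<open>The linear term cancels between the mean of the values and the value at the midpoint, so
  only the Clarkson defect of the energy remains. The factor p undoes \<open>energy / p\<close>, and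
  2^p undoes the halving of the difference.\<close>

lemma functional_midpoint:
  assumes g: "Lp (p / (p - 1)) g" and u: "X u" and v: "X v"
  shows "energy (\<lambda>x. u x - v x) \<le> p * 2 powr p * ((functional g u + functional g v) / 2 - functional g (\<lambda>x. (u x + v x) / 2))"
proof -
  have i: "integrable lebesgue (\<lambda>x. g x * u x)" "integrable lebesgue (\<lambda>x. g x * v x)"
    by (rule pairing_bound(1)[OF g XspaceD(3,6)[OF u]], rule pairing_bound(1)[OF g XspaceD(3,6)[OF v]])
  have "(\<integral>x. g x * ((u x + v x) / 2) \<partial>lebesgue) = (\<integral>x. (g x * u x + g x * v x) / 2 \<partial>lebesgue)"
    by (simp add: distrib_left)
  also have "\<dots> = ((\<integral>x. g x * u x \<partial>lebesgue) + (\<integral>x. g x * v x \<partial>lebesgue)) / 2" using i by simp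
  finally have lin: "(\<integral>x. g x * ((u x + v x) / 2) \<partial>lebesgue) = ((\<integral>x. g x * u x \<partial>lebesgue) + (\<integral>x. g x * v x \<partial>lebesgue)) / 2" .
  have "energy (\<lambda>x. u x - v x) / 2 powr p \<le> (energy u + energy v) / 2 - energy (\<lambda>x. (u x + v x) / 2)"
    using energy_clarkson[OF u v] by linarith
  also have "\<dots> = p * ((functional g u + functional g v) / 2 - functional g (\<lambda>x. (u x + v x) / 2))"
    unfolding functional_def lin using p2 by (simp add: field_simps)
  finally show ?thesis by (simp add: divide_le_eq mult_ac)
qed

lemma minimizer_exists:
  assumes g: "Lp (p / (p - 1)) g"
  shows "\<exists>w. X w \<and> (\<forall>v. X v \<longrightarrow> functional g w \<le> functional g v)"
proof -
  define S where "S = functional g ` {v. X v}"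
  have S: "S \<noteq> {}" "bdd_below S"
    using X_zero functional_bounded_below[OF g] by (auto simp: S_def bdd_below_def)
  define m where "m = Inf S"
  have m: "m \<le> functional g v" if "X v" for v
    unfolding m_def by (rule cInf_lower[OF _ S(2)]) (use that in \<open>auto simp: S_def\<close>)
  \<comment> \<open>Chosen so that the midpoint estimate, with a defect of at most
    \<open>\<delta> n\<close>, gives exactly the rate demanded by \<open>fast_limit\<close>.\<close>
  define \<delta> where "\<delta> n = 2 powr (- (p + 1) * real n) / (p * 2 powr p)" for n
  have \<delta>0: "\<delta> n > 0" for n using p2 by (simp add: \<delta>_def)
  have \<delta>dec: "\<delta> (Suc n) \<le> \<delta> n" for n
    unfolding \<delta>_def using p2 by (intro divide_right_mono powr_mono) (auto simp: algebra_simps)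
  have "\<exists>v. X v \<and> functional g v < m + \<delta> n" for n
    using cInf_lessD[OF S(1), of "m + \<delta> n"] \<delta>0[of n] by (auto simp: m_def S_def)
  then obtain v where v: "\<And>n. X (v n)" "\<And>n. functional g (v n) < m + \<delta> n" by metis
  have fast: "energy (\<lambda>x. v (Suc n) x - v n x) \<le> 2 powr (- (p + 1) * real n)" for n
  proof -
    have mid: "m \<le> functional g (\<lambda>x. (v (Suc n) x + v n x) / 2)" by (rule m[OF X_mid[OF v(1) v(1)]])
    have "(functional g (v (Suc n)) + functional g (v n)) / 2 \<le> m + \<delta> n"
      using v(2)[of n] v(2)[of "Suc n"] \<delta>dec[of n] by (simp add: field_simps)
    then have "(functional g (v (Suc n)) + functional g (v n)) / 2 - functional g (\<lambda>x. (v (Suc n) x + v n x) / 2) \<le> \<delta> n"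
      using mid by linarith
    then have "p * 2 powr p * ((functional g (v (Suc n)) + functional g (v n)) / 2 - functional g (\<lambda>x. (v (Suc n) x + v n x) / 2)) \<le> p * 2 powr p * \<delta> n"
      using p2 by (intro mult_left_mono) auto
    also have "\<dots> = 2 powr (- (p + 1) * real n)" using p2 by (simp add: \<delta>_def)
    finally show ?thesis using functional_midpoint[OF g v(1) v(1), of "Suc n" n] by linarith
  qed
  obtain u F where u: "X u" "AE x in lebesgue. (\<lambda>n. v n x) \<longlonglongrightarrow> u x" "(\<lambda>n. energy (v n)) \<longlonglongrightarrow> energy u"
    "F \<in> borel_measurable lebesgue" "integrable lebesgue (\<lambda>x. F x powr p)" "\<forall>n. AE x in lebesgue. \<bar>v n x\<bar> \<le> F x"
    using fast_limit[OF v(1) fast] by blast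
  have gm: "g \<in> borel_measurable lebesgue" using g by (simp add: Lp_def)
  \<comment> \<open>\<open>F\<close> is known to be nonnegative only almost everywhere, as a bound
    for absolute values, whereas the pairing bound asks for the power of
    \<open>\<bar>F x\<bar>\<close>.\<close>
  have Fabs: "integrable lebesgue (\<lambda>x. \<bar>F x\<bar> powr p)"
  proof -
    have ae: "AE x in lebesgue. \<bar>F x\<bar> powr p = F x powr p"
      using spec[OF u(6), of 0] by eventually_elim simp
    have "(\<lambda>x. \<bar>F x\<bar> powr p) \<in> borel_measurable lebesgue" "(\<lambda>x. F x powr p) \<in> borel_measurable lebesgue"
      using u(4) by measurable
    from integrable_cong_AE[OF this ae] show ?thesis using u(5) by simp
  qed
  have "(\<lambda>n. \<integral>x. g x * v n x \<partial>lebesgue) \<longlonglongrightarrow> (\<integral>x. g x * u x \<partial>lebesgue)"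
  proof (rule integral_dominated_convergence)
    show "(\<lambda>x. g x * u x) \<in> borel_measurable lebesgue" "\<And>n. (\<lambda>x. g x * v n x) \<in> borel_measurable lebesgue"
      using gm XspaceD(3)[OF u(1)] XspaceD(3)[OF v(1)] by simp_all
    show "integrable lebesgue (\<lambda>x. \<bar>g x * F x\<bar>)"
      using pairing_bound(1)[OF g u(4) Fabs] by (rule Bochner_Integration.integrable_abs)
    show "AE x in lebesgue. (\<lambda>n. g x * v n x) \<longlonglongrightarrow> g x * u x"
      using u(2) by eventually_elim (intro tendsto_mult tendsto_const)
    show "AE x in lebesgue. norm (g x * v n x) \<le> \<bar>g x * F x\<bar>" for n
      using spec[OF u(6), of n] by eventually_elim (auto simp: abs_mult intro!: mult_left_mono)
  qed
  then have "(\<lambda>n. functional g (v n)) \<longlonglongrightarrow> functional g u"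
    unfolding functional_def using p2 by (intro tendsto_diff tendsto_divide u(3) tendsto_const) auto
  moreover have "(\<lambda>n. m + \<delta> n) \<longlonglongrightarrow> m + 0"
  proof (intro tendsto_add tendsto_const)
    have "(\<lambda>n. 2 powr (- (p + 1) * real n) / (p * 2 powr p)) \<longlonglongrightarrow> 0 / (p * 2 powr p)"
      using p2 by (intro tendsto_divide geometric_rate_tendsto tendsto_const) auto
    then show "\<delta> \<longlonglongrightarrow> 0" unfolding \<delta>_def by simp
  qed
  ultimately have "functional g u \<le> m + 0"
    by (rule LIMSEQ_le) (use v(2) less_imp_le in blast)
  then show ?thesis using u(1) m by (intro exI[of _ u]) force
qed

definition form :: "('a \<Rightarrow> real) \<Rightarrow> ('a \<Rightarrow> real) \<Rightarrow> real" where
  "form w \<phi> = (\<integral>x. norm (wgrad w x) powr (p - 2) * (wgrad w x \<bullet> wgrad \<phi> x) \<partial>lebesgue)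
     + (\<integral>x. V x * \<bar>w x\<bar> powr (p - 2) * w x * \<phi> x \<partial>lebesgue)"

text \<open>The weight contributes \<open>wt x powr (p - 2)\<close> and one factor
  \<open>wt x\<close> from each argument, together V. The lower order term thus becomes the same
  duality pairing as the gradient term.\<close>

lemma wt_duality: "AE x in lebesgue. \<forall>y z. norm (wt x * y) powr (p - 2) * ((wt x * y) \<bullet> (wt x * z)) = V x * \<bar>y\<bar> powr (p - 2) * y * z"
  using V_ge_1
proof eventually_elim
  case (elim x)
  have w: "wt x \<ge> 0" by (simp add: wt_def)
  have "wt x powr (p - 2) * (wt x)\<^sup>2 = V x"
    using powr_diff_two_mult_square[OF w, of p] elim p2 by (simp add: wt_def powr_powr)
  moreover have "norm (wt x * y) powr (p - 2) * ((wt x * y) \<bullet> (wt x * z)) = (wt x powr (p - 2) * (wt x)\<^sup>2) * \<bar>y\<bar> powr (p - 2) * y * z" for y z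
    using w by (simp add: abs_mult powr_mult power2_eq_square mult_ac)
  ultimately show ?case by simp
qed

lemma form_wt:
  assumes w: "X w" and \<phi>: "X \<phi>"
  shows "(\<integral>x. V x * \<bar>w x\<bar> powr (p - 2) * w x * \<phi> x \<partial>lebesgue) =
      (\<integral>x. norm (wt x * w x) powr (p - 2) * ((wt x * w x) \<bullet> (wt x * \<phi> x)) \<partial>lebesgue)"
    and "integrable lebesgue (\<lambda>x. V x * \<bar>w x\<bar> powr (p - 2) * w x * \<phi> x)"
    and "integrable lebesgue (\<lambda>x. norm (wgrad w x) powr (p - 2) * (wgrad w x \<bullet> wgrad \<phi> x))"
proof -
  note U = XspaceD[OF w] and W = XspaceD[OF \<phi>]
  have mw: "(\<lambda>x. wt x * w x) \<in> borel_measurable lebesgue" "(\<lambda>x. wt x * \<phi> x) \<in> borel_measurable lebesgue"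
    using U(3) W(3) wt_meas by simp_all
  have m: "(\<lambda>x. V x * \<bar>w x\<bar> powr (p - 2) * w x * \<phi> x) \<in> borel_measurable lebesgue" using U(3) W(3) V_meas by measurable
  have ae: "AE x in lebesgue. V x * \<bar>w x\<bar> powr (p - 2) * w x * \<phi> x = norm (wt x * w x) powr (p - 2) * ((wt x * w x) \<bullet> (wt x * \<phi> x))"
    using wt_duality by eventually_elim (simp only:)
  show "(\<integral>x. V x * \<bar>w x\<bar> powr (p - 2) * w x * \<phi> x \<partial>lebesgue) =
      (\<integral>x. norm (wt x * w x) powr (p - 2) * ((wt x * w x) \<bullet> (wt x * \<phi> x)) \<partial>lebesgue)"
    by (rule integral_cong_AE[OF m duality_map_measurable[OF mw] ae])
  show "integrable lebesgue (\<lambda>x. V x * \<bar>w x\<bar> powr (p - 2) * w x * \<phi> x)"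
    using integrable_cong_AE[OF m duality_map_measurable[OF mw] ae] duality_pairing_integrable[OF p2 mw U(7) W(7)] by simp
  show "integrable lebesgue (\<lambda>x. norm (wgrad w x) powr (p - 2) * (wgrad w x \<bullet> wgrad \<phi> x))"
    by (rule duality_pairing_integrable[OF p2 U(2) W(2) U(4) W(4)])
qed

text \<open>Convexity bounds \<open>energy (w + t \<phi>) - energy w\<close> by \<open>t\<close> times the form at \<open>w + t \<phi>\<close>, so the
  Euler--Lagrange inequality needs only dominated convergence, not differentiation.\<close>

lemma minimizer_form_ge:
  assumes g: "Lp (p / (p - 1)) g" and w: "X w" and min: "\<And>v. X v \<Longrightarrow> functional g w \<le> functional g v" and \<phi>: "X \<phi>"
  shows "(\<integral>x. g x * \<phi> x \<partial>lebesgue) \<le> form w \<phi>"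
proof -
  note U = XspaceD[OF w] and W = XspaceD[OF \<phi>]
  have mw: "(\<lambda>x. wt x * w x) \<in> borel_measurable lebesgue" "(\<lambda>x. wt x * \<phi> x) \<in> borel_measurable lebesgue"
    using U(3) W(3) wt_meas by simp_all
  have i: "integrable lebesgue (\<lambda>x. g x * w x)" "integrable lebesgue (\<lambda>x. g x * \<phi> x)"
    by (rule pairing_bound(1)[OF g U(3,6)], rule pairing_bound(1)[OF g W(3,6)])
  define B1 where "B1 t = (\<integral>x. norm (wgrad w x + t *\<^sub>R wgrad \<phi> x) powr (p - 2) * ((wgrad w x + t *\<^sub>R wgrad \<phi> x) \<bullet> wgrad \<phi> x) \<partial>lebesgue)" for t
  define B2 where "B2 t = (\<integral>x. norm (wt x * w x + t *\<^sub>R (wt x * \<phi> x)) powr (p - 2) * ((wt x * w x + t *\<^sub>R (wt x * \<phi> x)) \<bullet> (wt x * \<phi> x)) \<partial>lebesgue)" for t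
  have ge: "(\<integral>x. g x * \<phi> x \<partial>lebesgue) \<le> B1 t + B2 t" if t: "t > 0" for t
  proof -
    have "functional g w \<le> functional g (\<lambda>x. 1 * w x + t * \<phi> x)" by (rule min[OF X_lincomb(1)[OF w \<phi>]])
    moreover have "(\<integral>x. g x * (1 * w x + t * \<phi> x) \<partial>lebesgue) = (\<integral>x. g x * w x + t * (g x * \<phi> x) \<partial>lebesgue)"
      by (simp add: algebra_simps)
    then have "(\<integral>x. g x * (1 * w x + t * \<phi> x) \<partial>lebesgue) = (\<integral>x. g x * w x \<partial>lebesgue) + t * (\<integral>x. g x * \<phi> x \<partial>lebesgue)"
      using i by simp
    ultimately have "t * (\<integral>x. g x * \<phi> x \<partial>lebesgue) \<le> (energy (\<lambda>x. 1 * w x + t * \<phi> x) - energy w) / p"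
      unfolding functional_def by (simp add: diff_divide_distrib)
    also have "\<dots> = ((\<integral>x. norm (wgrad w x + t *\<^sub>R wgrad \<phi> x) powr p \<partial>lebesgue) - (\<integral>x. norm (wgrad w x) powr p \<partial>lebesgue)) / p
       + ((\<integral>x. norm (wt x * w x + t *\<^sub>R (wt x * \<phi> x)) powr p \<partial>lebesgue) - (\<integral>x. norm (wt x * w x) powr p \<partial>lebesgue)) / p"
      unfolding X_lincomb(3)[OF w \<phi>] energy_wt[OF w] by (simp add: diff_divide_distrib add_divide_distrib)
    also have "\<dots> \<le> t * B1 t + t * B2 t"
      unfolding B1_def B2_def
      by (intro add_mono Lp_directional(1)[OF p2 U(2) W(2) U(4) W(4)] Lp_directional(1)[OF p2 mw U(7) W(7)])
    finally have "t * (\<integral>x. g x * \<phi> x \<partial>lebesgue) \<le> t * (B1 t + B2 t)" by (simp add: distrib_left)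
    then show ?thesis using t by simp
  qed
  have "(\<lambda>n. B1 (inverse (real (Suc n))) + B2 (inverse (real (Suc n)))) \<longlonglongrightarrow> form w \<phi>"
    unfolding form_def form_wt(1)[OF w \<phi>] B1_def B2_def
    by (intro tendsto_add Lp_directional(2)[OF p2 U(2) W(2) U(4) W(4)] Lp_directional(2)[OF p2 mw U(7) W(7)])
  then show ?thesis
    by (rule LIMSEQ_le_const) (intro exI[of _ 0] allI impI ge, simp)
qed

lemma weak_solution_exists:
  assumes g: "Lp (p / (p - 1)) g"
  shows "\<exists>w. weak_energy_sol V p g w"
proof -
  obtain w where w: "X w" and min: "\<And>v. X v \<Longrightarrow> functional g w \<le> functional g v" using minimizer_exists[OF g] by blast
  have "form w \<phi> = (\<integral>x. g x * \<phi> x \<partial>lebesgue)" if \<phi>: "X \<phi>" for \<phi>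
  proof (rule antisym)
    show "(\<integral>x. g x * \<phi> x \<partial>lebesgue) \<le> form w \<phi>" by (rule minimizer_form_ge[OF g w min \<phi>])
    \<comment> \<open>The inequality for \<open>\<phi>\<close> and for its negative gives equality;
      as the chosen gradient of the negative is known only almost everywhere, the integrals are
      compared by congruence.\<close>
    have n: "X (\<lambda>x. - \<phi> x)" "AE x in lebesgue. wgrad (\<lambda>x. - \<phi> x) x = - wgrad \<phi> x"
      using X_lincomb(1,2)[OF X_zero \<phi>, of 0 "-1"] by simp_all
    have "(\<integral>x. norm (wgrad w x) powr (p - 2) * (wgrad w x \<bullet> wgrad (\<lambda>x. - \<phi> x) x) \<partial>lebesgue) =
        (\<integral>x. - (norm (wgrad w x) powr (p - 2) * (wgrad w x \<bullet> wgrad \<phi> x)) \<partial>lebesgue)"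
    proof (rule integral_cong_AE)
      show "AE x in lebesgue. norm (wgrad w x) powr (p - 2) * (wgrad w x \<bullet> wgrad (\<lambda>x. - \<phi> x) x) =
        - (norm (wgrad w x) powr (p - 2) * (wgrad w x \<bullet> wgrad \<phi> x))" using n(2) by eventually_elim simp
      show "(\<lambda>x. norm (wgrad w x) powr (p - 2) * (wgrad w x \<bullet> wgrad (\<lambda>x. - \<phi> x) x)) \<in> borel_measurable lebesgue"
        by (rule duality_map_measurable[OF XspaceD(2)[OF w] XspaceD(2)[OF n(1)]])
      show "(\<lambda>x. - (norm (wgrad w x) powr (p - 2) * (wgrad w x \<bullet> wgrad \<phi> x))) \<in> borel_measurable lebesgue"
        using duality_map_measurable[OF XspaceD(2)[OF w] XspaceD(2)[OF \<phi>]] by (rule borel_measurable_uminus)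
    qed
    then have "form w (\<lambda>x. - \<phi> x) = - form w \<phi>" by (simp add: form_def)
    then show "form w \<phi> \<le> (\<integral>x. g x * \<phi> x \<partial>lebesgue)" using minimizer_form_ge[OF g w min n(1)] by simp
  qed
  then show ?thesis using w unfolding weak_energy_sol_def form_def by blast
qed

end

section \<open>Lower semicontinuity of the energy\<close>

text \<open>A substitute for the convex hull of the tail from index \<open>m\<close>, closed under
  midpoints alone, since that is the only convex combination occurring in Clarkson's
  inequality.\<close>

inductive midpoint_hull :: "(nat \<Rightarrow> 'a \<Rightarrow> real) \<Rightarrow> nat \<Rightarrow> ('a \<Rightarrow> real) \<Rightarrow> bool"
  for v :: "nat \<Rightarrow> 'a \<Rightarrow> real" and m :: nat where
  base: "m \<le> k \<Longrightarrow> midpoint_hull v m (v k)"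
| mid: "midpoint_hull v m a \<Longrightarrow> midpoint_hull v m b \<Longrightarrow> midpoint_hull v m (\<lambda>x. (a x + b x) / 2)"

lemma midpoint_hull_mono: "midpoint_hull v m a \<Longrightarrow> k \<le> m \<Longrightarrow> midpoint_hull v k a"
  by (induction rule: midpoint_hull.induct) (auto intro: midpoint_hull.intros)

text \<open>An interval around \<open>l\<close> is closed under midpoints. Hence elements picked
  from hulls of later and later tails converge at every point where the sequence does, and to the
  same limit.\<close>

lemma midpoint_hull_near:
  assumes "midpoint_hull v m a" and "\<And>k. m \<le> k \<Longrightarrow> \<bar>v k x - l\<bar> \<le> e"
  shows "\<bar>a x - l\<bar> \<le> e"
  using assms(1)
proof (induction rule: midpoint_hull.induct)
  case (base k)
  then show ?case by (rule assms(2))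
next
  case (mid a b)
  then show ?case by (simp add: abs_le_iff field_simps) 
qed

context potential
begin

lemma midpoint_hull_energy:
  assumes v: "\<And>n. X (v n)" "\<And>n. energy (v n) \<le> C" and a: "midpoint_hull v m a"
  shows "X a" "energy a \<le> C"
proof -
  have "X a \<and> energy a \<le> C" using a
  proof (induction rule: midpoint_hull.induct)
    case (base k)
    show ?case using v by blast
  next
    case (mid a b)
    have X: "X a" "X b" using mid.IH by blast+
    have "energy (\<lambda>x. (a x + b x) / 2) \<le> energy (\<lambda>x. (a x + b x) / 2) + energy (\<lambda>x. a x - b x) / 2 powr p"
      using energy_nonneg by (intro add_increasing2 divide_nonneg_nonneg) auto
    also have "\<dots> \<le> (energy a + energy b) / 2" by (rule energy_clarkson[OF X])
    also have "\<dots> \<le> C"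
    proof -
      have "energy a \<le> C" "energy b \<le> C" using mid.IH by blast+
      then show ?thesis by simp
    qed
    finally have "energy (\<lambda>x. (a x + b x) / 2) \<le> C" .
    then show ?case using X_mid[OF X] by blast
  qed
  then show "X a" "energy a \<le> C" by blast+
qed

text \<open>Nearly energy-minimal elements of the midpoint hulls of the tails form a Cauchy sequence by
  Clarkson's inequality; this replaces weak compactness and Mazur's lemma.\<close>

lemma energy_closure:
  assumes v: "\<And>n. X (v n)" "\<And>n. energy (v n) \<le> C"
    and lim: "AE x in lebesgue. (\<lambda>n. v n x) \<longlonglongrightarrow> u x" and um: "u \<in> borel_measurable lebesgue"
  shows "X u" "energy u \<le> C"
proof -
  define S where "S m = energy ` {a. midpoint_hull v m a}" for m
  \<comment> \<open>Later tails have smaller hulls, so these infima increase; being bounded by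
    \<open>C\<close>, they approach their supremum \<open>D\<close>.\<close>
  define d where "d m = Inf (S m)" for m
  have S: "S m \<noteq> {}" "bdd_below (S m)" for m
    using midpoint_hull.base[of m m v] energy_nonneg by (auto simp: S_def bdd_below_def)
  have dle: "d m \<le> energy a" if "midpoint_hull v m a" for m a
    unfolding d_def by (rule cInf_lower[OF _ S(2)]) (use that in \<open>auto simp: S_def\<close>)
  have dmono: "d m \<le> d k" if "m \<le> k" for m k
    unfolding d_def
  proof (rule cInf_superset_mono[OF S(1) S(2)])
    show "S k \<subseteq> S m" unfolding S_def using midpoint_hull_mono[OF _ that] by blast
  qed
  have dC: "d m \<le> C" for m
    using dle[OF midpoint_hull.base[OF order_refl]] v(2) by (rule order_trans)
  have bdd: "bdd_above (range d)" using dC by (auto simp: bdd_above_def)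
  define D where "D = Sup (range d)"
  have dD: "d m \<le> D" for m unfolding D_def by (rule cSup_upper[OF _ bdd]) simp
  \<comment> \<open>The defect in Clarkson's inequality is at most \<open>2 * \<delta> n\<close>:
    one part from near-minimality of the chosen elements, one from \<open>d (k n)\<close> lying
    below \<open>D\<close>. This explains the 2; the factor \<open>2 powr p\<close> is the one in
    Clarkson's inequality.\<close>
  define \<delta> where "\<delta> n = 2 powr (- (p + 1) * real n) / (2 * 2 powr p)" for n
  have \<delta>0: "\<delta> n > 0" for n by (simp add: \<delta>_def)
  have \<delta>dec: "\<delta> (Suc n) \<le> \<delta> n" for n
    unfolding \<delta>_def using p2 by (intro divide_right_mono powr_mono) (auto simp: algebra_simps)
  have "\<exists>K. D - \<delta> n < d K" for n
    using less_cSupD[of "range d" "D - \<delta> n"] \<delta>0[of n] by (auto simp: D_def)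
  then obtain K where K: "\<And>n. D - \<delta> n < d (K n)" by metis
  \<comment> \<open>The partial sums make the tail index monotone and at least \<open>K n\<close>;
    the summand \<open>n\<close> drives it to infinity.\<close>
  define k where "k n = n + (\<Sum>i\<le>n. K i)" for n
  have k: "n \<le> k n" "K n \<le> k n" "k n \<le> k (Suc n)" for n
  proof -
    have "K n \<le> (\<Sum>i\<le>n. K i)" by (rule member_le_sum) auto
    then show "n \<le> k n" "K n \<le> k n" "k n \<le> k (Suc n)" by (auto simp: k_def)
  qed
  have kD: "D - \<delta> n < d (k n)" for n using K[of n] dmono[OF k(2)[of n]] by linarith
  have "\<exists>a. midpoint_hull v (k n) a \<and> energy a < d (k n) + \<delta> n" for n
    using cInf_lessD[OF S(1), of "k n" "d (k n) + \<delta> n"] \<delta>0[of n] by (auto simp: d_def S_def)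
  then obtain w where w: "\<And>n. midpoint_hull v (k n) (w n)" "\<And>n. energy (w n) < d (k n) + \<delta> n" by metis
  note wX = midpoint_hull_energy[OF v w(1)]
  have fast: "energy (\<lambda>x. w (Suc n) x - w n x) \<le> 2 powr (- (p + 1) * real n)" for n
  proof -
    have "midpoint_hull v (k n) (\<lambda>x. (w (Suc n) x + w n x) / 2)"
      by (rule midpoint_hull.mid[OF midpoint_hull_mono[OF w(1) k(3)] w(1)])
    then have mid: "d (k n) \<le> energy (\<lambda>x. (w (Suc n) x + w n x) / 2)" by (rule dle)
    have "energy (w (Suc n)) \<le> D + \<delta> n" "energy (w n) \<le> D + \<delta> n"
      using w(2)[of n] w(2)[of "Suc n"] dD[of "k n"] dD[of "k (Suc n)"] \<delta>dec[of n] by linarith+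
    then have "(energy (w (Suc n)) + energy (w n)) / 2 \<le> D + \<delta> n" by simp
    then have "energy (\<lambda>x. w (Suc n) x - w n x) / 2 powr p \<le> 2 * \<delta> n"
      using energy_clarkson[OF wX(1) wX(1), of "Suc n" n] mid kD[of n] by linarith
    then have "energy (\<lambda>x. w (Suc n) x - w n x) \<le> 2 * \<delta> n * 2 powr p" by (simp add: divide_le_eq)
    then show ?thesis by (simp add: \<delta>_def)
  qed
  obtain u' where u': "X u'" "AE x in lebesgue. (\<lambda>n. w n x) \<longlonglongrightarrow> u' x" "(\<lambda>n. energy (w n)) \<longlonglongrightarrow> energy u'"
    using fast_limit[OF wX(1) fast] by blast
  \<comment> \<open>The energy limit was obtained for hull elements; pointwise it must agree with
    the limit of the given sequence.\<close>
  have "AE x in lebesgue. u' x = u x"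
    using u'(2) lim
  proof eventually_elim
    case (elim x)
    have "(\<lambda>n. w n x) \<longlonglongrightarrow> u x"
    proof (rule LIMSEQ_I)
      fix r :: real assume r: "0 < r"
      obtain N where N: "\<forall>n\<ge>N. norm (v n x - u x) < r / 2" using LIMSEQ_D[OF elim(2), of "r/2"] r by auto
      have "norm (w n x - u x) < r" if "n \<ge> N" for n
      proof -
        have "\<bar>w n x - u x\<bar> \<le> r / 2"
        proof (rule midpoint_hull_near[OF w(1)])
          fix j assume "k n \<le> j"
          then have "N \<le> j" using k(1)[of n] that by linarith
          then show "\<bar>v j x - u x\<bar> \<le> r / 2" using N by (auto intro: less_imp_le)
        qed
        then show ?thesis using r by simp
      qed
      then show "\<exists>no. \<forall>n\<ge>no. norm (w n x - u x) < r" by blast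
    qed
    then show ?case using elim(1) LIMSEQ_unique by blast
  qed
  note E = X_AE_cong[OF u'(1) this um]
  show "X u" by (rule E)
  have "energy u' \<le> C" by (rule LIMSEQ_le_const2[OF u'(3)]) (use wX(2) in blast)
  then show "energy u \<le> C" using E by simp
qed

section \<open>Testing with truncations\<close>

lemma trunc_scale:
  assumes "\<alpha> > 0"
  shows "\<exists>\<theta>. 0 \<le> \<theta> \<and> \<theta> \<le> 1 \<and> trunc \<alpha> s = \<theta> * s"
proof (cases "\<bar>s\<bar> \<le> \<alpha>")
  case True
  then show ?thesis by (intro exI[of _ 1]) (auto simp: trunc_def)
next
  case False
  then show ?thesis using assms by (intro exI[of _ "\<alpha> / \<bar>s\<bar>"]) (auto simp: trunc_def divide_simps abs_if split: if_splits)
qed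

text \<open>Truncation multiplies \<open>s\<close> by some \<open>\<theta>\<close> in [0, 1]. The
  left side then scales by \<open>\<theta> powr p\<close>, which is at most \<open>\<theta>\<close>,
  and the right side by \<open>\<theta>\<close> itself, so a coercivity inequality survives
  truncation.\<close>

lemma trunc_powr_le:
  assumes a: "\<alpha> > 0" and q: "q * s \<ge> c * \<bar>s\<bar> powr p" and c: "c \<ge> 0"
  shows "c * \<bar>trunc \<alpha> s\<bar> powr p \<le> q * trunc \<alpha> s"
proof -
  obtain \<theta> where \<theta>: "0 \<le> \<theta>" "\<theta> \<le> 1" "trunc \<alpha> s = \<theta> * s" using trunc_scale[OF a] by blast
  have "\<theta> powr p \<le> \<theta> powr 1" using p2 \<theta> by (intro powr_mono') auto
  then have "\<theta> powr p \<le> \<theta>" using \<theta> by simp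
  then have "c * (\<theta> powr p * \<bar>s\<bar> powr p) \<le> c * (\<theta> * \<bar>s\<bar> powr p)"
    using c by (intro mult_left_mono mult_right_mono) auto
  also have "\<dots> = \<theta> * (c * \<bar>s\<bar> powr p)" by simp
  also have "\<dots> \<le> \<theta> * (q * s)" using \<theta> q by (intro mult_left_mono) auto
  finally show ?thesis using \<theta> by (simp add: abs_mult powr_mult mult_ac)
qed

lemma weak_solD:
  assumes "weak_energy_sol V p g w"
  shows "X w" "X \<phi> \<Longrightarrow> (\<integral>x. norm (wgrad w x) powr (p - 2) * (wgrad w x \<bullet> wgrad \<phi> x) \<partial>lebesgue)
        + (\<integral>x. V x * \<bar>w x\<bar> powr (p - 2) * w x * \<phi> x \<partial>lebesgue) = (\<integral>x. g x * \<phi> x \<partial>lebesgue)"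
  using assms unfolding weak_energy_sol_def by blast+

lemma bounded_pairing:
  fixes g \<phi> :: "'a \<Rightarrow> real"
  assumes g: "integrable lebesgue g" and \<phi>: "\<phi> \<in> borel_measurable lebesgue" "\<And>x. \<bar>\<phi> x\<bar> \<le> \<alpha>"
  shows "integrable lebesgue (\<lambda>x. g x * \<phi> x)" "(\<integral>x. g x * \<phi> x \<partial>lebesgue) \<le> \<alpha> * (\<integral>x. \<bar>g x\<bar> \<partial>lebesgue)"
proof -
  have i: "integrable lebesgue (\<lambda>x. \<alpha> * \<bar>g x\<bar>)" using g by simp
  have a0: "0 \<le> \<alpha>" using \<phi>(2)[of 0] by linarith
  have le: "\<bar>g x * \<phi> x\<bar> \<le> \<alpha> * \<bar>g x\<bar>" for x
  proof -
    have "\<bar>\<phi> x\<bar> * \<bar>g x\<bar> \<le> \<alpha> * \<bar>g x\<bar>" by (intro mult_right_mono \<phi>(2)) simp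
    then show ?thesis by (simp add: abs_mult mult.commute)
  qed
  have m: "(\<lambda>x. g x * \<phi> x) \<in> borel_measurable lebesgue" using g \<phi>(1) by simp
  show ig: "integrable lebesgue (\<lambda>x. g x * \<phi> x)"
    by (rule Bochner_Integration.integrable_bound[OF i m]) (rule AE_I2, use le a0 in \<open>simp add: abs_mult\<close>)
  have "(\<integral>x. g x * \<phi> x \<partial>lebesgue) \<le> (\<integral>x. \<alpha> * \<bar>g x\<bar> \<partial>lebesgue)"
    by (rule integral_mono[OF ig i]) (use le abs_le_D1 in blast)
  then show "(\<integral>x. g x * \<phi> x \<partial>lebesgue) \<le> \<alpha> * (\<integral>x. \<bar>g x\<bar> \<partial>lebesgue)" by simp
qed

text \<open>The truncation of \<open>w\<close> serves as test function. Its gradient is that of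
  \<open>w\<close> or zero, so the gradient terms agree pointwise; for the potential term coercivity
  survives truncation with constant 1.\<close>

lemma trunc_energy_bound:
  assumes w: "weak_energy_sol V p g w" and g: "integrable lebesgue g" and a: "\<alpha> > 0"
  shows "energy (\<lambda>x. trunc \<alpha> (w x)) \<le> \<alpha> * (\<integral>x. \<bar>g x\<bar> \<partial>lebesgue)"
proof -
  note wX = weak_solD(1)[OF w]
  note T = X_trunc[OF wX a]
  note U = XspaceD[OF wX] and W = XspaceD[OF T(1)]
  have "(\<integral>x. norm (wgrad (\<lambda>x. trunc \<alpha> (w x)) x) powr p \<partial>lebesgue)
      \<le> (\<integral>x. norm (wgrad w x) powr (p - 2) * (wgrad w x \<bullet> wgrad (\<lambda>x. trunc \<alpha> (w x)) x) \<partial>lebesgue)"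
  proof (rule integral_mono_AE[OF W(4) form_wt(3)[OF wX T(1)]])
    show "AE x in lebesgue. norm (wgrad (\<lambda>x. trunc \<alpha> (w x)) x) powr p
        \<le> norm (wgrad w x) powr (p - 2) * (wgrad w x \<bullet> wgrad (\<lambda>x. trunc \<alpha> (w x)) x)"
      using T(2)
    proof eventually_elim
      case (elim x)
      have "norm (wgrad w x) powr (p - 2) * (wgrad w x \<bullet> wgrad w x) = norm (wgrad w x) powr p"
        unfolding power2_norm_eq_inner[symmetric] by (rule powr_diff_two_mult_square) simp
      then show ?case unfolding elim by simp
    qed
  qed
  moreover have "(\<integral>x. V x * \<bar>trunc \<alpha> (w x)\<bar> powr p \<partial>lebesgue)
      \<le> (\<integral>x. V x * \<bar>w x\<bar> powr (p - 2) * w x * trunc \<alpha> (w x) \<partial>lebesgue)"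
  proof (rule integral_mono_AE[OF W(5) form_wt(2)[OF wX T(1)]])
    show "AE x in lebesgue. V x * \<bar>trunc \<alpha> (w x)\<bar> powr p \<le> V x * \<bar>w x\<bar> powr (p - 2) * w x * trunc \<alpha> (w x)"
      using V_ge_1
    proof eventually_elim
      case (elim x)
      have "(\<bar>w x\<bar> powr (p - 2) * w x) * w x = \<bar>w x\<bar> powr p"
        using powr_diff_two_mult_square[of "\<bar>w x\<bar>" p] by (simp add: power2_eq_square mult.assoc)
      then have "1 * \<bar>trunc \<alpha> (w x)\<bar> powr p \<le> (\<bar>w x\<bar> powr (p - 2) * w x) * trunc \<alpha> (w x)"
        by (intro trunc_powr_le[OF a]) auto
      then have "V x * \<bar>trunc \<alpha> (w x)\<bar> powr p \<le> V x * ((\<bar>w x\<bar> powr (p - 2) * w x) * trunc \<alpha> (w x))"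
        using elim by (intro mult_left_mono) auto
      then show ?case by (simp add: mult.assoc)
    qed
  qed
  ultimately have "energy (\<lambda>x. trunc \<alpha> (w x)) \<le> (\<integral>x. g x * trunc \<alpha> (w x) \<partial>lebesgue)"
    using weak_solD(2)[OF w T(1)] unfolding energy_def by linarith
  also have "\<dots> \<le> \<alpha> * (\<integral>x. \<bar>g x\<bar> \<partial>lebesgue)"
    by (rule bounded_pairing(2)[OF g W(3)]) (use a in \<open>simp add: trunc_bounds\<close>)
  finally show ?thesis .
qed

text \<open>The two equations are subtracted and tested with the truncated difference. Its gradient
  is the difference of the gradients or zero, so vector monotonicity applies pointwise and brings in
  its constant 2^(1-p).\<close>

lemma trunc_diff_energy_bound:
  assumes w1: "weak_energy_sol V p g1 w1" and w2: "weak_energy_sol V p g2 w2"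
    and g: "integrable lebesgue g1" "integrable lebesgue g2" and a: "\<alpha> > 0"
  shows "X (\<lambda>x. trunc \<alpha> (w1 x - w2 x))"
    "2 powr (1 - p) * energy (\<lambda>x. trunc \<alpha> (w1 x - w2 x)) \<le> \<alpha> * (\<integral>x. \<bar>g1 x - g2 x\<bar> \<partial>lebesgue)"
proof -
  define c where "c = (2::real) powr (1 - p)"
  define \<phi> where "\<phi> = (\<lambda>x. trunc \<alpha> (w1 x - w2 x))"
  note X1 = weak_solD(1)[OF w1] and X2 = weak_solD(1)[OF w2]
  note Df = X_diff[OF X1 X2]
  note T = X_trunc[OF Df(1) a, folded \<phi>_def]
  show "X (\<lambda>x. trunc \<alpha> (w1 x - w2 x))" using T(1) by (simp add: \<phi>_def)
  note W = XspaceD[OF T(1)]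
  note I1 = form_wt(2,3)[OF X1 T(1)] and I2 = form_wt(2,3)[OF X2 T(1)]
  have 1: "c * (\<integral>x. norm (wgrad \<phi> x) powr p \<partial>lebesgue) \<le>
     (\<integral>x. norm (wgrad w1 x) powr (p - 2) * (wgrad w1 x \<bullet> wgrad \<phi> x) \<partial>lebesgue)
      - (\<integral>x. norm (wgrad w2 x) powr (p - 2) * (wgrad w2 x \<bullet> wgrad \<phi> x) \<partial>lebesgue)"
  proof -
    have "(\<integral>x. c * norm (wgrad \<phi> x) powr p \<partial>lebesgue) \<le> (\<integral>x. norm (wgrad w1 x) powr (p - 2) * (wgrad w1 x \<bullet> wgrad \<phi> x)
       - norm (wgrad w2 x) powr (p - 2) * (wgrad w2 x \<bullet> wgrad \<phi> x) \<partial>lebesgue)"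
    proof (rule integral_mono_AE)
      show "AE x in lebesgue. c * norm (wgrad \<phi> x) powr p \<le> norm (wgrad w1 x) powr (p - 2) * (wgrad w1 x \<bullet> wgrad \<phi> x)
       - norm (wgrad w2 x) powr (p - 2) * (wgrad w2 x \<bullet> wgrad \<phi> x)"
        using T(2) Df(2)
      proof eventually_elim
        case (elim x)
        show ?case
          unfolding elim using duality_map_monotone[OF p2, of "wgrad w1 x" "wgrad w2 x"]
          by (simp add: c_def inner_diff_left)
      qed
    qed (use W(4) I1 I2 in simp_all)
    then show ?thesis using I1 I2 by simp
  qed
  have 2: "c * (\<integral>x. V x * \<bar>\<phi> x\<bar> powr p \<partial>lebesgue) \<le>
     (\<integral>x. V x * \<bar>w1 x\<bar> powr (p - 2) * w1 x * \<phi> x \<partial>lebesgue) - (\<integral>x. V x * \<bar>w2 x\<bar> powr (p - 2) * w2 x * \<phi> x \<partial>lebesgue)"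
  proof -
    have "(\<integral>x. c * (V x * \<bar>\<phi> x\<bar> powr p) \<partial>lebesgue) \<le>
      (\<integral>x. V x * \<bar>w1 x\<bar> powr (p - 2) * w1 x * \<phi> x - V x * \<bar>w2 x\<bar> powr (p - 2) * w2 x * \<phi> x \<partial>lebesgue)"
    proof (rule integral_mono_AE)
      show "AE x in lebesgue. c * (V x * \<bar>\<phi> x\<bar> powr p) \<le> V x * \<bar>w1 x\<bar> powr (p - 2) * w1 x * \<phi> x - V x * \<bar>w2 x\<bar> powr (p - 2) * w2 x * \<phi> x"
        using V_ge_1
      proof eventually_elim
        case (elim x)
        define q where "q = \<bar>w1 x\<bar> powr (p - 2) * w1 x - \<bar>w2 x\<bar> powr (p - 2) * w2 x"
        have "c * \<bar>w1 x - w2 x\<bar> powr p \<le> q * (w1 x - w2 x)"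
          using duality_map_monotone[OF p2, of "w1 x" "w2 x"] by (simp add: c_def q_def)
        then have "c * \<bar>\<phi> x\<bar> powr p \<le> q * \<phi> x"
          unfolding \<phi>_def by (rule trunc_powr_le[OF a]) (simp add: c_def)
        then have "V x * (c * \<bar>\<phi> x\<bar> powr p) \<le> V x * (q * \<phi> x)" using elim by (intro mult_left_mono) auto
        then show ?case by (simp add: q_def algebra_simps)
      qed
    qed (use W(5) I1 I2 in simp_all)
    then show ?thesis using I1 I2 by simp
  qed
  have b: "\<bar>\<phi> x\<bar> \<le> \<alpha>" for x using a by (simp add: \<phi>_def trunc_bounds)
  have "c * energy \<phi> \<le> (\<integral>x. g1 x * \<phi> x \<partial>lebesgue) - (\<integral>x. g2 x * \<phi> x \<partial>lebesgue)"
    using 1 2 weak_solD(2)[OF w1 T(1)] weak_solD(2)[OF w2 T(1)] unfolding energy_def distrib_left by linarith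
  also have "\<dots> = (\<integral>x. (g1 x - g2 x) * \<phi> x \<partial>lebesgue)"
    using bounded_pairing(1)[OF g(1) W(3) b] bounded_pairing(1)[OF g(2) W(3) b] by (simp add: left_diff_distrib)
  also have "\<dots> \<le> \<alpha> * (\<integral>x. \<bar>g1 x - g2 x\<bar> \<partial>lebesgue)"
    by (rule bounded_pairing(2)[OF _ W(3) b]) (use g in simp)
  finally show "2 powr (1 - p) * energy (\<lambda>x. trunc \<alpha> (w1 x - w2 x)) \<le> \<alpha> * (\<integral>x. \<bar>g1 x - g2 x\<bar> \<partial>lebesgue)"
    by (simp add: c_def \<phi>_def)
qed

end

section \<open>Existence and uniqueness of asymptotic energy solutions\<close>

lemma abs_trunc_1: "\<bar>trunc 1 s\<bar> = min \<bar>s\<bar> 1"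
  by (auto simp: trunc_def min_def max_def)

text \<open>Of the q factors, q - 1 are bounded by the level \<open>N\<close> and the last one by
  \<open>\<bar>f x\<bar>\<close>, so integrability of \<open>f\<close> suffices for every exponent q
  at least 1.\<close>

lemma trunc_integrable_Lp:
  fixes f :: "'a::euclidean_space \<Rightarrow> real"
  assumes f: "integrable lebesgue f" and N: "N \<ge> 0" and q: "q \<ge> 1"
  shows "integrable lebesgue (\<lambda>x. trunc N (f x))" "Lp q (\<lambda>x. trunc N (f x))"
proof -
  have fm [measurable]: "f \<in> borel_measurable lebesgue" using f by (rule borel_measurable_integrable)
  have m [measurable]: "(\<lambda>x. trunc N (f x)) \<in> borel_measurable lebesgue" by measurable
  show "integrable lebesgue (\<lambda>x. trunc N (f x))"
    by (rule Bochner_Integration.integrable_bound[OF f m]) (rule AE_I2, use trunc_bounds(2)[OF N] in simp)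
  have i: "integrable lebesgue (\<lambda>x. N powr (q - 1) * \<bar>f x\<bar>)" using f by simp
  have le: "\<bar>trunc N (f x)\<bar> powr q \<le> N powr (q - 1) * \<bar>f x\<bar>" for x
  proof (cases "trunc N (f x) = 0")
    case False
    then have "\<bar>trunc N (f x)\<bar> powr q = \<bar>trunc N (f x)\<bar> powr (q - 1) * \<bar>trunc N (f x)\<bar>"
      using powr_add[of "\<bar>trunc N (f x)\<bar>" "q - 1" 1] by simp
    also have "\<dots> \<le> N powr (q - 1) * \<bar>f x\<bar>"
      by (intro mult_mono powr_mono2 trunc_bounds N) (use q in auto)
    finally show ?thesis .
  qed (use N in simp)
  have m2: "(\<lambda>x. \<bar>trunc N (f x)\<bar> powr q) \<in> borel_measurable lebesgue" by measurable
  have "integrable lebesgue (\<lambda>x. \<bar>trunc N (f x)\<bar> powr q)"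
    by (rule Bochner_Integration.integrable_bound[OF i m2]) (rule AE_I2, use le in simp)
  then show "Lp q (\<lambda>x. trunc N (f x))" using m by (simp add: Lp_def)
qed

lemma trunc_tendsto_L1:
  fixes f :: "'a::euclidean_space \<Rightarrow> real"
  assumes f: "integrable lebesgue f"
  shows "(\<lambda>n. \<integral>x. \<bar>trunc (real n) (f x) - f x\<bar> \<partial>lebesgue) \<longlonglongrightarrow> 0"
proof -
  have fm [measurable]: "f \<in> borel_measurable lebesgue" using f by (rule borel_measurable_integrable)
  have i: "integrable lebesgue (\<lambda>x. 2 * \<bar>f x\<bar>)" using f by simp
  have "(\<lambda>n. \<integral>x. \<bar>trunc (real n) (f x) - f x\<bar> \<partial>lebesgue) \<longlonglongrightarrow> (\<integral>(x::'a). 0 \<partial>lebesgue)"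
  proof (rule integral_dominated_convergence[OF _ _ i])
    show "(\<lambda>x. \<bar>trunc (real n) (f x) - f x\<bar>) \<in> borel_measurable lebesgue" for n by measurable
    show "AE x in lebesgue. (\<lambda>n. \<bar>trunc (real n) (f x) - f x\<bar>) \<longlonglongrightarrow> 0"
    proof (rule AE_I2)
      fix x
      obtain N :: nat where N: "\<bar>f x\<bar> < real N" using reals_Archimedean2 by blast
      have "\<forall>n\<ge>N. \<bar>trunc (real n) (f x) - f x\<bar> = 0" using N by (auto simp: trunc_def)
      then have "eventually (\<lambda>n. \<bar>trunc (real n) (f x) - f x\<bar> = 0) sequentially"
        unfolding eventually_sequentially by blast
      then show "(\<lambda>n. \<bar>trunc (real n) (f x) - f x\<bar>) \<longlonglongrightarrow> 0" by (rule tendsto_eventually)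
    qed
    show "AE x in lebesgue. norm \<bar>trunc (real n) (f x) - f x\<bar> \<le> 2 * \<bar>f x\<bar>" for n
    proof (rule AE_I2)
      fix x
      show "norm \<bar>trunc (real n) (f x) - f x\<bar> \<le> 2 * \<bar>f x\<bar>" using trunc_bounds(2)[of "real n" "f x"] by simp
    qed
  qed simp
  then show ?thesis by simp
qed

context potential
begin

lemma Lp_integral_le_energy:
  assumes "X v"
  shows "(\<integral>x. \<bar>v x\<bar> powr p \<partial>lebesgue) \<le> energy v"
proof -
  have "0 \<le> (\<integral>x. norm (wgrad v x) powr p \<partial>lebesgue)" by (rule integral_nonneg_AE) simp
  then show ?thesis using weighted_imp_unweighted(2)[OF XspaceD(3,5)[OF assms]] unfolding energy_def by linarith
qed

lemma asym_energy_sol_exists: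
  assumes f: "integrable lebesgue f"
  shows "\<exists>u. asym_energy_sol V p f u \<and> (\<forall>\<alpha>>0. energy (\<lambda>x. trunc \<alpha> (u x)) \<le> \<alpha> * (\<integral>x. \<bar>f x\<bar> \<partial>lebesgue))"
proof -
  define c where "c = (2::real) powr (1 - p)"
  have c0: "c > 0" by (simp add: c_def)
  \<comment> \<open>Two data differ by at most \<open>2 * \<delta> k\<close>, and the energy
    estimate divides by \<open>c\<close>; for \<open>\<alpha>\<close> = 1 this leaves exactly
    \<open>2 powr (- (p + 1) * real k)\<close>.\<close>
  define \<delta> where "\<delta> k = c * 2 powr (- (p + 1) * real k) / 2" for k
  have \<delta>0: "\<delta> k > 0" for k using c0 by (simp add: \<delta>_def)
  have \<delta>dec: "\<delta> (k + j) \<le> \<delta> k" for k j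
  proof -
    have "- (p + 1) * real (k + j) \<le> - (p + 1) * real k" by (rule mult_left_mono_neg) (use p2 in auto)
    then have "2 powr (- (p + 1) * real (k + j)) \<le> (2::real) powr (- (p + 1) * real k)" by (intro powr_mono) auto
    then show ?thesis unfolding \<delta>_def using c0 by (intro divide_right_mono mult_left_mono) auto
  qed
  have \<delta>lim: "\<delta> \<longlonglongrightarrow> 0"
  proof -
    have "(\<lambda>k. c * 2 powr (- (p + 1) * real k) / 2) \<longlonglongrightarrow> c * 0 / 2"
      using p2 by (intro tendsto_divide tendsto_mult tendsto_const geometric_rate_tendsto) auto
    then show ?thesis by (simp add: \<delta>_def[abs_def])
  qed
  have "\<exists>n. (\<integral>x. \<bar>trunc (real n) (f x) - f x\<bar> \<partial>lebesgue) < \<delta> k" for k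
  proof -
    have "eventually (\<lambda>n. (\<integral>x. \<bar>trunc (real n) (f x) - f x\<bar> \<partial>lebesgue) < \<delta> k) sequentially"
      by (rule order_tendstoD(2)[OF trunc_tendsto_L1[OF f] \<delta>0])
    then show ?thesis unfolding eventually_sequentially by blast
  qed
  then obtain r :: "nat \<Rightarrow> nat" where r: "\<And>k. (\<integral>x. \<bar>trunc (real (r k)) (f x) - f x\<bar> \<partial>lebesgue) < \<delta> k" by metis
  define fs where "fs k x = trunc (real (r k)) (f x)" for k x
  have q: "p / (p - 1) \<ge> 1" using p2 by (simp add: field_simps)
  have fs: "integrable lebesgue (fs k)" "Lp (p / (p - 1)) (fs k)" for k
    using trunc_integrable_Lp[OF f _ q, of "real (r k)"] by (simp_all add: fs_def[abs_def])
  have fsd: "(\<integral>x. \<bar>fs k x - f x\<bar> \<partial>lebesgue) < \<delta> k" for k using r by (simp add: fs_def)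
  have fsfs: "(\<integral>x. \<bar>fs k x - fs (k + j) x\<bar> \<partial>lebesgue) \<le> 2 * \<delta> k" for k j
  proof -
    have "(\<integral>x. \<bar>fs k x - fs (k + j) x\<bar> \<partial>lebesgue) \<le> (\<integral>x. \<bar>fs k x - f x\<bar> + \<bar>fs (k + j) x - f x\<bar> \<partial>lebesgue)"
      by (rule integral_mono) (use fs(1)[of k] fs(1)[of "k + j"] f in auto)
    also have "\<dots> = (\<integral>x. \<bar>fs k x - f x\<bar> \<partial>lebesgue) + (\<integral>x. \<bar>fs (k + j) x - f x\<bar> \<partial>lebesgue)"
      using fs(1)[of k] fs(1)[of "k + j"] f by simp
    finally show ?thesis using fsd[of k] fsd[of "k + j"] \<delta>dec[of k j] by linarith
  qed
  have "\<forall>k. \<exists>w. weak_energy_sol V p (fs k) w" using weak_solution_exists[OF fs(2)] by blast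
  then obtain us where us: "\<And>k. weak_energy_sol V p (fs k) (us k)" by metis
  have usX: "X (us k)" for k by (rule weak_solD(1)[OF us])
  have usm: "us k \<in> borel_measurable lebesgue" for k by (rule XspaceD(3)[OF usX])
  have TX: "X (\<lambda>x. trunc \<alpha> (us k x - us (k + j) x))"
    and TE: "energy (\<lambda>x. trunc \<alpha> (us k x - us (k + j) x)) \<le> \<alpha> * (2 * \<delta> k) / c" if a: "\<alpha> > 0" for \<alpha> k j
  proof -
    note B = trunc_diff_energy_bound[OF us us fs(1) fs(1) a, of k "k + j"]
    show "X (\<lambda>x. trunc \<alpha> (us k x - us (k + j) x))" by (rule B)
    have "c * energy (\<lambda>x. trunc \<alpha> (us k x - us (k + j) x)) \<le> \<alpha> * (\<integral>x. \<bar>fs k x - fs (k + j) x\<bar> \<partial>lebesgue)"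
      using B(2) by (simp add: c_def)
    also have "\<dots> \<le> \<alpha> * (2 * \<delta> k)" using a by (intro mult_left_mono fsfs) auto
    finally show "energy (\<lambda>x. trunc \<alpha> (us k x - us (k + j) x)) \<le> \<alpha> * (2 * \<delta> k) / c"
      using c0 by (simp add: le_divide_eq mult.commute)
  qed
  have p1: "p \<ge> 1" using p2 by simp
  obtain H where H: "integrable lebesgue H" "\<forall>x. 0 \<le> H x"
    "AE x in lebesgue. \<forall>k. \<bar>trunc 1 (us k x - us (k + 1) x)\<bar> \<le> (1/2) ^ k * H x powr (1 / p)"
  proof -
    have i: "integrable lebesgue (\<lambda>x. \<bar>trunc 1 (us k x - us (k + 1) x)\<bar> powr p)" for k
      by (rule XspaceD(6)[OF TX]) simp
    have "(\<integral>x. \<bar>trunc 1 (us k x - us (k + 1) x)\<bar> powr p \<partial>lebesgue) \<le> 2 powr (- (p + 1) * real k)" for k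
    proof -
      have "(\<integral>x. \<bar>trunc 1 (us k x - us (k + 1) x)\<bar> powr p \<partial>lebesgue) \<le> energy (\<lambda>x. trunc 1 (us k x - us (k + 1) x))"
        by (rule Lp_integral_le_energy[OF TX]) simp
      also have "\<dots> \<le> 1 * (2 * \<delta> k) / c" by (rule TE) simp
      also have "\<dots> = 2 powr (- (p + 1) * real k)" using c0 by (simp add: \<delta>_def)
      finally show ?thesis .
    qed
    from fast_dominated[OF p1 abs_ge_zero i this] show thesis using that by blast
  qed
  define u where "u x = lim (\<lambda>k. us k x)" for x
  have um: "u \<in> borel_measurable lebesgue" unfolding u_def[abs_def] by (rule borel_measurable_lim_metric[OF usm])
  have ul: "AE x in lebesgue. (\<lambda>k. us k x) \<longlonglongrightarrow> u x"
    using H(3)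
  proof eventually_elim
    case (elim x)
    define h where "h = H x powr (1 / p)"
    have h0: "h \<ge> 0" by (simp add: h_def)
    have "(\<lambda>k. (1/2) ^ k * h) \<longlonglongrightarrow> 0 * h" by (intro tendsto_mult LIMSEQ_power_zero tendsto_const) simp
    then have "eventually (\<lambda>k. (1/2) ^ k * h < 1) sequentially" by (intro order_tendstoD(2)) auto
    \<comment> \<open>From \<open>K\<close> on the bound is below 1, so truncation at level 1 is
      inactive and the estimate holds for the differences themselves.\<close>
    then obtain K where K: "\<forall>k\<ge>K. (1/2) ^ k * h < 1" unfolding eventually_sequentially by blast
    have "convergent (\<lambda>n. us (n + K) x)"
    proof (rule summable_diff_convergent(1)[where c=h])
      fix n
      have le: "\<bar>trunc 1 (us (n + K) x - us (n + K + 1) x)\<bar> \<le> (1/2) ^ (n + K) * h"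
        using elim by (simp add: h_def)
      moreover have "(1/2) ^ (n + K) * h < 1" using K by simp
      ultimately have "\<bar>us (n + K) x - us (n + K + 1) x\<bar> \<le> (1/2) ^ (n + K) * h"
        unfolding abs_trunc_1 by linarith
      also have "\<dots> \<le> (1/2) ^ n * h" using h0 by (intro mult_right_mono power_decreasing) auto
      finally show "norm (us (Suc n + K) x - us (n + K) x) \<le> (1/2) ^ n * h" by (simp add: abs_minus_commute)
    qed
    then have "convergent (\<lambda>k. us k x)" using convergent_ignore_initial_segment[of "\<lambda>k. us k x" K] by simp
    then show ?case by (simp add: u_def convergent_LIMSEQ_iff)
  qed
  have tl: "(\<lambda>k. trunc \<alpha> (y k)) \<longlonglongrightarrow> trunc \<alpha> l" if "y \<longlonglongrightarrow> l" for \<alpha> l and y :: "nat \<Rightarrow> real"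
    unfolding trunc_def by (intro tendsto_max tendsto_min tendsto_const that)
  have Tm: "(\<lambda>x. trunc \<alpha> (u x)) \<in> borel_measurable lebesgue" for \<alpha>
    by (rule measurable_compose[OF um trunc_measurable])
  have U: "X (\<lambda>x. trunc \<alpha> (u x))" "energy (\<lambda>x. trunc \<alpha> (u x)) \<le> \<alpha> * (\<integral>x. \<bar>f x\<bar> \<partial>lebesgue)" if a: "\<alpha> > 0" for \<alpha>
  proof -
    have X: "X (\<lambda>x. trunc \<alpha> (us k x))" for k by (rule X_trunc(1)[OF usX a])
    have E: "energy (\<lambda>x. trunc \<alpha> (us k x)) \<le> \<alpha> * (\<integral>x. \<bar>f x\<bar> \<partial>lebesgue)" for k
    proof -
      \<comment> \<open>Data obtained by truncating \<open>f\<close> have no larger L^1 norm, so the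
        sharp constant holds for every index before the limit is taken.\<close>
      have "(\<integral>x. \<bar>fs k x\<bar> \<partial>lebesgue) \<le> (\<integral>x. \<bar>f x\<bar> \<partial>lebesgue)"
      proof (rule integral_mono)
        show "\<bar>fs k x\<bar> \<le> \<bar>f x\<bar>" for x by (simp add: fs_def trunc_bounds)
      qed (use fs(1)[of k] f in auto)
      then have "\<alpha> * (\<integral>x. \<bar>fs k x\<bar> \<partial>lebesgue) \<le> \<alpha> * (\<integral>x. \<bar>f x\<bar> \<partial>lebesgue)" using a by (intro mult_left_mono) auto
      then show ?thesis using trunc_energy_bound[OF us fs(1) a, of k] by linarith
    qed
    have L: "AE x in lebesgue. (\<lambda>k. trunc \<alpha> (us k x)) \<longlonglongrightarrow> trunc \<alpha> (u x)" using ul by eventually_elim (rule tl)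
    show "X (\<lambda>x. trunc \<alpha> (u x))" "energy (\<lambda>x. trunc \<alpha> (u x)) \<le> \<alpha> * (\<integral>x. \<bar>f x\<bar> \<partial>lebesgue)"
      by (rule energy_closure[OF X E L Tm])+
  qed
  have Dj: "X (\<lambda>x. trunc \<alpha> (us j x - u x))" "energy (\<lambda>x. trunc \<alpha> (us j x - u x)) \<le> \<alpha> * (2 * \<delta> j) / c" if a: "\<alpha> > 0" for \<alpha> j
  proof -
    \<comment> \<open>Here \<open>j\<close> stays fixed while \<open>k\<close> grows. The energy
      bound depends on the first index only, so lower semicontinuity carries it to the difference
      with \<open>u\<close>.\<close>
    have L: "AE x in lebesgue. (\<lambda>k. trunc \<alpha> (us j x - us (j + k) x)) \<longlonglongrightarrow> trunc \<alpha> (us j x - u x)"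
      using ul
    proof eventually_elim
      case (elim x)
      have "(\<lambda>k. us (j + k) x) \<longlonglongrightarrow> u x" using LIMSEQ_ignore_initial_segment[OF elim, of j] by (simp add: add.commute)
      then show ?case by (intro tl tendsto_diff tendsto_const)
    qed
    have m: "(\<lambda>x. trunc \<alpha> (us j x - u x)) \<in> borel_measurable lebesgue"
      by (rule measurable_compose[OF borel_measurable_diff[OF usm um] trunc_measurable])
    show "X (\<lambda>x. trunc \<alpha> (us j x - u x))" "energy (\<lambda>x. trunc \<alpha> (us j x - u x)) \<le> \<alpha> * (2 * \<delta> j) / c"
      by (rule energy_closure[OF TX[OF a] TE[OF a] L m])+
  qed
  have lim: "(\<lambda>j. Xnorm V p (\<lambda>x. trunc \<alpha> (us j x - u x))) \<longlonglongrightarrow> 0" if a: "\<alpha> > 0" for \<alpha>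
  proof -
    have "(\<lambda>j. \<alpha> * (2 * \<delta> j) / c) \<longlonglongrightarrow> \<alpha> * (2 * 0) / c"
      using c0 by (intro tendsto_divide tendsto_mult tendsto_const \<delta>lim) auto
    then have l0: "(\<lambda>j. \<alpha> * (2 * \<delta> j) / c) \<longlonglongrightarrow> 0" by simp
    have "norm (energy (\<lambda>x. trunc \<alpha> (us j x - u x))) \<le> \<alpha> * (2 * \<delta> j) / c" for j
      using Dj(2)[OF a] energy_nonneg by simp
    then have "(\<lambda>j. energy (\<lambda>x. trunc \<alpha> (us j x - u x))) \<longlonglongrightarrow> 0"
      by (intro Lim_null_comparison[OF always_eventually[OF allI] l0])
    then have "(\<lambda>j. energy (\<lambda>x. trunc \<alpha> (us j x - u x)) powr (1 / p)) \<longlonglongrightarrow> 0 powr (1 / p)"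
      by (rule tendsto_powr2) (use p2 energy_nonneg in auto)
    then show ?thesis unfolding Xnorm_energy(1) by simp
  qed
  have "Lambda_p p u"
    unfolding Lambda_p_def using um XspaceD(6)[OF U(1)[of 1]] by (simp add: abs_trunc_1)
  moreover have "(\<lambda>j. \<integral>x. \<bar>fs j x - f x\<bar> \<partial>lebesgue) \<longlonglongrightarrow> 0"
  proof (rule Lim_null_comparison[OF always_eventually[OF allI] \<delta>lim])
    fix j
    show "norm (\<integral>x. \<bar>fs j x - f x\<bar> \<partial>lebesgue) \<le> \<delta> j" using fsd[of j] by (simp add: integral_nonneg_AE)
  qed
  ultimately have "asym_energy_sol V p f u"
    unfolding asym_energy_sol_def using U(1) fs us Dj(1) lim by blast
  then show ?thesis using U(2) by blast
qed

text \<open>The solutions may come with different approximating data, but both data sequences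
  converge to \<open>f\<close>. Comparing the weak solutions index by index therefore joins
  \<open>u\<close> to \<open>v\<close> through three errors whose energies all vanish.\<close>

lemma asym_energy_sol_unique:
  assumes f: "integrable lebesgue f" and u: "asym_energy_sol V p f u" and v: "asym_energy_sol V p f v"
  shows "AE x in lebesgue. v x = u x"
proof -
  obtain fs us where F0: "\<forall>j. integrable lebesgue (fs j) \<and> Lp (p / (p - 1)) (fs j)"
    "(\<lambda>j. \<integral>x. \<bar>fs j x - f x\<bar> \<partial>lebesgue) \<longlonglongrightarrow> 0" "\<forall>j. weak_energy_sol V p (fs j) (us j)"
    "\<forall>\<alpha>>0. (\<forall>j. X (\<lambda>x. trunc \<alpha> (us j x - u x))) \<and> (\<lambda>j. Xnorm V p (\<lambda>x. trunc \<alpha> (us j x - u x))) \<longlonglongrightarrow> 0"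
    using u unfolding asym_energy_sol_def by blast
  note F1 = spec[OF F0(4), of 1, THEN mp, OF zero_less_one]
  have F: "\<And>j. integrable lebesgue (fs j)" "(\<lambda>j. \<integral>x. \<bar>fs j x - f x\<bar> \<partial>lebesgue) \<longlonglongrightarrow> 0"
    "\<And>j. weak_energy_sol V p (fs j) (us j)" "\<And>j. X (\<lambda>x. trunc 1 (us j x - u x))"
    "(\<lambda>j. Xnorm V p (\<lambda>x. trunc 1 (us j x - u x))) \<longlonglongrightarrow> 0"
    using F0(1-3) F1 by blast+
  obtain gs vs where G0: "\<forall>j. integrable lebesgue (gs j) \<and> Lp (p / (p - 1)) (gs j)"
    "(\<lambda>j. \<integral>x. \<bar>gs j x - f x\<bar> \<partial>lebesgue) \<longlonglongrightarrow> 0" "\<forall>j. weak_energy_sol V p (gs j) (vs j)"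
    "\<forall>\<alpha>>0. (\<forall>j. X (\<lambda>x. trunc \<alpha> (vs j x - v x))) \<and> (\<lambda>j. Xnorm V p (\<lambda>x. trunc \<alpha> (vs j x - v x))) \<longlonglongrightarrow> 0"
    using v unfolding asym_energy_sol_def by blast
  note G1 = spec[OF G0(4), of 1, THEN mp, OF zero_less_one]
  have G: "\<And>j. integrable lebesgue (gs j)" "(\<lambda>j. \<integral>x. \<bar>gs j x - f x\<bar> \<partial>lebesgue) \<longlonglongrightarrow> 0"
    "\<And>j. weak_energy_sol V p (gs j) (vs j)" "\<And>j. X (\<lambda>x. trunc 1 (vs j x - v x))"
    "(\<lambda>j. Xnorm V p (\<lambda>x. trunc 1 (vs j x - v x))) \<longlonglongrightarrow> 0"
    using G0(1-3) G1 by blast+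
  have um: "u \<in> borel_measurable lebesgue" and vm: "v \<in> borel_measurable lebesgue"
    using u v unfolding asym_energy_sol_def Lambda_p_def by blast+
  define c where "c = (2::real) powr (1 - p)"
  have c0: "c > 0" by (simp add: c_def)
  define a where "a j = energy (\<lambda>x. trunc 1 (us j x - u x))" for j
  define b where "b j = energy (\<lambda>x. trunc 1 (vs j x - v x))" for j
  define d where "d j = ((\<integral>x. \<bar>fs j x - f x\<bar> \<partial>lebesgue) + (\<integral>x. \<bar>gs j x - f x\<bar> \<partial>lebesgue)) / c" for j
  have powlim: "(\<lambda>j. Xnorm V p (w j) powr p) \<longlonglongrightarrow> 0" if "(\<lambda>j. Xnorm V p (w j)) \<longlonglongrightarrow> 0" for w :: "nat \<Rightarrow> 'a \<Rightarrow> real"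
  proof -
    have "(\<lambda>j. Xnorm V p (w j) powr p) \<longlonglongrightarrow> 0 powr p"
      by (rule tendsto_powr2[OF that tendsto_const]) (use p2 in \<open>auto simp: Xnorm_def\<close>)
    then show ?thesis by simp
  qed
  have al: "a \<longlonglongrightarrow> 0" "b \<longlonglongrightarrow> 0"
    using powlim[OF F(5)] powlim[OF G(5)] unfolding Xnorm_energy(2) a_def[abs_def] b_def[abs_def] by simp_all
  have "d \<longlonglongrightarrow> (0 + 0) / c"
    unfolding d_def[abs_def] using c0 by (intro tendsto_divide tendsto_add F(2) G(2) tendsto_const) auto
  then have dl: "d \<longlonglongrightarrow> 0" by simp
  have D: "X (\<lambda>x. trunc 1 (us j x - vs j x))" "energy (\<lambda>x. trunc 1 (us j x - vs j x)) \<le> d j" for j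
  proof -
    note B = trunc_diff_energy_bound[OF F(3) G(3) F(1) G(1) zero_less_one, of j j]
    show "X (\<lambda>x. trunc 1 (us j x - vs j x))" by (rule B)
    have "(\<integral>x. \<bar>fs j x - gs j x\<bar> \<partial>lebesgue) \<le> (\<integral>x. \<bar>fs j x - f x\<bar> + \<bar>gs j x - f x\<bar> \<partial>lebesgue)"
      by (rule integral_mono) (use F(1)[of j] G(1)[of j] f in auto)
    also have "\<dots> = (\<integral>x. \<bar>fs j x - f x\<bar> \<partial>lebesgue) + (\<integral>x. \<bar>gs j x - f x\<bar> \<partial>lebesgue)"
      using F(1)[of j] G(1)[of j] f by simp
    finally have "c * energy (\<lambda>x. trunc 1 (us j x - vs j x)) \<le> (\<integral>x. \<bar>fs j x - f x\<bar> \<partial>lebesgue) + (\<integral>x. \<bar>gs j x - f x\<bar> \<partial>lebesgue)"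
      using B(2) by (simp add: c_def)
    then show "energy (\<lambda>x. trunc 1 (us j x - vs j x)) \<le> d j" using c0 by (simp add: d_def le_divide_eq mult.commute)
  qed
  define C where "C = (2::real) powr p"
  have C: "C \<ge> 0" by (simp add: C_def)
  \<comment> \<open>The function min(|s|, 1) is subadditive, which makes the triangle inequality
    available for truncations at level 1; splitting a p-th power into three terms uses the constant
    twice.\<close>
  have tri: "\<bar>trunc 1 (v x - u x)\<bar> powr p \<le> C * (\<bar>trunc 1 (us j x - u x)\<bar> powr p
      + C * (\<bar>trunc 1 (us j x - vs j x)\<bar> powr p + \<bar>trunc 1 (vs j x - v x)\<bar> powr p))" for x j
  proof -
    define x1 where "x1 = \<bar>trunc 1 (us j x - u x)\<bar>"
    define x2 where "x2 = \<bar>trunc 1 (us j x - vs j x)\<bar>"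
    define x3 where "x3 = \<bar>trunc 1 (vs j x - v x)\<bar>"
    have x0: "0 \<le> x1" "0 \<le> x2" "0 \<le> x3" by (simp_all add: x1_def x2_def x3_def)
    have "\<bar>trunc 1 (v x - u x)\<bar> \<le> x1 + (x2 + x3)"
      unfolding x1_def x2_def x3_def abs_trunc_1 by linarith
    then have "\<bar>trunc 1 (v x - u x)\<bar> powr p \<le> (x1 + (x2 + x3)) powr p" using p2 by (intro powr_mono2) auto
    also have "\<dots> \<le> C * (x1 powr p + (x2 + x3) powr p)"
      using norm_add_powr[of p x1 "x2 + x3"] p2 x0 by (simp add: C_def)
    also have "\<dots> \<le> C * (x1 powr p + C * (x2 powr p + x3 powr p))"
      using norm_add_powr[of p x2 x3] p2 x0 C by (intro mult_left_mono add_left_mono) (simp_all add: C_def)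
    finally show ?thesis by (simp add: x1_def x2_def x3_def)
  qed
  have m: "(\<lambda>x. \<bar>trunc 1 (v x - u x)\<bar> powr p) \<in> borel_measurable lebesgue"
    using measurable_compose[OF borel_measurable_diff[OF vm um] trunc_measurable[of 1]] by measurable
  have iR: "integrable lebesgue (\<lambda>x. C * (\<bar>trunc 1 (us j x - u x)\<bar> powr p
      + C * (\<bar>trunc 1 (us j x - vs j x)\<bar> powr p + \<bar>trunc 1 (vs j x - v x)\<bar> powr p)))" for j
    using XspaceD(6)[OF F(4)[of j]] XspaceD(6)[OF G(4)[of j]] XspaceD(6)[OF D(1)[of j]] by simp
  have i: "integrable lebesgue (\<lambda>x. \<bar>trunc 1 (v x - u x)\<bar> powr p)"
    by (rule Bochner_Integration.integrable_bound[OF iR[of 0] m]) (rule AE_I2, use tri[of _ 0] C in simp)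
  have le: "(\<integral>x. \<bar>trunc 1 (v x - u x)\<bar> powr p \<partial>lebesgue) \<le> C * (a j + C * (d j + b j))" for j
  proof -
    have "(\<integral>x. \<bar>trunc 1 (v x - u x)\<bar> powr p \<partial>lebesgue) \<le> (\<integral>x. C * (\<bar>trunc 1 (us j x - u x)\<bar> powr p
      + C * (\<bar>trunc 1 (us j x - vs j x)\<bar> powr p + \<bar>trunc 1 (vs j x - v x)\<bar> powr p)) \<partial>lebesgue)"
      by (rule integral_mono[OF i iR tri])
    also have "\<dots> = C * ((\<integral>x. \<bar>trunc 1 (us j x - u x)\<bar> powr p \<partial>lebesgue)
      + C * ((\<integral>x. \<bar>trunc 1 (us j x - vs j x)\<bar> powr p \<partial>lebesgue) + (\<integral>x. \<bar>trunc 1 (vs j x - v x)\<bar> powr p \<partial>lebesgue)))"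
      using XspaceD(6)[OF F(4)[of j]] XspaceD(6)[OF G(4)[of j]] XspaceD(6)[OF D(1)[of j]] by simp
    also have "\<dots> \<le> C * (a j + C * (d j + b j))"
      unfolding a_def b_def
      by (intro mult_left_mono add_mono C Lp_integral_le_energy F(4) G(4) order_trans[OF Lp_integral_le_energy[OF D(1)] D(2)])
    finally show ?thesis .
  qed
  have "(\<lambda>j. C * (a j + C * (d j + b j))) \<longlonglongrightarrow> C * (0 + C * (0 + 0))"
    by (intro tendsto_mult tendsto_add tendsto_const al dl)
  then have "(\<lambda>j. C * (a j + C * (d j + b j))) \<longlonglongrightarrow> 0" by simp
  then have "(\<integral>x. \<bar>trunc 1 (v x - u x)\<bar> powr p \<partial>lebesgue) \<le> 0"
    by (rule LIMSEQ_le_const) (use le in blast)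
  then have "(\<integral>x. \<bar>trunc 1 (v x - u x)\<bar> powr p \<partial>lebesgue) = 0"
    by (intro antisym integral_nonneg_AE) auto
  then have "AE x in lebesgue. \<bar>trunc 1 (v x - u x)\<bar> powr p = 0"
    using integral_nonneg_eq_0_iff_AE[OF i] by simp
  then show ?thesis
    by eventually_elim (simp add: trunc_def min_def max_def split: if_splits)
qed

end

theorem theorem1p1:
  fixes V f :: "'a::euclidean_space \<Rightarrow> real" and p :: real
  assumes "p \<ge> 2"
    and "integrable lebesgue f"
    and "Linf_loc V"
    and "AE x in lebesgue. 1 \<le> V x"
    and "confining_in_measure V"
  shows "\<exists>u. asym_energy_sol V p f u
           \<and> (\<forall>v. asym_energy_sol V p f v \<longrightarrow> (AE x in lebesgue. v x = u x))
           \<and> (\<forall>\<alpha>>0. Xnorm V p (\<lambda>x. trunc \<alpha> (u x)) powr p \<le> \<alpha> * (\<integral>x. \<bar>f x\<bar> \<partial>lebesgue))"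
proof -
  interpret potential V p
    by standard (use assms in \<open>auto simp: Linf_loc_def\<close>)
  show ?thesis
    using asym_energy_sol_exists[OF assms(2)] asym_energy_sol_unique[OF assms(2)] unfolding Xnorm_energy(2) by blast
qed

end
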